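(* Let $n\ge 3$ and $1<p<\frac{n+2}{n-2}$. Let $(M,g)$ be the $n$-dimensional Riemannian model with metric $ds^2=dr^2+\psi(r)^2d\Theta^2$, where $\psi\in C^2([0,+\infty))$ is positive on $(0,+\infty)$ and satisfies $\psi(0)=\psi''(0)=0$, $\psi'(0)=1$, $\psi'(r)\ge 0$ for every $r>0$, and $\liminf_{r\to+\infty}\frac{\psi'(r)}{\psi(r)}>0$. Then the equation $-\Delta_g u=|u|^{p-1}u$ on $M$ admits a positive radial solution $u\in H^1(M)$.
   Context: A Riemannian model $(M,g)$ of dimension $n$ is a manifold with a pole $o$ (diffeomorphic to $\mathbb{R}^n$, with empty cut locus of $o$) whose metric in polar coordinates around $o$ is $ds^2=dr^2+\psi(r)^2d\Theta^2$, $r>0$, $\Theta\in\mathbb{S}^{n-1}$, where $d\Theta^2$ is the canonical metric of the unit sphere $\mathbb{S}^{n-1}$ and $r$ is the Riemannian distance from $o$. $\Delta_g$, $\nabla_g$, $V_g$ denote the Laplace-Beltrami operator, the Riemannian gradient and the Riemannian measure. A function is radial if it depends only on $r$; for radial $f$, $\Delta_g f=f''+(n-1)\frac{\psi'}{\psi}f'$. $H^1(M)=\{u\in L^2(V_g):\nabla_g u\in L^2(V_g)\}$. *)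

theory Defs
  imports "HOL-Analysis.Analysis"
begin

text \<open>
  Riemannian metrics on the manifold \<open>real ^ 'n\<close> are given by their Gram matrices
  \<open>G x\<close> in the global Cartesian chart; the operators below are the usual coordinate
  expressions.
\<close>

definition partial_deriv :: "'n::finite \<Rightarrow> (real ^ 'n \<Rightarrow> real) \<Rightarrow> real ^ 'n \<Rightarrow> real" where
  "partial_deriv i f x = deriv (\<lambda>t. f (x + t *\<^sub>R axis i 1)) 0"

definition riem_inner ::
  "(real ^ 'n \<Rightarrow> real ^ 'n ^ 'n) \<Rightarrow> real ^ 'n \<Rightarrow> real ^ 'n \<Rightarrow> real ^ 'n \<Rightarrow> real" where
  "riem_inner G x v w = v \<bullet> (G x *v w)"

definition riem_measure :: "(real ^ 'n \<Rightarrow> real ^ 'n ^ 'n) \<Rightarrow> (real ^ 'n::finite) measure" where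
  "riem_measure G = density lborel (\<lambda>x. ennreal (sqrt (det (G x))))"

definition riem_grad ::
  "(real ^ 'n \<Rightarrow> real ^ 'n ^ 'n) \<Rightarrow> (real ^ 'n \<Rightarrow> real) \<Rightarrow> real ^ 'n \<Rightarrow> real ^ 'n::finite" where
  "riem_grad G u x = matrix_inv (G x) *v (\<chi> i. partial_deriv i u x)"

definition riem_div ::
  "(real ^ 'n \<Rightarrow> real ^ 'n ^ 'n) \<Rightarrow> (real ^ 'n \<Rightarrow> real ^ 'n) \<Rightarrow> real ^ 'n::finite \<Rightarrow> real" where
  "riem_div G X x =
     (\<Sum>i\<in>UNIV. partial_deriv i (\<lambda>y. sqrt (det (G y)) * X y $ i) x) / sqrt (det (G x))"

definition laplace_beltrami ::
  "(real ^ 'n \<Rightarrow> real ^ 'n ^ 'n) \<Rightarrow> (real ^ 'n \<Rightarrow> real) \<Rightarrow> real ^ 'n::finite \<Rightarrow> real" where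
  "laplace_beltrami G u x = riem_div G (riem_grad G u) x"

definition C1_field :: "(real ^ 'n::finite \<Rightarrow> real ^ 'n) \<Rightarrow> bool" where
  "C1_field X \<longleftrightarrow>
     (\<exists>DX. (\<forall>x. (X has_derivative (\<lambda>h. DX x *v h)) (at x)) \<and> continuous_on UNIV DX)"

definition C2_function :: "(real ^ 'n::finite \<Rightarrow> real) \<Rightarrow> bool" where
  "C2_function u \<longleftrightarrow>
     (\<exists>Du. (\<forall>x. (u has_derivative (\<lambda>h. Du x \<bullet> h)) (at x)) \<and> C1_field Du)"

definition test_field :: "(real ^ 'n::finite \<Rightarrow> real ^ 'n) \<Rightarrow> bool" where
  "test_field \<Phi> \<longleftrightarrow> C1_field \<Phi> \<and> compact (closure {x. \<Phi> x \<noteq> 0})"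

text \<open>
  The gradient in the definition of \<open>H\<^sup>1\<close> is the distributional one. The test fields are only
  required to be \<open>C\<^sup>1\<close>; by mollification this is equivalent to testing with smooth fields.
\<close>

definition weak_riem_grad ::
  "(real ^ 'n \<Rightarrow> real ^ 'n ^ 'n) \<Rightarrow> (real ^ 'n \<Rightarrow> real) \<Rightarrow> (real ^ 'n::finite \<Rightarrow> real ^ 'n) \<Rightarrow> bool"
  where
  "weak_riem_grad G u X \<longleftrightarrow>
     (\<forall>\<Phi>. test_field \<Phi> \<longrightarrow>
        (LINT x|riem_measure G. riem_inner G x (X x) (\<Phi> x)) =
        - (LINT x|riem_measure G. u x * riem_div G \<Phi> x))"

definition L2_function ::
  "(real ^ 'n \<Rightarrow> real ^ 'n ^ 'n) \<Rightarrow> (real ^ 'n::finite \<Rightarrow> real) \<Rightarrow> bool" where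
  "L2_function G u \<longleftrightarrow> u \<in> borel_measurable borel \<and> integrable (riem_measure G) (\<lambda>x. (u x)\<^sup>2)"

definition L2_field ::
  "(real ^ 'n \<Rightarrow> real ^ 'n ^ 'n) \<Rightarrow> (real ^ 'n::finite \<Rightarrow> real ^ 'n) \<Rightarrow> bool" where
  "L2_field G X \<longleftrightarrow>
     X \<in> borel_measurable borel \<and> integrable (riem_measure G) (\<lambda>x. riem_inner G x (X x) (X x))"

definition H1 :: "(real ^ 'n \<Rightarrow> real ^ 'n ^ 'n) \<Rightarrow> (real ^ 'n::finite \<Rightarrow> real) set" where
  "H1 G = {u. L2_function G u \<and> (\<exists>X. weak_riem_grad G u X \<and> L2_field G X)}"

text \<open>
  The Riemannian model with pole \<open>0\<close>, in the chart \<open>x = r \<Theta>\<close> (normal coordinates at the pole),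
  where \<open>r = norm x\<close> and \<open>\<Theta> = x / norm x\<close>. The value at the pole is the continuous extension
  when \<open>\<psi> 0 = 0\<close> and \<open>\<psi>' 0 = 1\<close>; under these conditions and \<open>\<psi>'' 0 = 0\<close> the metric is
  \<open>C\<^sup>1\<close> on all of \<open>real ^ 'n\<close>, so that \<open>laplace_beltrami\<close> makes sense at the pole too.
\<close>

definition model_metric :: "(real \<Rightarrow> real) \<Rightarrow> real ^ 'n::finite \<Rightarrow> real ^ 'n ^ 'n" where
  "model_metric \<psi> x =
     (if x = 0 then mat 1
      else let r = norm x; \<Theta> = (1 / r) *\<^sub>R x in
        \<chi> i j. \<Theta> $ i * \<Theta> $ j
              + (\<psi> r / r)\<^sup>2 * ((if i = j then 1 else 0) - \<Theta> $ i * \<Theta> $ j))"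

lemma riem_inner_model:
  fixes x v w :: "real ^ 'n::finite"
  assumes "x \<noteq> 0"
  defines "\<Theta> \<equiv> (1 / norm x) *\<^sub>R x"
  shows "riem_inner (model_metric \<psi>) x v w =
     (v \<bullet> \<Theta>) * (w \<bullet> \<Theta>) + (\<psi> (norm x) / norm x)\<^sup>2 * (v \<bullet> w - (v \<bullet> \<Theta>) * (w \<bullet> \<Theta>))"
proof -
  define c where "c = (\<psi> (norm x) / norm x)\<^sup>2"
  have "(model_metric \<psi> x *v w) $ i = (1 - c) * (w \<bullet> \<Theta>) * \<Theta> $ i + c * w $ i" for i
  proof -
    have "(model_metric \<psi> x *v w) $ i =
      (\<Sum>j\<in>UNIV. (1 - c) * \<Theta> $ i * (w $ j * \<Theta> $ j) + (if i = j then c * w $ j else 0))"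
      using assms(1)
      unfolding model_metric_def Let_def matrix_vector_mult_def \<Theta>_def[symmetric] c_def[symmetric]
      by (auto intro!: sum.cong simp: algebra_simps)
    also have "\<dots> = (1 - c) * \<Theta> $ i * (w \<bullet> \<Theta>) + c * w $ i"
      by (simp add: sum.distrib inner_vec_def flip: sum_distrib_left)
    finally show ?thesis by (simp add: mult_ac)
  qed
  then have eq: "model_metric \<psi> x *v w = ((1 - c) * (w \<bullet> \<Theta>)) *\<^sub>R \<Theta> + c *\<^sub>R w"
    by (simp add: vec_eq_iff)
  show ?thesis
    unfolding riem_inner_def c_def[symmetric] eq
    by (simp add: inner_add_right algebra_simps)
qed

text \<open>
  The metric is \<open>ds\<^sup>2 = dr\<^sup>2 + \<psi>(r)\<^sup>2 d\<Theta>\<^sup>2\<close>: at the point \<open>r \<Theta>\<close>, the polar map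
  \<open>(r, \<Theta>) \<mapsto> r \<Theta>\<close> sends a tangent vector \<open>(a, \<xi>)\<close> of \<open>(0,\<infinity>) \<times> S\<^sup>n\<^sup>-\<^sup>1\<close> to \<open>a \<Theta> + r \<xi>\<close>.
\<close>

lemma model_metric_polar:
  fixes \<Theta> \<xi> \<eta> :: "real ^ 'n::finite"
  assumes "r > 0" "norm \<Theta> = 1" "\<xi> \<bullet> \<Theta> = 0" "\<eta> \<bullet> \<Theta> = 0"
  shows "riem_inner (model_metric \<psi>) (r *\<^sub>R \<Theta>) (a *\<^sub>R \<Theta> + r *\<^sub>R \<xi>) (b *\<^sub>R \<Theta> + r *\<^sub>R \<eta>)
     = a * b + (\<psi> r)\<^sup>2 * (\<xi> \<bullet> \<eta>)"
proof -
  have 0: "r *\<^sub>R \<Theta> \<noteq> 0" using assms by auto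
  have 1: "\<Theta> \<bullet> \<Theta> = 1" using assms(2) by (simp add: dot_square_norm)
  have 2: "\<Theta> \<bullet> \<eta> = 0" using assms(4) by (simp add: inner_commute)
  have 3: "(1 / norm (r *\<^sub>R \<Theta>)) *\<^sub>R r *\<^sub>R \<Theta> = \<Theta>" "norm (r *\<^sub>R \<Theta>) = r" using assms by auto
  show ?thesis
    unfolding riem_inner_model[OF 0] 3 using assms(1,3,4) 1 2
    by (simp add: inner_add_left inner_add_right power2_eq_square)
qed

definition radial :: "(real ^ 'n::finite \<Rightarrow> real) \<Rightarrow> bool" where
  "radial u \<longleftrightarrow> (\<forall>x y. norm x = norm y \<longrightarrow> u x = u y)"

end

theory Submission
  imports Defs
begin

text \<open>
Why the theorem is true. Write \<open>V = \<psi>\<^sup>n\<^sup>-\<^sup>1\<close> and \<open>h = V' / V\<close>. A radial function \<open>u(r)\<close> solves the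
equation exactly when \<open>(V u')' = - V u\<^sup>p\<close>, that is \<open>u'' + h u' + u\<^sup>p = 0\<close>, with \<open>u(0) = \<alpha>\<close> and
\<open>u'(0) = 0\<close>. The proof is a shooting argument in the height \<open>\<alpha>\<close>.

The initial value problem, singular at the pole, is a fixed point equation for an integral operator
that is a contraction in an exponentially weighted supremum norm. This gives a family of solutions
depending continuously on \<open>\<alpha>\<close> (\<open>shooting_fixed_point\<close>, \<open>emden_family\<close>).

Large \<open>\<alpha>\<close>: the solution changes sign (\<open>large_data_change_sign\<close>). Near the pole \<open>r h(r)\<close> is close to
\<open>n - 1\<close>, and since \<open>p\<close> is subcritical there is an \<open>a\<close> strictly between \<open>(n-2)/2\<close> and \<open>n/(p+1)\<close>. As long
as \<open>u > 0\<close> the Pohozaev functional \<open>r V (u'\<^sup>2/2 + u\<^sup>p\<^sup>+\<^sup>1/(p+1)) + a V u u'\<close> increases on an interval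
\<open>(0,d)\<close> that does not depend on \<open>\<alpha>\<close>. There it reaches the size of a positive power of \<open>\<alpha>\<close>, while the
universal decay estimate \<open>decay_bound\<close> keeps it below a constant independent of \<open>\<alpha>\<close>.

Small \<open>\<alpha>\<close>: the solution stays positive. Far out \<open>h \<ge> 2 \<kappa> > 0\<close>, because \<open>\<psi>'/\<psi>\<close> has a positive lower
limit, and then \<open>u' + \<kappa> u > 0\<close> together with \<open>u\<^sup>p\<^sup>-\<^sup>1 \<le> \<kappa>\<^sup>2\<close> at one radius forbids a later zero
(\<open>barrier\<close>, \<open>small_data_positive\<close>).

Let \<open>\<alpha>\<close> be the infimum of the heights whose solution changes sign. By continuity its own solution is
positive, but it is the limit of solutions that do change sign. This excludes a positive limit at
infinity, for then the total drop of all solutions beyond a large radius would be uniformly small;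
and once \<open>u\<close> is small the barrier excludes \<open>u' + \<kappa> u > 0\<close>. Hence \<open>- u' \<ge> \<kappa> u\<close> for all large \<open>r\<close>
(\<open>exists_fast_decaying_solution\<close>). In that range \<open>(- V u u')' \<le> - V u'\<^sup>2 / 2\<close>, so \<open>V u'\<^sup>2\<close> and
\<open>V u\<^sup>2 \<le> V u'\<^sup>2 / \<kappa>\<^sup>2\<close> have finite integrals (\<open>fast_decay_energy\<close>), which is membership in \<open>H\<^sup>1\<close>.

The rest transfers this to \<open>\<real>\<^sup>n\<close>. In the Cartesian chart \<open>sqrt (det G) = (\<psi>(r)/r)\<^sup>n\<^sup>-\<^sup>1\<close>, and the radial
direction is an eigenvector of the metric with eigenvalue 1, so the Riemannian gradient of \<open>u(|x|)\<close> is
the Euclidean one, \<open>q(|x|) x\<close> with \<open>q(r) = u'(r)/r\<close>. The behaviour of \<open>q\<close> at the pole gives the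
regularity there, and the gradient is also the weak one because integrals of compactly supported
\<open>C\<^sup>1\<close> partial derivatives vanish.
\<close>

section \<open>Calculus on an interval\<close>

lemma le_of_deriv_nonneg:
  fixes F :: "real \<Rightarrow> real"
  assumes "a \<le> b" and cont: "continuous_on {a..b} F"
    and der: "\<And>x. a < x \<Longrightarrow> x < b \<Longrightarrow> (F has_real_derivative F' x) (at x)"
    and nonneg: "\<And>x. a < x \<Longrightarrow> x < b \<Longrightarrow> F' x \<ge> 0"
  shows "F a \<le> F b"
proof (rule DERIV_nonneg_imp_increasing_open[OF assms(1)])
  show "\<exists>y. (F has_real_derivative y) (at x) \<and> 0 \<le> y" if "a < x" "x < b" for x
    using der[OF that] nonneg[OF that] by blast
qed (rule cont)

lemma powr_lipschitz:
  fixes p M x y :: real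
  assumes p: "p > 1" and "0 \<le> x" "x \<le> M" "0 \<le> y" "y \<le> M"
  shows "\<bar>x powr p - y powr p\<bar> \<le> p * M powr (p - 1) * \<bar>x - y\<bar>"
proof -
  have *: "b powr p - a powr p \<le> p * M powr (p - 1) * (b - a)"
    if ab: "0 \<le> a" "a \<le> b" "b \<le> M" for a b :: real
  proof -
    have "p * M powr (p - 1) * a - a powr p \<le> p * M powr (p - 1) * b - b powr p"
    proof (rule le_of_deriv_nonneg[OF ab(2)])
      show "continuous_on {a..b} (\<lambda>x. p * M powr (p - 1) * x - x powr p)"
        using p ab by (intro continuous_intros continuous_on_powr') auto
      fix x assume x: "a < x" "x < b"
      show "((\<lambda>x. p * M powr (p - 1) * x - x powr p) has_real_derivative
          p * M powr (p - 1) - p * x powr (p - 1)) (at x)"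
        using x ab by (auto intro!: derivative_eq_intros)
      show "p * M powr (p - 1) - p * x powr (p - 1) \<ge> 0"
        using x ab p by (auto intro!: powr_mono2)
    qed
    then show ?thesis by (simp add: algebra_simps)
  qed
  have mono: "b powr p \<ge> a powr p" if "0 \<le> a" "a \<le> b" for a b :: real
    using that p by (intro powr_mono2) auto
  show ?thesis
    using *[of x y] *[of y x] mono[of x y] mono[of y x] assms by (cases "x \<le> y") (auto simp: abs_if)
qed

lemma tendsto_right_of_continuous:
  fixes f :: "real \<Rightarrow> 'a::topological_space"
  assumes "continuous_on {a..} f"
  shows "(f \<longlongrightarrow> f a) (at_right a)"
proof -
  have "(f \<longlongrightarrow> f a) (at a within {a..})" using assms by (simp add: continuous_on_def)
  then show ?thesis by (rule tendsto_within_subset) auto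
qed

section \<open>The radial integral operator and the shooting family\<close>

text \<open>
\<open>V\<close> plays the role of the volume density \<open>\<psi>\<^sup>N\<close> with \<open>N = n - 1\<close>. The two limits say that near the pole
it behaves like \<open>r\<^sup>N\<close>, together with its logarithmic derivative.
\<close>

locale volume_density =
  fixes V V' :: "real \<Rightarrow> real" and N :: nat
  assumes V_deriv: "\<And>r. r > 0 \<Longrightarrow> (V has_real_derivative V' r) (at r)"
    and V_cont: "continuous_on {0..} V"
    and V_0: "V 0 = 0"
    and V_pos: "\<And>r. r > 0 \<Longrightarrow> V r > 0"
    and V'_nonneg: "\<And>r. r > 0 \<Longrightarrow> V' r \<ge> 0"
    and V_asymp: "((\<lambda>r. V r / r ^ N) \<longlongrightarrow> 1) (at_right 0)"
    and V'_asymp: "((\<lambda>r. r * V' r / V r) \<longlongrightarrow> real N) (at_right 0)"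
begin

lemma V_nonneg: "r \<ge> 0 \<Longrightarrow> V r \<ge> 0"
  using V_pos[of r] V_0 by (cases "r = 0") auto

lemma V_mono:
  assumes "0 \<le> s" "s \<le> t" shows "V s \<le> V t"
proof (rule DERIV_nonneg_imp_increasing_open[OF assms(2)])
  show "continuous_on {s..t} V"
    using V_cont assms by (auto intro: continuous_on_subset)
  show "\<exists>y. (V has_real_derivative y) (at x) \<and> 0 \<le> y" if "s < x" "x < t" for x
    using V_deriv[of x] V'_nonneg[of x] that assms by (intro exI[of _ "V' x"]) auto
qed

text \<open>
\<open>avg g\<close> inverts the operator \<open>w \<mapsto> (V w)' / V\<close> with \<open>w(0) = 0\<close>. Since division by zero yields zero,
the value at \<open>s = 0\<close> is the continuous one.
\<close>

definition avg :: "(real \<Rightarrow> real) \<Rightarrow> real \<Rightarrow> real" where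
  "avg g s = integral {0..s} (\<lambda>t. V t * g t) / V s"

lemma Vg_cont:
  assumes "continuous_on {0..} g"
  shows "continuous_on {0..s} (\<lambda>t. V t * g t)"
  using assms V_cont by (intro continuous_intros) (auto intro: continuous_on_subset)

lemma Vg_int:
  assumes "continuous_on {0..} g"
  shows "(\<lambda>t. V t * g t) integrable_on {0..s}"
  by (rule integrable_continuous_real[OF Vg_cont[OF assms]])

lemma avg_0 [simp]: "avg g 0 = 0"
  by (simp add: avg_def)

lemma avg_diff:
  assumes "continuous_on {0..} g1" "continuous_on {0..} g2"
  shows "avg (\<lambda>t. g1 t - g2 t) s = avg g1 s - avg g2 s"
  using Vg_int[OF assms(1)] Vg_int[OF assms(2)]
  by (simp add: avg_def right_diff_distrib integral_diff diff_divide_distrib)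

text \<open>
As \<open>V\<close> increases, the weights \<open>V t / V s\<close> are at most 1. This removes the singularity at the pole
from all estimates.
\<close>

lemma avg_bound:
  assumes g: "continuous_on {0..} g" and w: "continuous_on {0..} w"
    and le: "\<And>t. 0 \<le> t \<Longrightarrow> t \<le> s \<Longrightarrow> \<bar>g t\<bar> \<le> w t" and s: "s \<ge> 0"
  shows "\<bar>avg g s\<bar> \<le> integral {0..s} w"
proof (cases "s = 0")
  case False
  then have sp: "s > 0" using s by simp
  have wi: "(\<lambda>t. V s * w t) integrable_on {0..s}"
    using w by (intro integrable_continuous_real continuous_intros) (auto intro: continuous_on_subset)
  have "\<bar>integral {0..s} (\<lambda>t. V t * g t)\<bar> \<le> integral {0..s} (\<lambda>t. V s * w t)"
    unfolding real_norm_def[symmetric]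
  proof (rule integral_norm_bound_integral[OF Vg_int[OF g] wi])
    fix t assume t: "t \<in> {0..s}"
    have "V t * \<bar>g t\<bar> \<le> V s * w t"
      using t by (intro mult_mono V_mono le V_nonneg) auto
    then show "norm (V t * g t) \<le> V s * w t"
      using t by (simp add: abs_mult V_nonneg)
  qed
  also have "\<dots> = V s * integral {0..s} w" by simp
  finally have "\<bar>integral {0..s} (\<lambda>t. V t * g t)\<bar> / V s \<le> integral {0..s} w"
    using V_pos[OF sp] by (simp only: pos_divide_le_eq mult.commute)
  then show ?thesis
    unfolding avg_def abs_divide using V_pos[OF sp] by (simp only: abs_of_pos)
next
  case True
  then show ?thesis by (simp add: avg_def)
qed

lemma Vavg_deriv:
  assumes g: "continuous_on {0..} g" and s: "s > 0"
  shows "((\<lambda>s. integral {0..s} (\<lambda>t. V t * g t)) has_real_derivative V s * g s) (at s)"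
proof -
  have "((\<lambda>s. integral {0..s} (\<lambda>t. V t * g t)) has_real_derivative V s * g s) (at s within {0..s+1})"
    using integral_has_real_derivative[OF Vg_cont[OF g], of s "s+1"] s by auto
  then show ?thesis
    using s at_within_Icc_at[of 0 s "s+1"] by simp
qed

lemma avg_deriv:
  assumes g: "continuous_on {0..} g" and s: "s > 0"
  shows "(avg g has_real_derivative g s - V' s / V s * avg g s) (at s)"
  unfolding avg_def using V_pos[OF s]
  by (auto intro!: derivative_eq_intros Vavg_deriv[OF g s] V_deriv[OF s] simp: field_simps)

lemma avg_cont:
  assumes g: "continuous_on {0..} g"
  shows "continuous_on {0..} (avg g)"
proof -
  have "continuous (at s within {0..}) (avg g)" if "s \<ge> 0" for s
  proof (cases "s = 0")
    case False
    then show ?thesis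
      using avg_deriv[OF g, of s] that DERIV_isCont continuous_at_imp_continuous_at_within by force
  next
    case True
    obtain B where B: "\<And>t. t \<in> {0..1} \<Longrightarrow> \<bar>g t\<bar> \<le> B"
      proof -
      have "compact (g ` {0..1})"
        using g by (intro compact_continuous_image) (auto intro: continuous_on_subset)
      from compact_imp_bounded[OF this] show ?thesis
        unfolding bounded_iff by (auto intro: that)
    qed
    have "((\<lambda>s. avg g s) \<longlongrightarrow> 0) (at 0 within {0..})"
    proof (rule Lim_null_comparison)
      show "((\<lambda>s. s * B) \<longlongrightarrow> 0) (at 0 within {0..})"
        by (auto intro!: tendsto_eq_intros)
      have "norm (avg g s) \<le> s * B" if "s \<in> {0..}" "dist s 0 < 1" for s
        using avg_bound[OF g, of "\<lambda>_. B" s] B that by (auto simp: dist_real_def)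
      then show "\<forall>\<^sub>F s in at 0 within {0..}. norm (avg g s) \<le> s * B"
        unfolding eventually_at by (auto intro!: exI[of _ 1])
    qed
    then show ?thesis using True by (simp add: continuous_within)
  qed
  then show ?thesis by (simp add: continuous_on_eq_continuous_within)
qed

lemma avg_int:
  assumes g: "continuous_on {0..} g"
  shows "avg g integrable_on {0..r}"
  using avg_cont[OF g] by (auto intro!: integrable_continuous_real intro: continuous_on_subset)

lemma integral_exp_le:
  fixes D l :: real
  assumes "l > 0" "s \<ge> 0" "D \<ge> 0"
  shows "integral {0..s} (\<lambda>t. D * exp (l * t)) \<le> D * exp (l * s) / l"
proof -
  have "((\<lambda>t. D * exp (l * t)) has_integral (D * exp (l * s) / l - D * exp (l * 0) / l)) {0..s}"
    using assms
    by (intro fundamental_theorem_of_calculus)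
      (auto intro!: derivative_eq_intros simp flip: has_real_derivative_iff_has_vector_derivative)
  from integral_unique[OF this] show ?thesis
    using assms by (simp del: integral_mult_right)
qed

lemma avg_exp_bound:
  assumes g: "continuous_on {0..} g" and l: "l > 0"
    and le: "\<And>t. 0 \<le> t \<Longrightarrow> \<bar>g t\<bar> \<le> D * exp (l * t)" and s: "s \<ge> 0"
  shows "\<bar>avg g s\<bar> \<le> D / l * exp (l * s)"
proof -
  have D: "D \<ge> 0" using le[of 0] by simp
  have "\<bar>avg g s\<bar> \<le> integral {0..s} (\<lambda>t. D * exp (l * t))"
    using le s by (intro avg_bound[OF g] continuous_intros) auto
  then show ?thesis using integral_exp_le[OF l s D] by simp
qed

lemma int_avg_exp_bound:
  assumes g: "continuous_on {0..} g" and l: "l > 0"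
    and le: "\<And>t. 0 \<le> t \<Longrightarrow> \<bar>g t\<bar> \<le> D * exp (l * t)" and s: "s \<ge> 0"
  shows "\<bar>integral {0..s} (avg g)\<bar> \<le> D / l\<^sup>2 * exp (l * s)"
proof -
  have D: "D \<ge> 0" using le[of 0] by simp
  have "\<bar>integral {0..s} (avg g)\<bar> \<le> integral {0..s} (\<lambda>t. (D / l) * exp (l * t))"
    unfolding real_norm_def[symmetric]
    using avg_exp_bound[OF g l le]
    by (intro integral_norm_bound_integral avg_int g integrable_continuous_real continuous_intros) auto
  also have "\<dots> \<le> D / l * exp (l * s) / l"
    using D l s by (intro integral_exp_le) auto
  finally show ?thesis by (simp add: power2_eq_square)
qed

lemma int_avg_deriv:
  assumes g: "continuous_on {0..} g" and s: "s > 0"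
  shows "((\<lambda>s. integral {0..s} (avg g)) has_real_derivative avg g s) (at s)"
proof -
  have "((\<lambda>s. integral {0..s} (avg g)) has_real_derivative avg g s) (at s within {0..s+1})"
    using s by (intro integral_has_real_derivative continuous_on_subset[OF avg_cont[OF g]]) auto
  then show ?thesis
    using s at_within_Icc_at[of 0 s "s+1"] by simp
qed

lemma int_avg_cont:
  assumes g: "continuous_on {0..} g"
  shows "continuous_on {0..} (\<lambda>s. integral {0..s} (avg g))"
proof -
  have "continuous (at s within {0..}) (\<lambda>s. integral {0..s} (avg g))" if "s \<ge> 0" for s
  proof -
    have "continuous_on {0..s+1} (\<lambda>s. integral {0..s} (avg g))"
      by (rule indefinite_integral_continuous_1[OF avg_int[OF g]])
    then have "continuous (at s within {0..s+1}) (\<lambda>s. integral {0..s} (avg g))"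
      using that by (simp add: continuous_on_eq_continuous_within)
    moreover have "at s within {0..} = at s within {0..s+1}"
      by (rule at_within_nhd[of _ "{s-1<..<s+1}"]) auto
    ultimately show ?thesis by simp
  qed
  then show ?thesis by (simp add: continuous_on_eq_continuous_within)
qed

text \<open>
The radial initial value problem, integrated twice, is \<open>u = \<alpha> - \<integral> avg (f \<circ> u)\<close>. Each of the two
integrations gains a factor \<open>1/l\<close> in the norm \<open>sup e\<^sup>-\<^sup>l\<^sup>r |u(r)|\<close>, so with Lipschitz constant
\<open>l\<^sup>2/2\<close> the right-hand side is a contraction with factor 1/2. The same factor yields the
Lipschitz dependence on \<open>\<alpha>\<close>.
\<close>

lemma shooting_fixed_point:
  fixes f :: "real \<Rightarrow> real"
  assumes f: "continuous_on UNIV f" and B: "\<And>x. \<bar>f x\<bar> \<le> B"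
    and lip: "\<And>x y. \<bar>f x - f y\<bar> \<le> l\<^sup>2 / 2 * \<bar>x - y\<bar>" and l: "l > 0"
  obtains u where
    "\<And>\<alpha>. continuous_on UNIV (u \<alpha>)"
    "\<And>\<alpha> r. r \<ge> 0 \<Longrightarrow> u \<alpha> r = \<alpha> - integral {0..r} (avg (\<lambda>t. f (u \<alpha> t)))"
    "\<And>\<alpha> \<beta> r. r \<ge> 0 \<Longrightarrow> \<bar>u \<alpha> r - u \<beta> r\<bar> \<le> 2 * \<bar>\<alpha> - \<beta>\<bar> * exp (l * r)"
proof -
  define g where "g b t = f (exp (l * t) * apply_bcontfun b t)" for b :: "real \<Rightarrow>\<^sub>C real" and t
  \<comment> \<open>the integral operator in the weighted unknown \<open>b(r) = e\<^sup>-\<^sup>l\<^sup>r u(r)\<close>, extended by constants to negative \<open>r\<close> so that bounded continuous functions on the whole line serve as the Banach space\<close>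
  define S where "S \<alpha> b r = exp (- l * max 0 r) * (\<alpha> - integral {0..max 0 r} (avg (g b)))"
    for \<alpha> :: real and b :: "real \<Rightarrow>\<^sub>C real" and r
  have g_cont: "continuous_on X (g b)" for b X
    unfolding g_def
    by (rule continuous_on_compose2[OF f])
      (intro continuous_on_mult continuous_on_exp continuous_on_const continuous_on_id
        continuous_on_apply_bcontfun, simp)
  have S_bc: "S \<alpha> b \<in> bcontfun" for \<alpha> b
  proof (rule bcontfun_normI)
    show "continuous_on UNIV (S \<alpha> b)"
      unfolding S_def
      by (intro continuous_on_mult continuous_on_diff continuous_on_compose2[OF int_avg_cont[OF g_cont]]
          continuous_on_exp continuous_on_const continuous_on_max continuous_on_id)
        auto
    fix r :: real
    define s where "s = max 0 r"
    have s: "s \<ge> 0" by (simp add: s_def)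
    have "\<bar>g b t\<bar> \<le> B * exp (l * t)" if "t \<ge> 0" for t
    proof -
      have "B * 1 \<le> B * exp (l * t)"
        using that l B[of 0] by (intro mult_left_mono) auto
      with B show ?thesis unfolding g_def by (metis mult.right_neutral order_trans)
    qed
    from int_avg_exp_bound[OF g_cont l this s]
    have "\<bar>integral {0..s} (avg (g b))\<bar> \<le> B / l\<^sup>2 * exp (l * s)" by simp
    then have "exp (- l * s) * \<bar>\<alpha> - integral {0..s} (avg (g b))\<bar>
        \<le> exp (- l * s) * (\<bar>\<alpha>\<bar> + B / l\<^sup>2 * exp (l * s))"
      by (intro mult_left_mono) auto
    also have "\<dots> = exp (- l * s) * \<bar>\<alpha>\<bar> + B / l\<^sup>2"
      by (simp add: algebra_simps exp_minus)
    also have "\<dots> \<le> \<bar>\<alpha>\<bar> + B / l\<^sup>2"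
      using l s by (auto intro!: mult_left_le_one_le)
    finally show "norm (S \<alpha> b r) \<le> \<bar>\<alpha>\<bar> + B / l\<^sup>2"
      unfolding S_def s_def by (simp add: abs_mult)
  qed
  have S_dist: "\<bar>S \<alpha> b r - S \<beta> c r\<bar> \<le> \<bar>\<alpha> - \<beta>\<bar> + dist b c / 2" for \<alpha> \<beta> b c and r :: real
  proof -
    define s where "s = max 0 r"
    have s: "s \<ge> 0" by (simp add: s_def)
    have "\<bar>g b t - g c t\<bar> \<le> (l\<^sup>2 / 2 * dist b c) * exp (l * t)" for t
    proof -
      have "\<bar>g b t - g c t\<bar> \<le> l\<^sup>2 / 2 * \<bar>exp (l * t) * b t - exp (l * t) * c t\<bar>"
        unfolding g_def by (rule lip)
      also have "\<dots> = l\<^sup>2 / 2 * exp (l * t) * dist (b t) (c t)"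
        by (simp add: dist_real_def abs_mult flip: right_diff_distrib)
      also have "\<dots> \<le> l\<^sup>2 / 2 * exp (l * t) * dist b c"
        by (intro mult_left_mono dist_bounded) auto
      finally show ?thesis by (simp add: mult_ac)
    qed
    from int_avg_exp_bound[OF _ l this s]
    have "\<bar>integral {0..s} (avg (\<lambda>t. g b t - g c t))\<bar> \<le> dist b c / 2 * exp (l * s)"
      using g_cont l by (auto intro: continuous_intros)
    moreover have "integral {0..s} (avg (\<lambda>t. g b t - g c t))
        = integral {0..s} (avg (g b)) - integral {0..s} (avg (g c))"
    proof -
      have "avg (\<lambda>t. g b t - g c t) = (\<lambda>s. avg (g b) s - avg (g c) s)"
        by (intro ext avg_diff g_cont)
      then show ?thesis by (simp add: integral_diff avg_int g_cont)
    qed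
    ultimately have I: "\<bar>integral {0..s} (avg (g b)) - integral {0..s} (avg (g c))\<bar>
        \<le> dist b c / 2 * exp (l * s)" by simp
    have "\<bar>S \<alpha> b r - S \<beta> c r\<bar> = exp (- l * s) * \<bar>(\<alpha> - \<beta>) -
        (integral {0..s} (avg (g b)) - integral {0..s} (avg (g c)))\<bar>"
      unfolding S_def s_def[symmetric] right_diff_distrib[symmetric] abs_mult
      by (simp add: algebra_simps)
    also have "\<dots> \<le> exp (- l * s) * (\<bar>\<alpha> - \<beta>\<bar> + dist b c / 2 * exp (l * s))"
      using I by (intro mult_left_mono) (linarith | simp)+
    also have "\<dots> = exp (- l * s) * \<bar>\<alpha> - \<beta>\<bar> + dist b c / 2"
      by (simp add: algebra_simps exp_minus)
    also have "\<dots> \<le> \<bar>\<alpha> - \<beta>\<bar> + dist b c / 2"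
      using l s by (auto intro!: mult_left_le_one_le)
    finally show ?thesis .
  qed
  define \<Phi> where "\<Phi> \<alpha> b = Bcontfun (S \<alpha> b)" for \<alpha> b
  have \<Phi>: "apply_bcontfun (\<Phi> \<alpha> b) = S \<alpha> b" for \<alpha> b
    unfolding \<Phi>_def using S_bc by (rule Bcontfun_inverse)
  have \<Phi>_dist: "dist (\<Phi> \<alpha> b) (\<Phi> \<beta> c) \<le> \<bar>\<alpha> - \<beta>\<bar> + dist b c / 2" for \<alpha> \<beta> b c
    by (rule dist_bound) (simp add: \<Phi> dist_real_def S_dist)
  have "\<exists>b. \<Phi> \<alpha> b = b" for \<alpha>
    using banach_fix_type[of "1/2" "\<Phi> \<alpha>"] \<Phi>_dist[of \<alpha> _ \<alpha>] by auto
  then obtain b where b: "\<And>\<alpha>. \<Phi> \<alpha> (b \<alpha>) = b \<alpha>" by metis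
  define u where "u \<alpha> t = exp (l * t) * apply_bcontfun (b \<alpha>) t" for \<alpha> t
  show thesis
  proof
    show "continuous_on UNIV (u \<alpha>)" for \<alpha>
      unfolding u_def by (intro continuous_intros continuous_on_apply_bcontfun)
    show "u \<alpha> r = \<alpha> - integral {0..r} (avg (\<lambda>t. f (u \<alpha> t)))" if "r \<ge> 0" for \<alpha> r
    proof -
      have "u \<alpha> r = exp (l * r) * S \<alpha> (b \<alpha>) r"
        unfolding u_def by (subst b[symmetric]) (simp add: \<Phi>)
      also have "\<dots> = \<alpha> - integral {0..r} (avg (g (b \<alpha>)))"
        using that by (simp add: S_def exp_minus)
      finally show ?thesis by (simp add: g_def[abs_def] u_def)
    qed
    show "\<bar>u \<alpha> r - u \<beta> r\<bar> \<le> 2 * \<bar>\<alpha> - \<beta>\<bar> * exp (l * r)" if "r \<ge> 0" for \<alpha> \<beta> r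
    proof -
      have "dist (b \<alpha>) (b \<beta>) \<le> \<bar>\<alpha> - \<beta>\<bar> + dist (b \<alpha>) (b \<beta>) / 2"
        using \<Phi>_dist[of \<alpha> "b \<alpha>" \<beta> "b \<beta>"] b by simp
      then have "\<bar>b \<alpha> r - b \<beta> r\<bar> \<le> 2 * \<bar>\<alpha> - \<beta>\<bar>"
        using dist_bounded[of "b \<alpha>" r "b \<beta>"] by (simp add: dist_real_def)
      then have "exp (l * r) * \<bar>b \<alpha> r - b \<beta> r\<bar> \<le> exp (l * r) * (2 * \<bar>\<alpha> - \<beta>\<bar>)"
        by (intro mult_left_mono) auto
      then show ?thesis
        unfolding u_def right_diff_distrib[symmetric] abs_mult by (simp add: mult_ac)
    qed
  qed
qed

text \<open>
The pair \<open>(u, v)\<close> with \<open>v = u'\<close> solves the radial equation with height \<open>\<alpha>\<close>. The nonlinearity is cut off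
at 0, so that solutions exist beyond their first zero and stay negative there.
\<close>

definition emden :: "real \<Rightarrow> real \<Rightarrow> (real \<Rightarrow> real) \<Rightarrow> (real \<Rightarrow> real) \<Rightarrow> bool" where
  "emden p \<alpha> u v \<longleftrightarrow> continuous_on {0..} u \<and> continuous_on {0..} v \<and> u 0 = \<alpha> \<and> v 0 = 0 \<and>
     (\<forall>r>0. (u has_real_derivative v r) (at r) \<and>
        (v has_real_derivative - (V' r / V r * v r) - max 0 (u r) powr p) (at r))"

text \<open>
Solutions never exceed their height, so for \<open>\<alpha> \<le> M\<close> the power may be truncated above at \<open>M\<close> as well,
which makes it bounded and globally Lipschitz.
\<close>

lemma emden_family:
  assumes p: "p > 1" and M: "M > 0"
  obtains u v where "\<And>\<alpha>. 0 < \<alpha> \<Longrightarrow> \<alpha> \<le> M \<Longrightarrow> emden p \<alpha> (u \<alpha>) (v \<alpha>)"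
    "\<And>r S. r \<ge> 0 \<Longrightarrow> continuous_on S (\<lambda>\<alpha>. u \<alpha> r)"
    "\<And>r S. r \<ge> 0 \<Longrightarrow> continuous_on S (\<lambda>\<alpha>. v \<alpha> r)"
proof -
  define f where "f x = max 0 (min M x) powr p" for x
  define l where "l = sqrt (2 * (p * M powr (p - 1)))"
  have l: "l > 0" "l\<^sup>2 = 2 * (p * M powr (p - 1))" using p M by (auto simp: l_def)
  have f_cont: "continuous_on UNIV f"
    unfolding f_def using p by (intro continuous_on_powr' continuous_intros) auto
  have f_bound: "\<bar>f x\<bar> \<le> M powr p" for x
    unfolding f_def using p M by (auto intro!: powr_mono2)
  have f_lip: "\<bar>f x - f y\<bar> \<le> l\<^sup>2 / 2 * \<bar>x - y\<bar>" for x y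
  proof -
    have "\<bar>f x - f y\<bar> \<le> p * M powr (p - 1) * \<bar>max 0 (min M x) - max 0 (min M y)\<bar>"
      unfolding f_def using M by (intro powr_lipschitz[OF p]) auto
    also have "\<dots> \<le> p * M powr (p - 1) * \<bar>x - y\<bar>"
      using p by (intro mult_left_mono) auto
    finally show ?thesis using l by simp
  qed
  obtain u where u: "\<And>\<alpha>. continuous_on UNIV (u \<alpha>)"
    "\<And>\<alpha> r. r \<ge> 0 \<Longrightarrow> u \<alpha> r = \<alpha> - integral {0..r} (avg (\<lambda>t. f (u \<alpha> t)))"
    "\<And>\<alpha> \<beta> r. r \<ge> 0 \<Longrightarrow> \<bar>u \<alpha> r - u \<beta> r\<bar> \<le> 2 * \<bar>\<alpha> - \<beta>\<bar> * exp (l * r)"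
    using shooting_fixed_point[OF f_cont f_bound f_lip l(1)] by blast
  have fu_cont: "continuous_on S (\<lambda>t. f (u \<alpha> t))" for S \<alpha>
    by (rule continuous_on_compose2[OF f_cont continuous_on_subset[OF u(1)]]) auto
  define v where "v \<alpha> r = - avg (\<lambda>t. f (u \<alpha> t)) r" for \<alpha> r
  have avg_nonneg: "avg (\<lambda>t. f (u \<alpha> t)) r \<ge> 0" if "r \<ge> 0" for \<alpha> r
    unfolding avg_def using that
    by (intro divide_nonneg_nonneg integral_nonneg Vg_int fu_cont V_nonneg mult_nonneg_nonneg)
      (auto simp: f_def)
  have u_le: "u \<alpha> r \<le> \<alpha>" if "r \<ge> 0" for \<alpha> r
    using u(2)[OF that, of \<alpha>] that
      integral_nonneg[OF avg_int[OF fu_cont], of r \<alpha>] avg_nonneg by auto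
  have u_der: "(u \<alpha> has_real_derivative v \<alpha> r) (at r)" if "r > 0" for \<alpha> r
  proof (rule has_field_derivative_transform_within_open[of _ _ _ "{0<..}"])
    show "((\<lambda>r. \<alpha> - integral {0..r} (avg (\<lambda>t. f (u \<alpha> t)))) has_real_derivative v \<alpha> r) (at r)"
      using int_avg_deriv[OF fu_cont that, of \<alpha>] by (auto intro!: derivative_eq_intros simp: v_def)
  qed (use that u(2) in auto)
  have v_der: "(v \<alpha> has_real_derivative - (V' r / V r * v \<alpha> r) - max 0 (u \<alpha> r) powr p) (at r)"
    if "r > 0" "\<alpha> \<le> M" for \<alpha> r
  proof -
    have "f (u \<alpha> r) = max 0 (u \<alpha> r) powr p"
      using u_le[of r \<alpha>] that by (simp add: f_def min_absorb2)
    then show ?thesis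
      using avg_deriv[OF fu_cont that(1), of \<alpha>] unfolding v_def[abs_def]
      by (auto intro!: derivative_eq_intros)
  qed
  have lip_cont: "continuous_on S g" if "\<And>x y. \<bar>g x - g y\<bar> \<le> C * \<bar>x - y\<bar>" "C \<ge> 0"
    for g :: "real \<Rightarrow> real" and C S
    by (rule lipschitz_on_continuous_on[of C]) (use that in \<open>auto simp: lipschitz_on_def dist_real_def\<close>)
  show thesis
  proof
    show "emden p \<alpha> (u \<alpha>) (v \<alpha>)" if "0 < \<alpha>" "\<alpha> \<le> M" for \<alpha>
      unfolding emden_def
    proof (intro conjI allI impI)
      show "continuous_on {0..} (u \<alpha>)" using u(1) continuous_on_subset by blast
      show "continuous_on {0..} (v \<alpha>)"
        unfolding v_def[abs_def] by (intro continuous_on_minus avg_cont fu_cont)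
      show "u \<alpha> 0 = \<alpha>" using u(2)[of 0 \<alpha>] by simp
      show "v \<alpha> 0 = 0" by (simp add: v_def)
    qed (use u_der v_der that in auto)
    show "continuous_on S (\<lambda>\<alpha>. u \<alpha> r)" if "r \<ge> 0" for r S
      by (rule lip_cont[of _ "2 * exp (l * r)"]) (use u(3)[OF that] in \<open>auto simp: mult_ac\<close>)
    show "continuous_on S (\<lambda>\<alpha>. v \<alpha> r)" if "r \<ge> 0" for r S
    proof (rule lip_cont[of _ "l * exp (l * r)"])
      fix \<alpha> \<beta>
      have "\<bar>f (u \<alpha> t) - f (u \<beta> t)\<bar> \<le> (l\<^sup>2 * \<bar>\<alpha> - \<beta>\<bar>) * exp (l * t)" if "t \<ge> 0" for t
      proof -
        have "\<bar>f (u \<alpha> t) - f (u \<beta> t)\<bar> \<le> l\<^sup>2 / 2 * \<bar>u \<alpha> t - u \<beta> t\<bar>" by (rule f_lip)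
        also have "\<dots> \<le> l\<^sup>2 / 2 * (2 * \<bar>\<alpha> - \<beta>\<bar> * exp (l * t))"
          by (intro mult_left_mono u(3) that) auto
        finally show ?thesis by simp
      qed
      from avg_exp_bound[OF continuous_on_diff[OF fu_cont fu_cont] l(1) this that]
      have "\<bar>avg (\<lambda>t. f (u \<alpha> t) - f (u \<beta> t)) r\<bar> \<le> l * exp (l * r) * \<bar>\<alpha> - \<beta>\<bar>"
        using l(1) by (simp add: power2_eq_square mult_ac)
      then show "\<bar>v \<alpha> r - v \<beta> r\<bar> \<le> l * exp (l * r) * \<bar>\<alpha> - \<beta>\<bar>"
        using avg_diff[OF fu_cont fu_cont, of \<alpha> \<beta> r] by (simp add: v_def)
    qed (use l in auto)
  qed
qed

lemma rV_deriv:
  "r > 0 \<Longrightarrow> ((\<lambda>r. r * V r) has_real_derivative V r + r * V' r) (at r)"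
  by (auto intro!: derivative_eq_intros V_deriv)

lemma mass_deriv:
  "t > 0 \<Longrightarrow> ((\<lambda>s. integral {0..s} (\<lambda>t. V t * 1)) has_real_derivative V t * 1) (at t)"
  by (rule Vavg_deriv[OF continuous_on_const])

lemma mass_cont: "continuous_on {0..r} (\<lambda>s. integral {0..s} (\<lambda>t. V t * 1))"
  by (rule indefinite_integral_continuous_1[OF Vg_int[OF continuous_on_const]])

context
  fixes p \<alpha> u v
  assumes p: "p > 1" and \<alpha>: "\<alpha> > 0" and sol: "emden p \<alpha> u v"
begin

lemma u_cont: "S \<subseteq> {0..} \<Longrightarrow> continuous_on S u" and v_cont: "S \<subseteq> {0..} \<Longrightarrow> continuous_on S v"
  and u_0: "u 0 = \<alpha>" and v_0: "v 0 = 0"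
  and u_deriv: "r > 0 \<Longrightarrow> (u has_real_derivative v r) (at r)"
  and v_deriv: "r > 0 \<Longrightarrow> (v has_real_derivative - (V' r / V r * v r) - max 0 (u r) powr p) (at r)"
  using sol unfolding emden_def by (auto intro: continuous_on_subset)

lemma flux_deriv:
  assumes "r > 0"
  shows "((\<lambda>r. V r * v r) has_real_derivative - V r * max 0 (u r) powr p) (at r)"
  using V_pos[OF assms]
  by (auto intro!: derivative_eq_intros V_deriv v_deriv assms simp: field_simps)

lemma flux_cont: "S \<subseteq> {0..} \<Longrightarrow> continuous_on S (\<lambda>r. V r * v r)"
  using V_cont by (intro continuous_intros v_cont) (auto intro: continuous_on_subset)

lemma flux_antimono:
  assumes "0 \<le> a" "a \<le> b"
  shows "V b * v b \<le> V a * v a"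
proof -
  have "- (V a * v a) \<le> - (V b * v b)"
  proof (rule le_of_deriv_nonneg[OF assms(2)])
    show "continuous_on {a..b} (\<lambda>r. - (V r * v r))"
      using assms by (intro continuous_on_minus flux_cont) auto
    show "((\<lambda>r. - (V r * v r)) has_real_derivative V r * max 0 (u r) powr p) (at r)"
      if "a < r" "r < b" for r
      using DERIV_minus[OF flux_deriv[of r]] that assms by simp
    show "V r * max 0 (u r) powr p \<ge> 0" if "a < r" "r < b" for r
      using V_nonneg[of r] that assms by auto
  qed
  then show ?thesis by simp
qed

lemma v_nonpos: "r \<ge> 0 \<Longrightarrow> v r \<le> 0"
  using flux_antimono[of 0 r] V_0 V_pos[of r] v_0
  by (cases "r = 0") (auto simp: mult_le_0_iff)

lemma u_antimono:
  assumes "0 \<le> a" "a \<le> b"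
  shows "u b \<le> u a"
proof -
  have "- u a \<le> - u b"
  proof (rule le_of_deriv_nonneg[OF assms(2)])
    show "continuous_on {a..b} (\<lambda>r. - u r)"
      using assms by (intro continuous_on_minus u_cont) auto
    show "((\<lambda>r. - u r) has_real_derivative - v r) (at r)" if "a < r" "r < b" for r
      using that assms by (auto intro!: derivative_eq_intros u_deriv)
    show "- v r \<ge> 0" if "a < r" "r < b" for r
      using v_nonpos[of r] that assms by auto
  qed
  then show ?thesis by simp
qed

lemma u_le: "r \<ge> 0 \<Longrightarrow> u r \<le> \<alpha>"
  using u_antimono[of 0 r] u_0 by simp

lemma source_le: "r \<ge> 0 \<Longrightarrow> max 0 (u r) powr p \<le> \<alpha> powr p"
  using u_le \<alpha> p by (intro powr_mono2) auto

lemma v_lower: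
  assumes "r \<ge> 0"
  shows "v r \<ge> - (\<alpha> powr p * r)"
proof (cases "r = 0")
  case False
  have "V 0 * v 0 + \<alpha> powr p * (0 * V 0) \<le> V r * v r + \<alpha> powr p * (r * V r)"
  proof (rule le_of_deriv_nonneg[OF assms])
    show "continuous_on {0..r} (\<lambda>r. V r * v r + \<alpha> powr p * (r * V r))"
      using V_cont by (intro continuous_intros flux_cont) (auto intro: continuous_on_subset)
    show "((\<lambda>r. V r * v r + \<alpha> powr p * (r * V r)) has_real_derivative
        - V t * max 0 (u t) powr p + \<alpha> powr p * (V t + t * V' t)) (at t)" if "0 < t" "t < r" for t
      by (intro DERIV_add flux_deriv DERIV_cmult rV_deriv that)
    show "- V t * max 0 (u t) powr p + \<alpha> powr p * (V t + t * V' t) \<ge> 0" if "0 < t" "t < r" for t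
    proof -
      have "V t * max 0 (u t) powr p \<le> V t * \<alpha> powr p"
        using that by (intro mult_left_mono source_le V_nonneg) auto
      moreover have "\<alpha> powr p * (t * V' t) \<ge> 0" using that V'_nonneg[of t] by simp
      ultimately show ?thesis by (simp add: algebra_simps)
    qed
  qed
  then have "V r * (v r + \<alpha> powr p * r) \<ge> 0" using V_0 by (simp add: algebra_simps)
  then show ?thesis using V_pos[of r] False assms by (simp add: zero_le_mult_iff)
qed (simp add: v_0)

lemma u_lower:
  assumes "r \<ge> 0"
  shows "u r \<ge> \<alpha> - \<alpha> powr p * r\<^sup>2 / 2"
proof -
  have "u 0 + \<alpha> powr p * 0\<^sup>2 / 2 \<le> u r + \<alpha> powr p * r\<^sup>2 / 2"
  proof (rule le_of_deriv_nonneg[OF assms])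
    show "continuous_on {0..r} (\<lambda>r. u r + \<alpha> powr p * r\<^sup>2 / 2)"
      by (intro continuous_intros u_cont) auto
    show "((\<lambda>r. u r + \<alpha> powr p * r\<^sup>2 / 2) has_real_derivative v t + \<alpha> powr p * t) (at t)"
      if "0 < t" "t < r" for t
      using that by (auto intro!: derivative_eq_intros u_deriv)
    show "v t + \<alpha> powr p * t \<ge> 0" if "0 < t" "t < r" for t
      using v_lower[of t] that by simp
  qed
  then show ?thesis using u_0 by simp
qed

text \<open>
If the flux \<open>V v\<close> vanished at \<open>r\<close> it would vanish on all of \<open>[0,r]\<close> by monotonicity, so \<open>u\<close> would be
the constant \<open>\<alpha>\<close> there, which does not solve the equation. Consequently a solution that reaches zero
becomes negative immediately.
\<close>

lemma v_neg:
  assumes r: "r > 0"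
  shows "v r < 0"
proof (rule ccontr)
  assume "\<not> v r < 0"
  then have "v r = 0" using v_nonpos[of r] r by simp
  then have z: "v t = 0" if "0 < t" "t \<le> r" for t
    using flux_antimono[of t r] that V_pos[of t] v_nonpos[of t] by (auto simp: zero_le_mult_iff)
  have "u 0 \<le> u (r / 2)"
  proof (rule le_of_deriv_nonneg[where F = u and F' = v])
    show "(u has_real_derivative v t) (at t)" if "0 < t" "t < r / 2" for t
      by (rule u_deriv[OF that(1)])
    show "v t \<ge> 0" if "0 < t" "t < r / 2" for t using z[of t] that by simp
  qed (use r in \<open>auto intro!: u_cont\<close>)
  then have upos: "u (r / 2) > 0" using u_0 \<alpha> by simp
  have "((\<lambda>_. 0) has_real_derivative - V (r/2) * max 0 (u (r/2)) powr p) (at (r/2))"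
    by (rule has_field_derivative_transform_within_open[OF flux_deriv, of _ "{0<..<r}"])
      (use r z in auto)
  then have "- V (r/2) * max 0 (u (r/2)) powr p = 0"
    by (rule DERIV_unique) (rule DERIV_const)
  then show False using upos V_pos[of "r/2"] r by (auto simp: max_def)
qed

lemma u_strict_antimono:
  assumes "0 \<le> a" "a < b"
  shows "u b < u a"
proof -
  have "u b < u ((a + b) / 2)"
  proof (rule DERIV_neg_imp_decreasing[where f = u and a = "(a + b) / 2" and b = b])
    fix x assume x: "(a + b) / 2 \<le> x" "x \<le> b"
    have "(a + b) / 2 > 0" using assms by simp
    then have "x > 0" using x(1) by (rule less_le_trans)
    then show "\<exists>y. (u has_real_derivative y) (at x) \<and> y < 0"
      using u_deriv v_neg by blast
  qed (use assms in auto)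
  also have "\<dots> \<le> u a" using assms by (intro u_antimono) auto
  finally show ?thesis .
qed

text \<open>
Comparison of the flux with that of the constant source \<open>\<alpha>\<^sup>p\<close>. The bounds here and in the next lemma
involve the same function \<open>avg 1\<close>, hence one solution with a positive limit controls the decay of all
the others.
\<close>

lemma v_ge_avg:
  assumes r: "r > 0"
  shows "v r \<ge> - (\<alpha> powr p * avg (\<lambda>_. 1) r)"
proof -
  define I where "I s = integral {0..s} (\<lambda>t. V t * 1)" for s
  have "V 0 * v 0 + \<alpha> powr p * I 0 \<le> V r * v r + \<alpha> powr p * I r"
  proof (rule le_of_deriv_nonneg[OF less_imp_le[OF r]])
    show "continuous_on {0..r} (\<lambda>r. V r * v r + \<alpha> powr p * I r)"
      unfolding I_def using mass_cont by (intro continuous_intros flux_cont) auto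
    show "((\<lambda>r. V r * v r + \<alpha> powr p * I r) has_real_derivative
        - V t * max 0 (u t) powr p + \<alpha> powr p * (V t * 1)) (at t)" if "0 < t" "t < r" for t
      unfolding I_def by (intro DERIV_add DERIV_diff DERIV_minus DERIV_cmult flux_deriv mass_deriv that)
    show "- V t * max 0 (u t) powr p + \<alpha> powr p * (V t * 1) \<ge> 0" if "0 < t" "t < r" for t
      using mult_left_mono[OF source_le[of t] V_nonneg[of t]] that by (simp add: algebra_simps)
  qed
  then have "0 \<le> V r * v r + \<alpha> powr p * I r" using V_0 by (simp add: I_def)
  then have "0 \<le> (V r * v r + \<alpha> powr p * I r) / V r"
    using V_pos[OF r] by (intro divide_nonneg_pos)
  also have "\<dots> = v r + \<alpha> powr p * (I r / V r)"
    using V_pos[OF r] by (simp add: add_divide_distrib)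
  finally show ?thesis unfolding avg_def I_def by linarith
qed

lemma v_le_avg:
  assumes r: "r > 0" and c: "c \<ge> 0" "c \<le> u r"
  shows "v r \<le> - (c powr p * avg (\<lambda>_. 1) r)"
proof -
  define I where "I s = integral {0..s} (\<lambda>t. V t * 1)" for s
  have "- (V 0 * v 0) - c powr p * I 0 \<le> - (V r * v r) - c powr p * I r"
  proof (rule le_of_deriv_nonneg[OF less_imp_le[OF r]])
    show "continuous_on {0..r} (\<lambda>r. - (V r * v r) - c powr p * I r)"
      unfolding I_def using mass_cont by (intro continuous_intros flux_cont) auto
    show "((\<lambda>r. - (V r * v r) - c powr p * I r) has_real_derivative
        - (- V t * max 0 (u t) powr p) - c powr p * (V t * 1)) (at t)" if "0 < t" "t < r" for t
      unfolding I_def by (intro DERIV_add DERIV_diff DERIV_minus DERIV_cmult flux_deriv mass_deriv that)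
    show "- (- V t * max 0 (u t) powr p) - c powr p * (V t * 1) \<ge> 0" if "0 < t" "t < r" for t
    proof -
      have "c powr p \<le> max 0 (u t) powr p"
        using u_antimono[of t r] that c p by (intro powr_mono2) auto
      from mult_left_mono[OF this V_nonneg[of t]] that show ?thesis by (simp add: algebra_simps)
    qed
  qed
  then have "0 \<le> - (V r * v r) - c powr p * I r" using V_0 by (simp add: I_def)
  then have "0 \<le> (- (V r * v r) - c powr p * I r) / V r"
    using V_pos[OF r] by (intro divide_nonneg_pos)
  also have "\<dots> = - v r - c powr p * (I r / V r)"
    using V_pos[OF r] by (simp add: diff_divide_distrib)
  finally show ?thesis unfolding avg_def I_def by linarith
qed

end

text \<open>
By l'Hospital's rule for \<open>(V v) / (r V)\<close>: the quotient of derivatives is \<open>- u\<^sup>p / (1 + r V'/V)\<close>, and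
\<open>r V'/V \<rightarrow> N\<close>.
\<close>

lemma slope_quotient_limit:
  assumes p: "p > 1" and \<alpha>: "\<alpha> > 0" and sol: "emden p \<alpha> u v"
  shows "((\<lambda>r. v r / r) \<longlongrightarrow> - (\<alpha> powr p / (real N + 1))) (at_right 0)"
proof -
  note s = p \<alpha> sol
  note right = tendsto_right_of_continuous
  have "((\<lambda>r. (V r * v r) / (r * V r)) \<longlongrightarrow> - (\<alpha> powr p / (real N + 1))) (at_right 0)"
  proof (rule lhopital_right_0[where f' = "\<lambda>r. - V r * max 0 (u r) powr p" and g' = "\<lambda>r. V r + r * V' r"])
    show "((\<lambda>r. V r * v r) \<longlongrightarrow> 0) (at_right 0)"
      using right[OF flux_cont[OF s order_refl]] V_0 by simp
    have "((\<lambda>r. r * V r) \<longlongrightarrow> 0 * V 0) (at_right 0)"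
      by (intro tendsto_intros right V_cont)
    then show "((\<lambda>r. r * V r) \<longlongrightarrow> 0) (at_right 0)" by simp
    have *: "\<forall>\<^sub>F r in at_right 0. P r" if "\<And>r. r > 0 \<Longrightarrow> P r" for P :: "real \<Rightarrow> bool"
      using that by (auto simp: eventually_at_filter)
    show "\<forall>\<^sub>F r in at_right 0. r * V r \<noteq> 0" 
    proof (rule *)
      show "r * V r \<noteq> 0" if "r > 0" for r using V_pos[OF that] that by simp
    qed
    show "\<forall>\<^sub>F r in at_right 0. V r + r * V' r \<noteq> 0"
    proof (rule *)
      fix r :: real assume r: "r > 0"
      have "r * V' r \<ge> 0" using r V'_nonneg[OF r] by simp
      then show "V r + r * V' r \<noteq> 0" using V_pos[OF r] by linarith
    qed
    show "\<forall>\<^sub>F r in at_right 0. ((\<lambda>r. V r * v r) has_real_derivative - V r * max 0 (u r) powr p) (at r)"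
      by (intro * flux_deriv[OF s])
    show "\<forall>\<^sub>F r in at_right 0. ((\<lambda>r. r * V r) has_real_derivative V r + r * V' r) (at r)"
      by (intro * rV_deriv)
    have "((\<lambda>r. max 0 (u r)) \<longlongrightarrow> max 0 (u 0)) (at_right 0)"
      by (intro tendsto_max tendsto_const right u_cont[OF s order_refl])
    then have "((\<lambda>r. - (max 0 (u r) powr p) / (1 + r * V' r / V r)) \<longlongrightarrow> - (\<alpha> powr p) / (1 + real N)) (at_right 0)"
      using \<alpha> u_0[OF s] by (intro tendsto_intros V'_asymp) auto
    then have "((\<lambda>r. - (max 0 (u r) powr p) / (1 + r * V' r / V r)) \<longlongrightarrow> - (\<alpha> powr p / (real N + 1))) (at_right 0)"
      by (simp add: add.commute)
    then show "((\<lambda>r. - V r * max 0 (u r) powr p / (V r + r * V' r)) \<longlongrightarrow> - (\<alpha> powr p / (real N + 1))) (at_right 0)"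
    proof (rule Lim_transform_eventually)
      have "- (max 0 (u r) powr p) / (1 + r * V' r / V r) = - V r * max 0 (u r) powr p / (V r + r * V' r)"
        if r: "r > 0" for r
      proof -
        have "V r + r * V' r = V r * (1 + r * V' r / V r)" using V_pos[OF r] by (simp add: distrib_left)
        then show ?thesis using V_pos[OF r] by simp
      qed
      then show "\<forall>\<^sub>F r in at_right 0. - (max 0 (u r) powr p) / (1 + r * V' r / V r)
          = - V r * max 0 (u r) powr p / (V r + r * V' r)" by (rule *)
    qed
  qed
  then show ?thesis
  proof (rule Lim_transform_eventually)
    have "V r * v r / (r * V r) = v r / r" if "r > 0" for r
      using V_pos[OF that] by simp
    then show "\<forall>\<^sub>F r in at_right 0. V r * v r / (r * V r) = v r / r"
      unfolding eventually_at_filter by (intro always_eventually) simp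
  qed
qed

section \<open>Pohozaev functional and barrier\<close>

text \<open>
A positive decreasing solution satisfies \<open>- V u' \<ge> u(r)\<^sup>p \<integral>\<^sub>0\<^sup>r V\<close>, and \<open>r V \<le> (K+1) \<integral>\<^sub>0\<^sup>r V\<close>. Thus
\<open>(u\<^sup>1\<^sup>-\<^sup>p)'\<close> is bounded below by a multiple of \<open>r\<close>, and integration bounds \<open>u(d)\<close> independently
of the initial height.
\<close>

lemma decay_bound:
  assumes p: "p > 1" and \<alpha>: "\<alpha> > 0" and sol: "emden p \<alpha> u v"
    and d: "d > 0" and pos: "u d > 0"
    and h: "\<And>r. 0 < r \<Longrightarrow> r < d \<Longrightarrow> r * V' r / V r \<le> K" and K: "K \<ge> 0"
  shows "u d \<le> ((p - 1) * d\<^sup>2 / (2 * (K + 1))) powr (- (1 / (p - 1)))"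
proof -
  note s = p \<alpha> sol
  have upos: "u r > 0" if "0 \<le> r" "r \<le> d" for r
    using u_antimono[OF s that] pos by simp
  have v_le: "(K + 1) * v r \<le> - (u r powr p * r)" if r: "0 < r" "r < d" for r
  proof -
    have "- ((K + 1) * (V 0 * v 0)) - u r powr p * (0 * V 0)
        \<le> - ((K + 1) * (V r * v r)) - u r powr p * (r * V r)"
    proof (rule le_of_deriv_nonneg[OF less_imp_le[OF r(1)]])
      show "continuous_on {0..r} (\<lambda>t. - ((K + 1) * (V t * v t)) - u r powr p * (t * V t))"
        using V_cont by (intro continuous_intros flux_cont[OF s]) (auto intro: continuous_on_subset)
      fix t assume t: "0 < t" "t < r"
      show "((\<lambda>t. - ((K + 1) * (V t * v t)) - u r powr p * (t * V t)) has_real_derivative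
          - ((K + 1) * (- V t * max 0 (u t) powr p)) - u r powr p * (V t + t * V' t)) (at t)"
        by (intro DERIV_diff DERIV_minus DERIV_cmult flux_deriv[OF s] rV_deriv t)
      have "t * V' t \<le> K * V t"
        using h[of t] t r V_pos[of t] by (simp add: pos_divide_le_eq)
      then have "u r powr p * (V t + t * V' t) \<le> u r powr p * ((K + 1) * V t)"
        by (intro mult_left_mono) (auto simp: algebra_simps)
      also have "\<dots> \<le> max 0 (u t) powr p * ((K + 1) * V t)"
        using u_antimono[OF s, of t r] upos[of r] t r p K V_nonneg[of t]
        by (intro mult_right_mono powr_mono2) auto
      finally show "- ((K + 1) * (- V t * max 0 (u t) powr p)) - u r powr p * (V t + t * V' t) \<ge> 0"
        by (simp add: mult_ac)
    qed
    then have "V r * ((K + 1) * v r + u r powr p * r) \<le> 0"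
      using V_0 by (simp add: algebra_simps)
    then show ?thesis using V_pos[OF r(1)] by (simp add: mult_le_0_iff)
  qed
  have "u 0 powr (1 - p) - (p - 1) * 0\<^sup>2 / (2 * (K + 1))
      \<le> u d powr (1 - p) - (p - 1) * d\<^sup>2 / (2 * (K + 1))"
  proof (rule le_of_deriv_nonneg[OF less_imp_le[OF d]])
    show "continuous_on {0..d} (\<lambda>r. u r powr (1 - p) - (p - 1) * r\<^sup>2 / (2 * (K + 1)))"
    proof -
      have "continuous_on {0..d} (\<lambda>r. u r powr (1 - p))"
        using p upos by (intro continuous_on_powr u_cont[OF s] continuous_on_const) fastforce+
      then show ?thesis
        by (rule continuous_on_diff) (use K in \<open>auto intro!: continuous_intros\<close>)
    qed
    fix r assume r: "0 < r" "r < d"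
    have "((\<lambda>r. u r powr (1 - p)) has_real_derivative (1 - p) * u r powr (1 - p - of_nat 1) * v r) (at r)"
      using upos[of r] r by (intro DERIV_fun_powr u_deriv[OF s]) auto
    moreover have "((\<lambda>r. (p - 1) * r\<^sup>2 / (2 * (K + 1))) has_real_derivative (p - 1) * r / (K + 1)) (at r)"
    proof -
      have "((\<lambda>r. (p - 1) * r\<^sup>2 / (2 * (K + 1))) has_real_derivative (p - 1) * (2 * r) / (2 * (K + 1))) (at r)"
        using DERIV_power[OF DERIV_ident, of 2 r] by (intro DERIV_cdivide DERIV_cmult) simp
      moreover have "(p - 1) * (2 * r) / (2 * (K + 1)) = (p - 1) * r / (K + 1)"
        unfolding mult.left_commute[of "p - 1"] by (rule mult_divide_mult_cancel_left) simp
      ultimately show ?thesis by (simp only:)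
    qed
    ultimately show "((\<lambda>r. u r powr (1 - p) - (p - 1) * r\<^sup>2 / (2 * (K + 1))) has_real_derivative
        (1 - p) * u r powr (1 - p - of_nat 1) * v r - (p - 1) * r / (K + 1)) (at r)"
      by (rule DERIV_diff)
    have U: "u r powr (- p) * u r powr p = 1"
      using upos[of r] r by (simp flip: powr_add)
    have "u r powr (- p) * (u r powr p * r) \<le> u r powr (- p) * (- ((K + 1) * v r))"
      using v_le[OF r] by (intro mult_left_mono) auto
    then have "r \<le> - (u r powr (- p) * v r * (K + 1))"
      unfolding mult.assoc[symmetric] U by (simp add: mult_ac)
    then have "r / (K + 1) \<le> - (u r powr (- p) * v r)"
      using K by (simp add: divide_simps)
    then have "(p - 1) * (r / (K + 1)) \<le> (p - 1) * - (u r powr (- p) * v r)"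
      using p by (intro mult_left_mono) auto
    then show "(1 - p) * u r powr (1 - p - of_nat 1) * v r - (p - 1) * r / (K + 1) \<ge> 0"
      by (simp add: algebra_simps)
  qed
  moreover define c where "c = (p - 1) * d\<^sup>2 / (2 * (K + 1))"
  moreover have "(p - 1) * 0\<^sup>2 / (2 * (K + 1)) = 0" "0 \<le> u 0 powr (1 - p)" by simp_all
  ultimately have "c \<le> u d powr (1 - p)" by linarith
  moreover have "c > 0" using p d K by (simp add: c_def)
  ultimately have "(u d powr (1 - p)) powr (- (1 / (p - 1))) \<le> c powr (- (1 / (p - 1)))"
    using p by (intro powr_mono2') auto
  also have "(u d powr (1 - p)) powr (- (1 / (p - 1))) = u d"
  proof -
    have "(1 - p) * - (1 / (p - 1)) = 1" using p by (simp add: field_simps)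
    then show ?thesis using pos by (simp only: powr_powr powr_one)
  qed
  finally show ?thesis by (simp add: c_def)
qed

text \<open>
With \<open>h = V'/V\<close> one computes \<open>P' = V (u'\<^sup>2 ((1 + 2 a - r h)/2) + u\<^sup>p\<^sup>+\<^sup>1 ((1 + r h)/(p+1) - a))\<close>. The
hypotheses make the first coefficient nonnegative and the second at least \<open>b\<close>; the lower bound \<open>low\<close>
on the remaining term turns this into quantitative growth.
\<close>

lemma pohozaev_increasing:
  assumes p: "p > 1" and \<alpha>: "\<alpha> > 0" and sol: "emden p \<alpha> u v"
    and ab: "0 \<le> x" "x \<le> y" and pos: "u y > 0" and c: "c \<ge> 0"
    and h1: "\<And>r. x < r \<Longrightarrow> r < y \<Longrightarrow> r * V' r / V r \<le> 1 + 2 * a"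
    and h2: "\<And>r. x < r \<Longrightarrow> r < y \<Longrightarrow> (1 + r * V' r / V r) / (p + 1) - a \<ge> b"
    and low: "\<And>r. x < r \<Longrightarrow> r < y \<Longrightarrow> c * r ^ k \<le> b * V r * u r powr (p + 1)"
  defines "P \<equiv> \<lambda>r. r * V r * ((v r)\<^sup>2 / 2 + u r powr (p + 1) / (p + 1)) + a * (u r * (V r * v r))"
  shows "P x + c * (y ^ Suc k - x ^ Suc k) / (real k + 1) \<le> P y"
proof -
  note s = p \<alpha> sol
  have upos: "u r > 0" if "0 \<le> r" "r \<le> y" for r
    using u_antimono[OF s that] pos by simp
  have "P x - c * x ^ Suc k / (real k + 1) \<le> P y - c * y ^ Suc k / (real k + 1)"
  proof (rule le_of_deriv_nonneg[OF ab(2)])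
    have sub: "continuous_on {x..y} V" "continuous_on {x..y} u" "continuous_on {x..y} v"
      using continuous_on_subset[OF V_cont] u_cont[OF s] v_cont[OF s] ab by auto
    show "continuous_on {x..y} (\<lambda>r. P r - c * r ^ Suc k / (real k + 1))"
    proof -
      have "continuous_on {x..y} (\<lambda>r. u r powr (p + 1))"
        using p ab by (intro continuous_on_powr' sub continuous_on_const) (auto intro!: less_imp_le[OF upos])
      moreover have "continuous_on {x..y} (\<lambda>r. r * V r * ((v r)\<^sup>2 / 2 + W r / (p + 1))
          + a * (u r * (V r * v r)) - c * r ^ Suc k / (real k + 1))"
        if "continuous_on {x..y} W" for W
        using p that by (intro continuous_intros sub) auto
      ultimately show ?thesis unfolding P_def by blast
    qed
    fix r assume r: "x < r" "r < y"
    define h where "h = V' r / V r"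
    define U where "U = u r powr p"
    have r0: "r > 0" using r ab by simp
    have ur: "u r > 0" using upos[of r] r ab by simp
    have Vr: "V r > 0" "V' r = h * V r" using V_pos[OF r0] by (auto simp: h_def)
    have U1: "u r powr (p + 1) = u r * U" using ur by (simp add: U_def powr_add mult.commute)
    have mx: "max 0 (u r) = u r" using ur by simp
    have 1: "((\<lambda>r. (v r)\<^sup>2 / 2 + u r powr (p + 1) / (p + 1)) has_real_derivative - (h * (v r)\<^sup>2)) (at r)"
    proof -
      have "((\<lambda>r. u r powr (p + 1)) has_real_derivative (p + 1) * u r powr (p + 1 - of_nat 1) * v r) (at r)"
        by (intro DERIV_fun_powr u_deriv[OF s] ur r0)
      moreover have "((\<lambda>r. (v r)\<^sup>2) has_real_derivative 2 * v r * (- (h * v r) - U)) (at r)"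
        using DERIV_power[OF v_deriv[OF s r0], of 2] by (simp add: h_def U_def mx mult_ac)
      ultimately have "((\<lambda>r. (v r)\<^sup>2 / 2 + u r powr (p + 1) / (p + 1)) has_real_derivative
          2 * v r * (- (h * v r) - U) / 2 + (p + 1) * u r powr (p + 1 - of_nat 1) * v r / (p + 1)) (at r)"
        by (intro DERIV_add DERIV_cdivide)
      moreover have "2 * v r * (- (h * v r) - U) / 2 + (p + 1) * u r powr (p + 1 - of_nat 1) * v r / (p + 1)
          = - (h * (v r)\<^sup>2)"
      proof -
        have "(p + 1) * u r powr (p + 1 - of_nat 1) * v r / (p + 1) = U * v r"
          using p by (simp add: U_def)
        moreover have "2 * v r * w / 2 = v r * w" for w by simp
        ultimately show ?thesis by (simp only:) (simp add: algebra_simps power2_eq_square)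
      qed
      ultimately show ?thesis by (simp only:)
    qed
    have 2: "((\<lambda>r. u r * (V r * v r)) has_real_derivative v r * (V r * v r) + (- V r * U) * u r) (at r)"
      using DERIV_mult[OF u_deriv[OF s r0] flux_deriv[OF s r0]] by (simp add: mx U_def)
    have 3: "((\<lambda>r. c * r ^ Suc k / (real k + 1)) has_real_derivative c * r ^ k) (at r)"
    proof -
      have "((\<lambda>r. c * r ^ Suc k / (real k + 1)) has_real_derivative
          c * (real (Suc k) * r ^ k) / (real k + 1)) (at r)"
        using DERIV_pow[of "Suc k" r] by (intro DERIV_cdivide DERIV_cmult) simp
      moreover have "c * (real (Suc k) * r ^ k) / (real k + 1) = c * r ^ k"
        by (simp add: add.commute)
      ultimately show ?thesis by (simp only:)
    qed
    show "((\<lambda>r. P r - c * r ^ Suc k / (real k + 1)) has_real_derivative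
        ((V r + r * V' r) * ((v r)\<^sup>2 / 2 + u r powr (p + 1) / (p + 1)) + (- (h * (v r)\<^sup>2)) * (r * V r)
          + a * (v r * (V r * v r) + (- V r * U) * u r)) - c * r ^ k) (at r)"
      unfolding P_def
      by (intro DERIV_diff[OF DERIV_add[OF DERIV_mult[OF rV_deriv[OF r0] 1] DERIV_cmult[OF 2]] 3])
    have "(V r + r * V' r) * ((v r)\<^sup>2 / 2 + u r powr (p + 1) / (p + 1)) + (- (h * (v r)\<^sup>2)) * (r * V r)
          + a * (v r * (V r * v r) + (- V r * U) * u r)
        = V r * ((v r)\<^sup>2 * ((1 + 2 * a - r * h) / 2) + u r * U * ((1 + r * h) / (p + 1) - a))"
      unfolding Vr(2) U1 using p by (simp add: field_simps power2_eq_square)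
    also have "\<dots> \<ge> V r * (0 + u r * U * b)"
      using h1[OF r] h2[OF r] Vr(1) ur
      by (intro mult_left_mono add_mono mult_nonneg_nonneg) (auto simp: h_def U_def)
    also have "V r * (0 + u r * U * b) = b * V r * u r powr (p + 1)"
      by (simp add: U1)
    finally show "((V r + r * V' r) * ((v r)\<^sup>2 / 2 + u r powr (p + 1) / (p + 1)) + (- (h * (v r)\<^sup>2)) * (r * V r)
          + a * (v r * (V r * v r) + (- V r * U) * u r)) - c * r ^ k \<ge> 0"
      using low[OF r] by linarith
  qed
  then show ?thesis by (simp add: diff_divide_distrib right_diff_distrib)
qed

text \<open>
Where \<open>u \<ge> 0\<close>, the function \<open>e\<^sup>\<kappa>\<^sup>r (u' + \<kappa> u)\<close> has derivative
\<open>e\<^sup>\<kappa>\<^sup>r ((2\<kappa> - h) u' + (\<kappa>\<^sup>2 - u\<^sup>p\<^sup>-\<^sup>1) u) \<ge> 0\<close>. It therefore stays positive, whereas at a first zero of \<open>u\<close>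
it would have the sign of \<open>u' \<le> 0\<close>.
\<close>

lemma barrier:
  assumes p: "p > 1" and \<alpha>: "\<alpha> > 0" and sol: "emden p \<alpha> u v"
    and R: "R > 0" and \<kappa>: "\<kappa> > 0" and h: "\<And>r. r \<ge> R \<Longrightarrow> V' r / V r \<ge> 2 * \<kappa>"
    and slope: "v R + \<kappa> * u R > 0" and small: "u R powr (p - 1) \<le> \<kappa>\<^sup>2" and r: "r \<ge> R"
  shows "u r > 0"
proof (rule ccontr)
  note s = p \<alpha> sol
  assume "\<not> u r > 0"
  moreover have uR: "u R > 0"
    using slope v_nonpos[OF s, of R] R \<kappa> by (smt (verit) zero_less_mult_pos)
  ultimately obtain T where T: "R \<le> T" "T \<le> r" "u T = 0"
    using IVT2'[of u r 0 R] r R u_cont[OF s, of "{R..r}"] by force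
  have "exp (\<kappa> * R) * (v R + \<kappa> * u R) \<le> exp (\<kappa> * T) * (v T + \<kappa> * u T)"
  proof (rule le_of_deriv_nonneg[OF T(1)])
    show "continuous_on {R..T} (\<lambda>t. exp (\<kappa> * t) * (v t + \<kappa> * u t))"
      using R by (intro continuous_intros u_cont[OF s] v_cont[OF s]) auto
    fix t assume t: "R < t" "t < T"
    have t0: "t > 0" using t R by simp
    show "((\<lambda>t. exp (\<kappa> * t) * (v t + \<kappa> * u t)) has_real_derivative
       exp (\<kappa> * t) * ((2 * \<kappa> - V' t / V t) * v t + (\<kappa>\<^sup>2 * u t - max 0 (u t) powr p))) (at t)"
      using u_deriv[OF s t0] v_deriv[OF s t0]
      by (auto intro!: derivative_eq_intros simp: algebra_simps power2_eq_square)
    have ut: "u t \<ge> 0" using u_antimono[OF s, of t T] T t R by simp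
    have "u t powr (p - 1) \<le> u R powr (p - 1)"
      using u_antimono[OF s, of R t] ut t R p by (intro powr_mono2) auto
    then have "u t * u t powr (p - 1) \<le> u t * \<kappa>\<^sup>2"
      using small ut by (intro mult_left_mono) auto
    moreover have "u t * u t powr (p - 1) = max 0 (u t) powr p"
      using ut by (simp add: powr_mult_base)
    ultimately have "\<kappa>\<^sup>2 * u t - max 0 (u t) powr p \<ge> 0" by (simp add: mult.commute)
    moreover have "(2 * \<kappa> - V' t / V t) * v t \<ge> 0"
      using h[of t] t v_nonpos[OF s, of t] t0 by (intro mult_nonpos_nonpos) auto
    ultimately show "exp (\<kappa> * t) * ((2 * \<kappa> - V' t / V t) * v t + (\<kappa>\<^sup>2 * u t - max 0 (u t) powr p)) \<ge> 0"
      by simp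
  qed
  moreover have "exp (\<kappa> * R) * (v R + \<kappa> * u R) > 0" using slope by simp
  ultimately have "exp (\<kappa> * T) * v T > 0" using T(3) by simp
  then show False using v_nonpos[OF s, of T] T R by (simp add: zero_less_mult_iff)
qed

text \<open>
If the solution of height \<open>M\<close> were positive on \<open>[0,d]\<close>, its Pohozaev functional would be at least
\<open>c\<^sub>0 M\<^sup>e\<close> at radius \<open>\<rho> = M\<^sup>-\<^sup>(\<^sup>p\<^sup>-\<^sup>1\<^sup>)\<^sup>/\<^sup>2\<close>, the scale on which \<open>u \<ge> M/2\<close>. Here
\<open>e = p + 1 - n (p-1)/2\<close> is positive exactly because \<open>p\<close> is subcritical. At some point between
\<open>d/2\<close> and \<open>d\<close> the functional is at most a constant \<open>B\<close> not depending on \<open>M\<close>, by the decay bound for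
\<open>u\<close> and the mean value theorem for \<open>u'\<close>.
\<close>

lemma large_data_change_sign:
  assumes N: "N \<ge> 2" and p: "p > 1" and sub: "p < (real N + 3) / (real N - 1)"
  obtains M where "M > 0" "\<And>u v. emden p M u v \<Longrightarrow> \<exists>r\<ge>0. u r < 0"
proof -
  have gap: "(real N - 1) / 2 < (real N + 1) / (p + 1)"
    using sub p N by (simp add: field_simps)
  define X where "X = (real N + 1) / (p + 1)"
  \<comment> \<open>the exponent condition on \<open>p\<close> leaves room for a multiplier \<open>a\<close>; \<open>b\<close> is half of the remaining gap\<close>
  obtain a where a: "(real N - 1) / 2 < a" "a < X"
    using dense[OF gap] unfolding X_def by blast
  define b where "b = (X - a) / 2"
  have b: "b > 0" using a by (simp add: b_def)
  define k where "k r = r * V' r / V r" for r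
  have k_lim: "(k \<longlongrightarrow> real N) (at_right 0)" unfolding k_def by (rule V'_asymp)
  have "\<forall>\<^sub>F r in at_right 0. k r < 1 + 2 * a"
    by (rule order_tendstoD(2)[OF k_lim]) (use a in simp)
  moreover have "\<forall>\<^sub>F r in at_right 0. k r < real N + 1"
    by (rule order_tendstoD(2)[OF k_lim]) simp
  moreover have "\<forall>\<^sub>F r in at_right 0. (1 + k r) / (p + 1) - a > b"
  proof (rule order_tendstoD(1))
    have "((\<lambda>r. (1 + k r) / (p + 1) - a) \<longlongrightarrow> (1 + real N) / (p + 1) - a) (at_right 0)"
      using p by (intro tendsto_intros k_lim) auto
    then show "((\<lambda>r. (1 + k r) / (p + 1) - a) \<longlongrightarrow> X - a) (at_right 0)"
      by (simp add: X_def add.commute)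
    show "b < X - a" using a unfolding b_def by simp
  qed
  moreover have "\<forall>\<^sub>F r in at_right 0. V r / r ^ N > 1 / 2"
    by (rule order_tendstoD(1)[OF V_asymp]) simp
  ultimately have "\<forall>\<^sub>F r in at_right 0. k r < 1 + 2 * a \<and> k r < real N + 1 \<and>
      (1 + k r) / (p + 1) - a > b \<and> V r / r ^ N > 1 / 2"
    by eventually_elim auto
  then obtain d where d: "d > 0" and near: "\<And>r. 0 < r \<Longrightarrow> r < d \<Longrightarrow> k r < 1 + 2 * a \<and>
      k r < real N + 1 \<and> (1 + k r) / (p + 1) - a > b \<and> V r / r ^ N > 1 / 2"
    unfolding eventually_at_right_field by auto
  have V_low: "V r \<ge> r ^ N / 2" if "0 < r" "r < d" for r
    using near[OF that] that by (simp add: pos_less_divide_eq)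
  define C where "C = ((p - 1) * (d / 2)\<^sup>2 / (2 * ((real N + 1) + 1))) powr (- (1 / (p - 1)))"
  define B where "B = d * V d * ((2 * C / d)\<^sup>2 / 2 + C powr (p + 1) / (p + 1))"
  \<comment> \<open>the powers of \<open>M\<close> in \<open>M\<^sup>p\<^sup>+\<^sup>1 \<rho>\<^sup>N\<^sup>+\<^sup>1\<close> combine to the exponent \<open>e\<close>\<close>
  define e where "e = p + 1 - (real N + 1) * (p - 1) / 2"
  have e: "e > 0" using sub p N by (simp add: e_def field_simps)
  define c0 where "c0 = b / 2 * (1 / 2) powr (p + 1) / (real N + 1)"
  have c0: "c0 > 0" using b by (simp add: c0_def)
  have "\<forall>\<^sub>F M in at_top. c0 * M powr e > B"
    using eventually_gt_at_top[of "max 1 (B / c0) powr (1 / e)"]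
  proof eventually_elim
    case (elim M)
    then have "(max 1 (B / c0) powr (1 / e)) powr e < M powr e"
      using e by (intro powr_less_mono2) auto
    then have "B / c0 < M powr e" using e by (simp add: powr_powr)
    then show ?case using c0 by (simp add: pos_divide_less_eq mult.commute)
  qed
  moreover have "\<forall>\<^sub>F M in at_top. M powr (- ((p - 1) / 2)) < d / 2"
    using p d by (intro order_tendstoD(2)[OF tendsto_neg_powr] filterlim_ident) auto
  moreover have "\<forall>\<^sub>F M :: real in at_top. M > 0" by (rule eventually_gt_at_top)
  ultimately have "\<forall>\<^sub>F M in at_top. c0 * M powr e > B \<and> M powr (- ((p - 1) / 2)) < d / 2 \<and> M > 0"
    by eventually_elim auto
  then obtain M where M: "c0 * M powr e > B" "M powr (- ((p - 1) / 2)) < d / 2" "M > 0"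
    using eventually_happens[of _ "at_top :: real filter"] by auto
  define \<rho> where "\<rho> = M powr (- ((p - 1) / 2))"
  have \<rho>: "\<rho> > 0" "\<rho> < d / 2" using M by (auto simp: \<rho>_def)
  show thesis
  proof
    fix u v assume sol: "emden p M u v"
    note s = p M(3) sol
    show "\<exists>r\<ge>0. u r < 0"
    proof (rule ccontr)
      assume "\<not> (\<exists>r\<ge>0. u r < 0)"
      then have nonneg: "u r \<ge> 0" if "r \<ge> 0" for r using that by (meson not_le)
      have upos: "u r > 0" if "r \<ge> 0" for r
        using u_strict_antimono[OF s that, of "r + 1"] nonneg[of "r + 1"] that by simp
      have C: "u (d / 2) \<le> C"
        unfolding C_def
      proof (rule decay_bound[OF s])
        show "r * V' r / V r \<le> real N + 1" if "0 < r" "r < d / 2" for r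
          using near[of r] that unfolding k_def by simp
      qed (use d upos in auto)
      define P where "P r = r * V r * ((v r)\<^sup>2 / 2 + u r powr (p + 1) / (p + 1)) + a * (u r * (V r * v r))" for r
      have uM: "u r \<ge> M / 2" if "0 \<le> r" "r \<le> \<rho>" for r
      proof -
        have "M powr p * r\<^sup>2 \<le> M powr p * \<rho>\<^sup>2"
          using that by (intro mult_left_mono power_mono) auto
        also have "\<rho>\<^sup>2 = M powr (1 - p)"
        proof -
          have "- ((p - 1) / 2) + - ((p - 1) / 2) = 1 - p" by (simp add: field_simps)
          then show ?thesis unfolding \<rho>_def power2_eq_square powr_add[symmetric] by (simp only:)
        qed
        also have "M powr p * M powr (1 - p) = M"
          using M(3) by (simp flip: powr_add)
        finally show ?thesis using u_lower[OF s that(1)] by linarith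
      qed
      define c where "c = b / 2 * (M / 2) powr (p + 1)"
      have c: "c > 0" using b M by (simp add: c_def)
      have 1: "P 0 + c * (\<rho> ^ Suc N - 0 ^ Suc N) / (real N + 1) \<le> P \<rho>"
        unfolding P_def
      proof (rule pohozaev_increasing[OF s])
        fix r assume r: "0 < r" "r < \<rho>"
        then have rd: "r < d" using \<rho> d by linarith
        show "r * V' r / V r \<le> 1 + 2 * a" "(1 + r * V' r / V r) / (p + 1) - a \<ge> b"
          using near[OF r(1) rd] by (auto simp: k_def)
        have "c * r ^ N = b * (r ^ N / 2) * (M / 2) powr (p + 1)" by (simp add: c_def)
        also have "\<dots> \<le> b * V r * u r powr (p + 1)"
          using V_low[OF r(1) rd] uM[of r] r b M p V_nonneg[of r]
          by (intro mult_mono powr_mono2 mult_nonneg_nonneg) auto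
        finally show "c * r ^ N \<le> b * V r * u r powr (p + 1)" .
      qed (use \<rho> upos c in auto)
      have "c * \<rho> ^ Suc N / (real N + 1) = c0 * M powr e"
      proof -
        have "\<rho> ^ Suc N = M powr (- ((p - 1) / 2) * real (Suc N))"
          using M(3) by (simp add: \<rho>_def powr_power mult_ac del: power_Suc)
        moreover have "(M / 2) powr (p + 1) = (1 / 2) powr (p + 1) * M powr (p + 1)"
          using M(3) by (simp add: powr_divide powr_mult)
        moreover have "M powr (p + 1) * M powr (- ((p - 1) / 2) * real (Suc N)) = M powr e"
          unfolding powr_add[symmetric] by (simp add: e_def algebra_simps add_divide_distrib diff_divide_distrib)
        ultimately show ?thesis by (simp add: c_def c0_def del: power_Suc)
      qed
      with 1 V_0 have 2: "P \<rho> \<ge> c0 * M powr e" by (simp add: P_def)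
      obtain \<xi> where \<xi>: "d / 2 < \<xi>" "\<xi> < d" "u d - u (d / 2) = (d - d / 2) * v \<xi>"
        using MVT2[of "d / 2" d u v] d u_deriv[OF s] by auto
      have "P \<rho> + 0 * (\<xi> ^ Suc N - \<rho> ^ Suc N) / (real N + 1) \<le> P \<xi>"
        unfolding P_def
      proof (rule pohozaev_increasing[OF s])
        fix r assume r: "\<rho> < r" "r < \<xi>"
        then have rd: "0 < r" "r < d" using \<rho> \<xi> by linarith+
        show "r * V' r / V r \<le> 1 + 2 * a" "(1 + r * V' r / V r) / (p + 1) - a \<ge> b"
          using near[OF rd] by (auto simp: k_def)
        show "0 * r ^ N \<le> b * V r * u r powr (p + 1)"
          using b V_nonneg[of r] rd by simp
      qed (use \<rho> \<xi> upos[of \<xi>] in auto)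
      then have "c0 * M powr e \<le> P \<xi>" using 2 by simp
      also have "P \<xi> \<le> \<xi> * V \<xi> * ((v \<xi>)\<^sup>2 / 2 + u \<xi> powr (p + 1) / (p + 1))"
        using a N upos[of \<xi>] V_nonneg[of \<xi>] v_nonpos[OF s, of \<xi>] \<xi> d
        unfolding P_def by (simp add: mult_nonneg_nonpos)
      also have "\<dots> \<le> d * V d * ((2 * C / d)\<^sup>2 / 2 + C powr (p + 1) / (p + 1))"
      proof (intro mult_mono add_mono divide_right_mono powr_mono2)
        have ud: "u d \<ge> 0" by (rule nonneg) (use d in simp)
        have "- v \<xi> * d = 2 * (u (d / 2) - u d)" using \<xi>(3) by (simp add: field_simps)
        also have "\<dots> \<le> 2 * C"
        proof (rule mult_left_mono)
          show "u (d / 2) - u d \<le> C" using C ud by simp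
        qed simp
        finally have "- v \<xi> * d \<le> 2 * C" .
        then have "- v \<xi> \<le> 2 * C / d" using d by (simp add: pos_le_divide_eq)
        then have "(- v \<xi>)\<^sup>2 \<le> (2 * C / d)\<^sup>2"
          using v_nonpos[OF s, of \<xi>] \<xi> d by (intro power_mono) auto
        then show "(v \<xi>)\<^sup>2 \<le> (2 * C / d)\<^sup>2" unfolding power2_minus .
        show "u \<xi> \<le> C" using u_antimono[OF s, of "d / 2" \<xi>] \<xi> d C by simp
        show "V \<xi> \<le> V d" using \<xi> d by (intro V_mono) auto
      qed (use \<xi> d p upos[of \<xi>] V_nonneg[of \<xi>] V_nonneg[of d] in auto)
      also have "\<dots> = B" by (simp add: B_def)
      finally show False using M(1) by simp
    qed
  qed (rule M(3))
qed

section \<open>The borderline solution\<close>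

text \<open>
Up to the fixed radius \<open>R\<close> the drop of \<open>u\<close> and its slope are of order \<open>\<alpha>\<^sup>p\<close>, negligible against \<open>\<alpha>\<close>.
Hence the barrier applies at \<open>R\<close>.
\<close>

lemma small_data_positive:
  assumes p: "p > 1" and R: "R > 0" and \<kappa>: "\<kappa> > 0"
    and h: "\<And>r. r \<ge> R \<Longrightarrow> V' r / V r \<ge> 2 * \<kappa>"
  obtains \<epsilon> where "\<epsilon> > 0" "\<And>\<alpha> u v r. \<lbrakk>0 < \<alpha>; \<alpha> \<le> \<epsilon>; emden p \<alpha> u v; r \<ge> 0\<rbrakk> \<Longrightarrow> u r > 0"
proof
  \<comment> \<open>the three entries ensure in turn \<open>u(R) \<ge> \<alpha>/2\<close>, \<open>u' + \<kappa> u > 0\<close> and \<open>u\<^sup>p\<^sup>-\<^sup>1 \<le> \<kappa>\<^sup>2\<close> at \<open>R\<close>\<close>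
  define m where "m = min (1 / R\<^sup>2) (min (\<kappa> / (4 * R)) (\<kappa>\<^sup>2))"
  have m: "m > 0" "m * R\<^sup>2 \<le> 1" "m * R \<le> \<kappa> / 4" "m \<le> \<kappa>\<^sup>2"
  proof -
    show "m > 0" using R \<kappa> by (simp add: m_def)
    have "m \<le> 1 / R\<^sup>2" by (simp add: m_def)
    then show "m * R\<^sup>2 \<le> 1" using R by (simp add: pos_le_divide_eq)
    have "m \<le> \<kappa> / (4 * R)" by (simp add: m_def)
    then show "m * R \<le> \<kappa> / 4" using R by (simp add: pos_le_divide_eq)
    show "m \<le> \<kappa>\<^sup>2" by (simp add: m_def)
  qed
  show "m powr (1 / (p - 1)) > 0" using m by simp
  fix \<alpha> u v r assume \<alpha>: "0 < \<alpha>" "\<alpha> \<le> m powr (1 / (p - 1))" and sol: "emden p \<alpha> u v" and r: "r \<ge> (0::real)"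
  note s = p \<alpha>(1) sol
  define q where "q = \<alpha> powr (p - 1)"
  have "q \<le> (m powr (1 / (p - 1))) powr (p - 1)"
    unfolding q_def using \<alpha> p by (intro powr_mono2) auto
  also have "\<dots> = m" using p m by (simp add: powr_powr)
  finally have q: "q \<le> m" "q \<ge> 0" by (auto simp: q_def)
  have ap: "\<alpha> powr p = \<alpha> * q"
    unfolding q_def using \<alpha>(1) by (simp add: powr_mult_base)
  have "q * R\<^sup>2 \<le> m * R\<^sup>2" using q by (intro mult_right_mono) auto
  then have "\<alpha> * (q * R\<^sup>2) \<le> \<alpha> * 1" using m(2) \<alpha>(1) by (intro mult_left_mono) auto
  then have uR: "u R \<ge> \<alpha> / 2"
    using u_lower[OF s, of R] R unfolding ap by (simp add: mult.assoc)
  have "q * R \<le> \<kappa> / 4" 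
    by (rule order_trans[OF mult_right_mono m(3)]) (use q R in auto)
  then have "\<alpha> * (q * R) \<le> \<alpha> * (\<kappa> / 4)" using \<alpha>(1) by (intro mult_left_mono) auto
  then have vR: "v R \<ge> - (\<alpha> * (\<kappa> / 4))"
    using v_lower[OF s, of R] R unfolding ap by (simp add: mult.assoc)
  have "\<kappa> * (\<alpha> / 2) \<le> \<kappa> * u R" using uR \<kappa> by (intro mult_left_mono) auto
  moreover have "\<alpha> * (\<kappa> / 4) < \<kappa> * (\<alpha> / 2)" using \<alpha>(1) \<kappa> by (simp add: field_simps)
  ultimately have slope: "v R + \<kappa> * u R > 0" using vR by linarith
  have "u R powr (p - 1) \<le> q"
    unfolding q_def using u_le[OF s, of R] uR \<alpha>(1) R p by (intro powr_mono2) auto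
  then have small: "u R powr (p - 1) \<le> \<kappa>\<^sup>2" using q m(4) by linarith
  show "u r > 0"
  proof (cases "r \<ge> R")
    case True
    show ?thesis by (rule barrier[OF s R \<kappa> h slope small True])
  next
    case False
    then show ?thesis using u_antimono[OF s r, of R] uR \<alpha>(1) by simp
  qed
qed

text \<open>
The solution at the infimum \<open>a\<close> of the set \<open>A\<close> of sign-changing heights. Every property that holds
for all heights near \<open>a\<close> holds for some member of \<open>A\<close>; so open conditions that enforce positivity
cannot be satisfied at \<open>a\<close>. This rules out a positive limit at infinity as well as \<open>u' + \<kappa> u > 0\<close> at
radii where \<open>u\<close> is small.
\<close>

lemma exists_fast_decaying_solution:
  assumes N: "N \<ge> 2" and p: "p > 1" and sub: "p < (real N + 3) / (real N - 1)"
    and R0: "R0 > 0" and \<kappa>: "\<kappa> > 0" and h: "\<And>r. r \<ge> R0 \<Longrightarrow> V' r / V r \<ge> 2 * \<kappa>"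
  obtains \<alpha> u v R where "\<alpha> > 0" "emden p \<alpha> u v" "\<And>r. r \<ge> 0 \<Longrightarrow> u r > 0"
    "R > 0" "\<And>r. r \<ge> R \<Longrightarrow> \<kappa> * u r \<le> - v r" "\<And>r. r \<ge> R \<Longrightarrow> u r powr (p - 1) \<le> \<kappa>\<^sup>2 / 2"
proof -
  obtain M where M: "M > 0" "\<And>u v. emden p M u v \<Longrightarrow> \<exists>r\<ge>0. u r < 0"
    using large_data_change_sign[OF N p sub] by blast
  obtain u v where sol: "\<And>\<alpha>. 0 < \<alpha> \<Longrightarrow> \<alpha> \<le> M \<Longrightarrow> emden p \<alpha> (u \<alpha>) (v \<alpha>)"
    and ucont: "\<And>r S. r \<ge> 0 \<Longrightarrow> continuous_on S (\<lambda>\<alpha>. u \<alpha> r)"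
    and vcont: "\<And>r S. r \<ge> 0 \<Longrightarrow> continuous_on S (\<lambda>\<alpha>. v \<alpha> r)"
    using emden_family[OF p M(1)] by blast
  obtain \<epsilon> where \<epsilon>: "\<epsilon> > 0"
    "\<And>\<alpha> u v r. \<lbrakk>0 < \<alpha>; \<alpha> \<le> \<epsilon>; emden p \<alpha> u v; r \<ge> 0\<rbrakk> \<Longrightarrow> u r > 0"
    using small_data_positive[OF p R0 \<kappa> h] by blast
  define A where "A = {\<alpha>. 0 < \<alpha> \<and> \<alpha> \<le> M \<and> (\<exists>r\<ge>0. u \<alpha> r < 0)}"
  define a where "a = Inf A"
  have MA: "M \<in> A" using M sol[of M] by (auto simp: A_def)
  have A_low: "\<alpha> \<ge> \<epsilon>" if "\<alpha> \<in> A" for \<alpha>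
  proof (rule ccontr)
    assume "\<not> \<alpha> \<ge> \<epsilon>"
    then have "\<alpha> \<le> \<epsilon>" by simp
    from that obtain r where r: "0 < \<alpha>" "\<alpha> \<le> M" "r \<ge> 0" "u \<alpha> r < 0" by (auto simp: A_def)
    from \<epsilon>(2)[OF r(1) \<open>\<alpha> \<le> \<epsilon>\<close> sol[OF r(1,2)] r(3)] r(4) show False by simp
  qed
  have bdd: "bdd_below A" using A_low by (rule bdd_belowI)
  have a: "\<epsilon> \<le> a" "a \<le> M"
    unfolding a_def using MA A_low bdd by (auto intro: cInf_greatest cInf_lower)
  then have a0: "a > 0" using \<epsilon>(1) by simp
  note s = p a0 sol[OF a0 a(2)]
  have tends: "((\<lambda>\<beta>. u \<beta> r) \<longlongrightarrow> u a r) (at a)" "((\<lambda>\<beta>. v \<beta> r) \<longlongrightarrow> v a r) (at a)" if "r \<ge> 0" for r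
    using ucont[OF that, of UNIV] vcont[OF that, of UNIV] by (auto simp: continuous_on_def)
  have aA: "a \<notin> A"
  proof
    assume "a \<in> A"
    then obtain r where r: "r \<ge> 0" "u a r < 0" by (auto simp: A_def)
    have "\<forall>\<^sub>F \<beta> in at a. u \<beta> r < 0" by (rule order_tendstoD(2)[OF tends(1)[OF r(1)] r(2)])
    then have "\<forall>\<^sub>F \<beta> in at_left a. u \<beta> r < 0" by (rule filter_leD[OF at_le, rotated]) simp
    moreover have "\<forall>\<^sub>F \<beta> in at_left a. \<beta> \<in> {0<..<a}" by (rule eventually_at_left_real[OF a0])
    ultimately have "\<forall>\<^sub>F \<beta> in at_left a. u \<beta> r < 0 \<and> \<beta> \<in> {0<..<a}" by (rule eventually_conj)
    then obtain \<beta> where \<beta>: "u \<beta> r < 0" "0 < \<beta>" "\<beta> < a"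
      using eventually_happens[of _ "at_left a"] by (auto simp: trivial_limit_at_left_real)
    then have "\<beta> \<in> A" using r a by (auto simp: A_def)
    then show False using cInf_lower[OF _ bdd] \<beta>(3) unfolding a_def by fastforce
  qed
  have near: "\<exists>\<beta>\<in>A. P \<beta>" if ev: "\<forall>\<^sub>F \<beta> in at a. P \<beta>" for P
  proof -
    obtain d where d: "d > 0" "\<And>\<beta>. \<beta> \<noteq> a \<Longrightarrow> dist \<beta> a < d \<Longrightarrow> P \<beta>"
      using ev unfolding eventually_at by auto
    obtain \<beta> where \<beta>: "\<beta> \<in> A" "\<beta> < a + d"
      using cInf_lessD[of A "a + d"] MA d(1) unfolding a_def by auto
    have "a \<le> \<beta>" unfolding a_def by (rule cInf_lower[OF \<beta>(1) bdd])
    then show ?thesis using d(2)[of \<beta>] \<beta> aA by (auto simp: dist_real_def)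
  qed
  have nonneg: "u a r \<ge> 0" if "r \<ge> 0" for r
    using aA that a a0 by (force simp: A_def)
  have upos: "u a r > 0" if "r \<ge> 0" for r
    using u_strict_antimono[OF s that, of "r + 1"] nonneg[of "r + 1"] that by simp
  have A_sol: "0 < \<beta>" "emden p \<beta> (u \<beta>) (v \<beta>)" "\<beta> \<le> M" if "\<beta> \<in> A" for \<beta>
    using that sol by (auto simp: A_def)
  have "\<exists>r\<ge>0. u a r < c" if c: "c > 0" for c
  proof (rule ccontr)
    assume "\<not> (\<exists>r\<ge>0. u a r < c)"
    then have uc: "u a r \<ge> c" if "r \<ge> 0" for r using that by (meson not_le)
    \<comment> \<open>\<open>G\<close> is bounded because it is dominated by the drop of the solution with positive limit, and its increments control the drop of every other solution\<close>
    define G where "G r = integral {0..r} (avg (\<lambda>_. 1))" for r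
    note one = continuous_on_const[of "{0..}" "1::real"]
    have G_cont: "continuous_on {0..r} G" for r
      unfolding G_def using int_avg_cont[OF one] by (rule continuous_on_subset) auto
    have G_der: "(G has_real_derivative avg (\<lambda>_. 1) r) (at r)" if "r > 0" for r
      unfolding G_def by (rule int_avg_deriv[OF one that])
    have drop: "u \<beta> r \<ge> u \<beta> R - \<beta> powr p * (G r - G R)"
      if "\<beta> > 0" "emden p \<beta> (u \<beta>) (v \<beta>)" "0 \<le> R" "R \<le> r" for \<beta> r R
    proof -
      have "u \<beta> R + \<beta> powr p * G R \<le> u \<beta> r + \<beta> powr p * G r"
      proof (rule le_of_deriv_nonneg[OF that(4)])
        show "continuous_on {R..r} (\<lambda>r. u \<beta> r + \<beta> powr p * G r)"
          using that by (intro continuous_intros u_cont[OF p that(1,2)] continuous_on_subset[OF G_cont[of r]]) auto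
        fix t assume t: "R < t" "t < r"
        show "((\<lambda>r. u \<beta> r + \<beta> powr p * G r) has_real_derivative v \<beta> t + \<beta> powr p * avg (\<lambda>_. 1) t) (at t)"
          using t that by (intro DERIV_add DERIV_cmult u_deriv[OF p that(1,2)] G_der) auto
        show "v \<beta> t + \<beta> powr p * avg (\<lambda>_. 1) t \<ge> 0"
          using v_ge_avg[OF p that(1,2), of t] t that by simp
      qed
      then show ?thesis by (simp add: right_diff_distrib)
    qed
    have avg1: "avg (\<lambda>_. 1) t \<ge> 0" if "t > 0" for t
      unfolding avg_def using that
      by (intro divide_nonneg_nonneg integral_nonneg Vg_int one) (auto intro: V_nonneg)
    have G_mono: "G x \<le> G y" if "0 \<le> x" "x \<le> y" for x y
      by (rule le_of_deriv_nonneg[OF that(2) _ G_der avg1])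
        (use that in \<open>auto intro: continuous_on_subset[OF G_cont[of y]]\<close>)
    have G_bdd: "G r \<le> a / c powr p" if "r \<ge> 0" for r
    proof -
      have "- u a 0 - c powr p * G 0 \<le> - u a r - c powr p * G r"
      proof (rule le_of_deriv_nonneg[OF that])
        show "continuous_on {0..r} (\<lambda>r. - u a r - c powr p * G r)"
          by (intro continuous_intros u_cont[OF s] G_cont) auto
        fix t assume t: "0 < t" "t < r"
        show "((\<lambda>r. - u a r - c powr p * G r) has_real_derivative - v a t - c powr p * avg (\<lambda>_. 1) t) (at t)"
          using t by (intro DERIV_diff DERIV_minus DERIV_cmult u_deriv[OF s] G_der) auto
        show "- v a t - c powr p * avg (\<lambda>_. 1) t \<ge> 0"
          using v_le_avg[OF s t(1) less_imp_le[OF c] uc] t by simp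
      qed
      then have "c powr p * G r \<le> a" using upos[OF that] u_0[OF s] by (simp add: G_def)
      then show ?thesis using c by (simp add: pos_le_divide_eq mult.commute)
    qed
    define S where "S = Sup (G ` {0..})"
    have bddG: "bdd_above (G ` {0..})" using G_bdd by (auto intro!: bdd_aboveI)
    have eps: "c / (4 * M powr p) > 0" using c M by simp
    \<comment> \<open>beyond \<open>R\<close> no solution of height at most \<open>M\<close> drops by more than \<open>c/4\<close>\<close>
    obtain R where R: "R \<ge> 0" "G R > S - c / (4 * M powr p)"
      using less_cSupD[of "G ` {0..}" "S - c / (4 * M powr p)"] eps unfolding S_def by auto
    have "\<forall>\<^sub>F \<beta> in at a. u \<beta> R > c / 2"
      by (rule order_tendstoD(1)[OF tends(1)[OF R(1)]]) (use uc[OF R(1)] c in simp)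
    then obtain \<beta> where \<beta>: "\<beta> \<in> A" "u \<beta> R > c / 2" using near by blast
    note \<beta>s = A_sol[OF \<beta>(1)]
    obtain r where r: "r \<ge> 0" "u \<beta> r < 0" using \<beta>(1) by (auto simp: A_def)
    have Rr: "R \<le> r"
      using u_antimono[OF p \<beta>s(1,2) r(1), of R] r \<beta>(2) c by (cases "R \<le> r") auto
    have "G r \<le> S" unfolding S_def using r bddG by (intro cSup_upper) auto
    then have "G r - G R \<le> c / (4 * M powr p)" using R(2) by linarith
    moreover have "\<beta> powr p \<le> M powr p" using \<beta>s p by (intro powr_mono2) auto
    ultimately have "\<beta> powr p * (G r - G R) \<le> M powr p * (c / (4 * M powr p))"
      using G_mono[OF R(1) Rr] by (intro mult_mono) auto
    also have "\<dots> = c / 4" using M(1) by simp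
    finally show False using drop[OF \<beta>s(1,2) R(1) Rr] r(2) \<beta>(2) c by linarith
  qed
  moreover have "(\<kappa>\<^sup>2 / 2) powr (1 / (p - 1)) > 0" using \<kappa> by simp
  ultimately obtain R1 where R1: "R1 \<ge> 0" "u a R1 < (\<kappa>\<^sup>2 / 2) powr (1 / (p - 1))" by blast
  define R where "R = max R0 R1"
  have R: "R > 0" "R \<ge> R0" "R \<ge> R1" using R0 by (auto simp: R_def)
  have small: "u a r powr (p - 1) \<le> \<kappa>\<^sup>2 / 2" if "r \<ge> R" for r
  proof -
    have "u a r \<le> (\<kappa>\<^sup>2 / 2) powr (1 / (p - 1))"
      using u_antimono[OF s R1(1), of r] R1(2) R that by simp
    then have "u a r powr (p - 1) \<le> ((\<kappa>\<^sup>2 / 2) powr (1 / (p - 1))) powr (p - 1)"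
      using upos[of r] that R p by (intro powr_mono2) auto
    then show ?thesis using p by (simp add: powr_powr)
  qed
  have steep: "\<kappa> * u a r \<le> - v a r" if r: "r \<ge> R" for r
  proof (rule ccontr)
    assume "\<not> \<kappa> * u a r \<le> - v a r"
    then have slope: "v a r + \<kappa> * u a r > 0" by linarith
    have r0: "r > 0" using r R by simp
    note t = tends[OF less_imp_le[OF r0]]
    have ur: "u a r > 0" using upos[of r] r0 by simp
    have "\<forall>\<^sub>F \<beta> in at a. v \<beta> r + \<kappa> * u \<beta> r > 0"
      by (rule order_tendstoD(1)[OF _ slope]) (intro tendsto_intros t)
    moreover have "\<forall>\<^sub>F \<beta> in at a. u \<beta> r powr (p - 1) < \<kappa>\<^sup>2"
    proof (rule order_tendstoD(2))
      show "((\<lambda>\<beta>. u \<beta> r powr (p - 1)) \<longlongrightarrow> u a r powr (p - 1)) (at a)"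
        using ur by (intro tendsto_powr t tendsto_const) auto
      show "u a r powr (p - 1) < \<kappa>\<^sup>2"
        using small[OF r] zero_less_power[OF \<kappa>, of 2] by linarith
    qed
    ultimately have "\<forall>\<^sub>F \<beta> in at a. v \<beta> r + \<kappa> * u \<beta> r > 0 \<and> u \<beta> r powr (p - 1) < \<kappa>\<^sup>2"
      by (rule eventually_conj)
    then obtain \<beta> where \<beta>: "\<beta> \<in> A" "v \<beta> r + \<kappa> * u \<beta> r > 0" "u \<beta> r powr (p - 1) < \<kappa>\<^sup>2"
      using near by blast
    note \<beta>s = A_sol[OF \<beta>(1)]
    have pos: "u \<beta> x > 0" if "x \<ge> r" for x
      by (rule barrier[OF p \<beta>s(1,2) r0 \<kappa> h \<beta>(2) less_imp_le[OF \<beta>(3)] that]) (use r R in simp)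
    obtain x where x: "x \<ge> 0" "u \<beta> x < 0" using \<beta>(1) by (auto simp: A_def)
    then have "x < r" using pos[of x] by (cases "x < r") auto
    then show False using u_antimono[OF p \<beta>s(1,2) x(1), of r] pos[of r] x by simp
  qed
  show thesis
    by (rule that[OF a0 s(3) upos R(1) steep small])
qed

text \<open>
The derivative of \<open>- V u u'\<close> is \<open>V u\<^sup>p\<^sup>+\<^sup>1 - V u'\<^sup>2\<close>, and \<open>u\<^sup>p\<^sup>+\<^sup>1 \<le> (\<kappa> u)\<^sup>2/2 \<le> u'\<^sup>2/2\<close> beyond \<open>R\<close>. So half
the energy is bounded by the value of \<open>- V u u'\<close> at \<open>R\<close>.
\<close>

lemma fast_decay_energy:
  assumes p: "p > 1" and \<alpha>: "\<alpha> > 0" and sol: "emden p \<alpha> u v"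
    and pos: "\<And>r. r \<ge> 0 \<Longrightarrow> u r > 0" and R: "R > 0" and \<kappa>: "\<kappa> > 0"
    and steep: "\<And>r. r \<ge> R \<Longrightarrow> \<kappa> * u r \<le> - v r"
    and small: "\<And>r. r \<ge> R \<Longrightarrow> u r powr (p - 1) \<le> \<kappa>\<^sup>2 / 2"
    and x: "x \<ge> R"
  shows "integral {R..x} (\<lambda>r. V r * (v r)\<^sup>2) \<le> - 2 * (u R * (V R * v R))"
proof -
  note s = p \<alpha> sol
  have cont: "continuous_on {R..y} (\<lambda>r. V r * (v r)\<^sup>2)" for y
    using R continuous_on_subset[OF V_cont] by (intro continuous_intros v_cont[OF s]) auto
  define I where "I y = integral {R..y} (\<lambda>r. V r * (v r)\<^sup>2)" for y
  have "- I R + 2 * (u R * (V R * v R)) \<le> - I x + 2 * (u x * (V x * v x))"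
  proof (rule le_of_deriv_nonneg[OF x])
    show "continuous_on {R..x} (\<lambda>x. - I x + 2 * (u x * (V x * v x)))"
      unfolding I_def using R
      by (intro continuous_intros indefinite_integral_continuous_1 integrable_continuous_real cont
          u_cont[OF s] flux_cont[OF s]) auto
    fix t assume t: "R < t" "t < x"
    have t0: "t > 0" using t R by simp
    have "(I has_real_derivative V t * (v t)\<^sup>2) (at t within {R..x})"
      unfolding I_def using integral_has_real_derivative[OF cont] t by auto
    then have "(I has_real_derivative V t * (v t)\<^sup>2) (at t)"
      using at_within_Icc_at[of R t x] t by simp
    then show "((\<lambda>x. - I x + 2 * (u x * (V x * v x))) has_real_derivative
        - (V t * (v t)\<^sup>2) + 2 * (v t * (V t * v t) + (- V t * max 0 (u t) powr p) * u t)) (at t)"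
      by (intro DERIV_add DERIV_minus DERIV_cmult DERIV_mult u_deriv[OF s t0] flux_deriv[OF s t0])
    have ut: "u t > 0" using pos[of t] t0 by simp
    have mx: "max 0 (u t) powr p = u t * u t powr (p - 1)" using ut by (simp add: powr_mult_base)
    have "(u t)\<^sup>2 * u t powr (p - 1) \<le> (u t)\<^sup>2 * (\<kappa>\<^sup>2 / 2)"
      using small[of t] t by (intro mult_left_mono) auto
    also have "\<dots> = (\<kappa> * u t)\<^sup>2 / 2" by (simp add: power_mult_distrib)
    also have "\<dots> \<le> (- v t)\<^sup>2 / 2"
      using steep[of t] t ut \<kappa> by (intro divide_right_mono power_mono) auto
    finally have "(u t)\<^sup>2 * u t powr (p - 1) \<le> (v t)\<^sup>2 / 2" by simp
    then have le: "V t * (2 * ((u t)\<^sup>2 * u t powr (p - 1))) \<le> V t * (v t)\<^sup>2"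
      using V_nonneg[of t] t0 by (intro mult_left_mono) auto
    show "- (V t * (v t)\<^sup>2) + 2 * (v t * (V t * v t) + (- V t * max 0 (u t) powr p) * u t) \<ge> 0"
    proof -
      have "- (V t * (v t)\<^sup>2) + 2 * (v t * (V t * v t) + (- V t * max 0 (u t) powr p) * u t)
          = V t * (v t)\<^sup>2 - V t * (2 * ((u t)\<^sup>2 * u t powr (p - 1)))"
        unfolding mx power2_eq_square by algebra
      then show ?thesis using le by (simp only: diff_ge_0_iff_ge)
    qed
  qed
  moreover have "u x * (V x * v x) \<le> 0"
    using x R
    by (intro mult_nonneg_nonpos V_nonneg v_nonpos[OF s] less_imp_le[OF pos]) auto
  ultimately show ?thesis by (simp add: I_def)
qed

end

section \<open>Integration of radial functions and of derivatives\<close>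

text \<open>
Both the image of Lebesgue measure under the norm and the measure with density
\<open>d \<omega>\<^sub>d r\<^sup>d\<^sup>-\<^sup>1\<close> on the half line give a ball of radius \<open>a\<close> the mass \<open>\<omega>\<^sub>d a\<^sup>d\<close>, and half lines \<open>{..a}\<close>
generate the Borel sets.
\<close>

lemma nn_integral_radial:
  fixes F :: "real \<Rightarrow> ennreal"
  assumes F: "F \<in> borel_measurable borel"
  shows "(\<integral>\<^sup>+x. F (norm (x::'a::euclidean_space)) \<partial>lborel) =
    ennreal (real DIM('a) * unit_ball_vol (real DIM('a))) *
      (\<integral>\<^sup>+r. F r * ennreal (r ^ (DIM('a) - 1)) * indicator {0..} r \<partial>lborel)"
proof -
  note F [measurable]
  define d where "d = DIM('a)"
  define K where "K = real d * unit_ball_vol (real d)"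
  have d: "d > 0" and K: "K \<ge> 0" by (auto simp: d_def K_def)
  define D where "D r = ennreal (K * r ^ (d - 1)) * indicator {0..} r" for r :: real
  have D_meas: "D \<in> borel_measurable borel" unfolding D_def by measurable
  have ball: "emeasure (distr lborel borel (norm :: 'a \<Rightarrow> real)) {..a} =
      ennreal (unit_ball_vol (real d) * max 0 a ^ d)" for a
  proof -
    have "emeasure (distr lborel borel (norm :: 'a \<Rightarrow> real)) {..a}
        = emeasure lborel {x::'a. norm x \<le> a}"
      by (subst emeasure_distr) (auto intro!: arg_cong[where f = "emeasure lborel"])
    also have "\<dots> = ennreal (unit_ball_vol (real d) * max 0 a ^ d)"
    proof (cases "a \<ge> 0")
      case True
      then show ?thesis
        using emeasure_cball[of a "0::'a"] by (simp add: d_def cball_def)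
    next
      case False
      then have "{x::'a. norm x \<le> a} = {}"
        using norm_ge_zero by (metis (mono_tags, lifting) Collect_empty_eq order_trans)
      then show ?thesis using False d by simp
    qed
    finally show ?thesis .
  qed
  have eq: "distr lborel borel (norm :: 'a \<Rightarrow> real) = density lborel D"
  proof (rule measure_eqI_generator_eq[where E = "range atMost" and \<Omega> = UNIV and A = "\<lambda>i. {..real i}"])
    show "Int_stable (range (atMost :: real \<Rightarrow> _))"
      by (auto simp: Int_stable_def)
    fix X :: "real set" assume "X \<in> range atMost"
    then obtain a where X: "X = {..a}" by auto
    have "emeasure (density lborel D) X = (\<integral>\<^sup>+r. ennreal (K * r ^ (d - 1)) * indicator {0..max 0 a} r \<partial>lborel)"
    proof -
      have "emeasure (density lborel D) X = (\<integral>\<^sup>+r. D r * indicator X r \<partial>lborel)"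
        using D_meas X by (subst emeasure_density) auto
      also have "\<dots> = (\<integral>\<^sup>+r. ennreal (K * r ^ (d - 1)) * indicator {0..max 0 a} r \<partial>lborel)"
      proof (rule nn_integral_cong_AE)
        have "AE r in lborel. r \<noteq> (0::real)" by (rule AE_lborel_singleton)
        then show "AE r in lborel. D r * indicator X r = ennreal (K * r ^ (d - 1)) * indicator {0..max 0 a} r"
          by eventually_elim (auto simp: D_def X indicator_def)
      qed
      finally show ?thesis .
    qed
    also have "\<dots> = ennreal (unit_ball_vol (real d) * max 0 a ^ d - unit_ball_vol (real d) * 0 ^ d)"
    proof (rule nn_integral_FTC_Icc)
      fix x :: real
      have "((\<lambda>r. unit_ball_vol (real d) * r ^ d) has_real_derivative
          unit_ball_vol (real d) * (real d * x ^ (d - 1))) (at x)"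
        using DERIV_pow[of d x] by (intro DERIV_cmult) simp
      then show "((\<lambda>r. unit_ball_vol (real d) * r ^ d) has_real_derivative K * x ^ (d - 1)) (at x)"
        by (simp add: K_def mult_ac)
      assume "x \<in> {0..max 0 a}"
      then show "0 \<le> K * x ^ (d - 1)" using K by simp
    qed auto
    finally show "emeasure (distr lborel borel (norm :: 'a \<Rightarrow> real)) X = emeasure (density lborel D) X"
      using d by (simp add: X ball)
  next
    show "emeasure (distr lborel borel (norm :: 'a \<Rightarrow> real)) {..real i} \<noteq> \<infinity>" for i
      by (simp add: ball)
  next
    show "sets (distr lborel borel (norm :: 'a \<Rightarrow> real)) = sigma_sets UNIV (range atMost)"
      "sets (density lborel D) = sigma_sets UNIV (range atMost)"
      by (simp_all add: borel_eq_atMost)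
    show "(\<Union>i. {..real i}) = UNIV" by (auto intro: real_arch_simple)
  qed auto
  have "(\<integral>\<^sup>+x. F (norm (x::'a)) \<partial>lborel) = (\<integral>\<^sup>+r. F r \<partial>distr lborel borel (norm :: 'a \<Rightarrow> real))"
    using F by (subst nn_integral_distr) auto
  also have "\<dots> = (\<integral>\<^sup>+r. D r * F r \<partial>lborel)"
    unfolding eq using D_meas F by (subst nn_integral_density) auto
  also have "\<dots> = (\<integral>\<^sup>+r. ennreal K * (F r * ennreal (r ^ (d - 1)) * indicator {0..} r) \<partial>lborel)"
    using K by (intro nn_integral_cong) (auto simp: D_def indicator_def ennreal_mult' mult_ac)
  also have "\<dots> = ennreal K * (\<integral>\<^sup>+r. F r * ennreal (r ^ (d - 1)) * indicator {0..} r \<partial>lborel)"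
    by (intro nn_integral_cmult) measurable
  finally show ?thesis by (simp add: K_def d_def)
qed

text \<open>
For a nonnegative integrand, bounded integrals over compact intervals pass to the half line by
monotone convergence.
\<close>

lemma nn_integral_half_line_finite:
  fixes f :: "real \<Rightarrow> real"
  assumes cont: "continuous_on {0..} f" and nonneg: "\<And>x. x \<ge> 0 \<Longrightarrow> f x \<ge> 0"
    and R: "R \<ge> 0" and bound: "\<And>x. x \<ge> R \<Longrightarrow> integral {R..x} f \<le> C"
  shows "(\<integral>\<^sup>+x. ennreal (f x) * indicator {0..} x \<partial>lborel) < \<infinity>"
proof -
  define g where "g x = ennreal (f (max 0 x))" for x
  have "(\<lambda>x. f (max 0 x)) \<in> borel_measurable borel"
    by (intro borel_measurable_continuous_onI continuous_on_compose2[OF cont] continuous_intros) auto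
  then have g: "g \<in> borel_measurable borel" unfolding g_def by measurable
  have int: "f integrable_on {a..b}" if "0 \<le> a" for a b
    using that by (intro integrable_continuous_real continuous_on_subset[OF cont]) auto
  have "emeasure (density lborel g) {0..R + real k} \<le> ennreal (integral {0..R} f + C)" for k
  proof -
    have "emeasure (density lborel g) {0..R + real k}
        = (\<integral>\<^sup>+x. ennreal (f x) * indicator {0..R + real k} x \<partial>lborel)"
      using g by (subst emeasure_density) (auto intro!: nn_integral_cong simp: g_def indicator_def)
    also have "\<dots> = ennreal (integral {0..R + real k} f)"
      using nonneg int by (intro nn_integral_has_integral_lebesgue') (auto intro!: integrable_integral)
    also have "integral {0..R + real k} f = integral {0..R} f + integral {R..R + real k} f"
      using R int by (intro Henstock_Kurzweil_Integration.integral_combine[symmetric]) auto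
    also have "\<dots> \<le> integral {0..R} f + C" using bound[of "R + real k"] by simp
    finally show ?thesis by (simp add: ennreal_leI)
  qed
  then have "(SUP k. emeasure (density lborel g) {0..R + real k}) \<le> ennreal (integral {0..R} f + C)"
    by (rule SUP_least)
  moreover have "(SUP k. emeasure (density lborel g) {0..R + real k})
      = emeasure (density lborel g) (\<Union>k. {0..R + real k})"
    by (intro SUP_emeasure_incseq) (auto simp: incseq_def)
  moreover have "(\<Union>k. {0..R + real k}) = {0..}"
  proof -
    have "\<exists>k. x \<le> R + real k" for x
      using real_arch_simple[of "x - R"] by (auto simp: diff_le_eq add.commute)
    then show ?thesis by auto
  qed
  moreover have "emeasure (density lborel g) {0..} = (\<integral>\<^sup>+x. ennreal (f x) * indicator {0..} x \<partial>lborel)"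
    using g by (subst emeasure_density) (auto intro!: nn_integral_cong simp: g_def indicator_def)
  ultimately show ?thesis by (simp add: le_less_trans)
qed

lemma integrable_compact_support:
  fixes f :: "'a::euclidean_space \<Rightarrow> real"
  assumes K: "compact K" and f: "continuous_on UNIV f" and zero: "\<And>x. x \<notin> K \<Longrightarrow> f x = 0"
  shows "integrable lborel f"
proof -
  have "integrable lborel (\<lambda>x. indicator K x *\<^sub>R f x)"
    by (rule borel_integrable_compact[OF K continuous_on_subset[OF f]]) simp
  moreover have "(\<lambda>x. indicator K x *\<^sub>R f x) = f"
    using zero by (auto simp: indicator_def fun_eq_iff)
  ultimately show ?thesis by simp
qed

text \<open>
The divergence theorem for compact support. The difference quotients of \<open>f\<close> in direction \<open>e\<close> have
integral zero by translation invariance of Lebesgue measure, and they converge to \<open>g\<close> boundedly and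
with support in one compact set.
\<close>

lemma integral_directional_derivative_zero:
  fixes f g :: "'a::euclidean_space \<Rightarrow> real"
  assumes K: "compact K" and zero: "\<And>x. x \<notin> K \<Longrightarrow> f x = 0"
    and f: "continuous_on UNIV f" and g: "continuous_on UNIV g"
    and der: "\<And>x. ((\<lambda>t. f (x + t *\<^sub>R e)) has_real_derivative g x) (at 0)"
  shows "integrable lborel g" "(LINT x|lborel. g x) = 0"
proof -
  have g0: "g x = 0" if x: "x \<notin> K" for x
  proof -
    have "((\<lambda>t. x + t *\<^sub>R e) \<longlongrightarrow> x + 0 *\<^sub>R e) (at 0)" by (intro tendsto_intros)
    then have "\<forall>\<^sub>F t in at 0. x + t *\<^sub>R e \<in> - K"
      using x compact_imp_closed[OF K] by (intro topological_tendstoD) (auto simp: open_Compl)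
    then have "\<forall>\<^sub>F t in at 0. f (x + t *\<^sub>R e) = 0" by eventually_elim (use zero in auto)
    moreover have "f (x + 0 *\<^sub>R e) = 0" using zero x by simp
    ultimately have "((\<lambda>t. f (x + t *\<^sub>R e)) has_real_derivative g x) (at 0) \<longleftrightarrow>
        ((\<lambda>t. 0) has_real_derivative g x) (at (0::real))"
      by (intro has_field_derivative_cong_eventually) auto
    then show ?thesis using der[of x] DERIV_unique[of "\<lambda>_. 0" "g x" 0 0] by auto
  qed
  show "integrable lborel g" by (rule integrable_compact_support[OF K g g0])
  have der': "((\<lambda>t. f (x + t *\<^sub>R e)) has_real_derivative g (x + s *\<^sub>R e)) (at s)" for x s
  proof -
    have "((\<lambda>t. f ((x + s *\<^sub>R e) + t *\<^sub>R e)) has_real_derivative g (x + s *\<^sub>R e)) (at 0)"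
      by (rule der)
    then show ?thesis
      using DERIV_shift[of "\<lambda>t. f (x + t *\<^sub>R e)" "g (x + s *\<^sub>R e)" 0 s]
      by (simp add: algebra_simps)
  qed
  obtain B where B: "\<And>x. \<bar>g x\<bar> \<le> B"
  proof -
    have "bounded (g ` K)"
      by (intro compact_imp_bounded compact_continuous_image continuous_on_subset[OF g] K) simp
    then obtain B where "\<And>x. x \<in> K \<Longrightarrow> \<bar>g x\<bar> \<le> B" unfolding bounded_iff by auto
    then have "\<bar>g x\<bar> \<le> max B 0" for x using g0[of x] by (cases "x \<in> K") (auto simp: le_max_iff_disj)
    then show ?thesis by (rule that)
  qed
  define q where "q k x = (f (x + (1 / Suc k) *\<^sub>R e) - f x) / (1 / Suc k)" for k :: nat and x
  \<comment> \<open>all points from which a step of length at most 1 along \<open>e\<close> can reach the support\<close>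
  define K' where "K' = (\<lambda>(x, t). x - t *\<^sub>R e) ` (K \<times> {0..1})"
  have K': "compact K'"
    unfolding K'_def case_prod_unfold
    by (intro compact_continuous_image continuous_intros compact_Times K) auto
  have q_bound: "\<bar>q k x\<bar> \<le> B * indicator K' x" for k x
  proof -
    have t: "0 < 1 / real (Suc k)" "1 / real (Suc k) \<le> 1" by auto
    obtain z where z: "0 < z" "z < 1 / real (Suc k)"
      "f (x + (1 / Suc k) *\<^sub>R e) - f (x + 0 *\<^sub>R e) = (1 / Suc k - 0) * g (x + z *\<^sub>R e)"
      using MVT2[OF t(1), of "\<lambda>t. f (x + t *\<^sub>R e)" "\<lambda>t. g (x + t *\<^sub>R e)"] der' by blast
    then have q: "q k x = g (x + z *\<^sub>R e)" by (simp add: q_def)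
    show ?thesis
    proof (cases "x \<in> K'")
      case True
      then show ?thesis using B q by simp
    next
      case False
      have "x + z *\<^sub>R e \<notin> K"
      proof
        assume "x + z *\<^sub>R e \<in> K"
        then have "(x + z *\<^sub>R e) - z *\<^sub>R e \<in> K'"
          unfolding K'_def using z(1) less_imp_le[OF less_le_trans[OF z(2) t(2)]]
          by (intro image_eqI[of _ _ "(x + z *\<^sub>R e, z)"]) auto
        then show False using False by simp
      qed
      then show ?thesis using g0 q False by simp
    qed
  qed
  have f_int: "integrable lborel f" by (rule integrable_compact_support[OF K f zero])
  have f_meas [measurable]: "f \<in> borel_measurable borel" by (rule borel_measurable_continuous_onI[OF f])
  have g_meas [measurable]: "g \<in> borel_measurable borel" by (rule borel_measurable_continuous_onI[OF g])
  have shift: "(LINT x|lborel. f (x + a)) = (LINT x|lborel. f x)" "integrable lborel (\<lambda>x. f (x + a))" for a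
  proof -
    have "(LINT x|lborel. f x) = (LINT x|distr lborel borel ((+) a). f x)"
      by (simp add: lborel_distr_plus)
    also have "\<dots> = (LINT x|lborel. f (a + x))" by (subst integral_distr) auto
    finally show "(LINT x|lborel. f (x + a)) = (LINT x|lborel. f x)" by (simp add: add.commute)
    have "integrable (distr lborel borel ((+) a)) f" using f_int by (simp add: lborel_distr_plus)
    then have "integrable lborel (\<lambda>x. f (a + x))" by (subst (asm) integrable_distr_eq) auto
    then show "integrable lborel (\<lambda>x. f (x + a))" by (simp add: add.commute)
  qed
  have q_int: "(LINT x|lborel. q k x) = 0" for k
    unfolding q_def using shift[of "(1 / Suc k) *\<^sub>R e"] f_int by (simp add: Bochner_Integration.integral_diff)
  have "(\<lambda>k. LINT x|lborel. q k x) \<longlonglongrightarrow> (LINT x|lborel. g x)"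
  proof (rule integral_dominated_convergence)
    show "integrable lborel (\<lambda>x. B * indicator K' x)"
      using K' emeasure_compact_finite[OF K'] compact_imp_closed[OF K'] by (intro integrable_mult_right) auto
    show "AE x in lborel. (\<lambda>k. q k x) \<longlonglongrightarrow> g x"
    proof (rule AE_I2)
      fix x
      have "filterlim (\<lambda>k. 1 / real (Suc k)) (at 0) sequentially"
        unfolding filterlim_at using LIMSEQ_inverse_real_of_nat by (auto simp: inverse_eq_divide)
      moreover have "((\<lambda>t. (f (x + (0 + t) *\<^sub>R e) - f (x + 0 *\<^sub>R e)) / t) \<longlongrightarrow> g x) (at 0)"
        using der[of x] unfolding DERIV_def by simp
      ultimately have "(\<lambda>k. (f (x + (0 + 1 / real (Suc k)) *\<^sub>R e) - f (x + 0 *\<^sub>R e)) / (1 / real (Suc k)))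
          \<longlonglongrightarrow> g x"
        by (rule filterlim_compose[rotated])
      then show "(\<lambda>k. q k x) \<longlonglongrightarrow> g x" by (simp add: q_def)
    qed
    show "AE x in lborel. norm (q k x) \<le> B * indicator K' x" for k using q_bound by simp
    show "q k \<in> borel_measurable lborel" for k unfolding q_def by measurable
  qed measurable
  then show "(LINT x|lborel. g x) = 0" using q_int by (simp add: LIMSEQ_const_iff)
qed

section \<open>Linear algebra of the model metric\<close>

lemma model_metric_mult:
  fixes x w :: "real ^ 'n::finite" and \<psi> :: "real \<Rightarrow> real"
  assumes x: "x \<noteq> 0"
  defines "\<Theta> \<equiv> (1 / norm x) *\<^sub>R x" and "c \<equiv> (\<psi> (norm x) / norm x)\<^sup>2"
  shows "model_metric \<psi> x *v w = ((1 - c) * (w \<bullet> \<Theta>)) *\<^sub>R \<Theta> + c *\<^sub>R w"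
proof -
  have T: "\<Theta> \<bullet> \<Theta> = 1" using x by (simp add: \<Theta>_def dot_square_norm power2_eq_square)
  have "y \<bullet> (model_metric \<psi> x *v w) = y \<bullet> (((1 - c) * (w \<bullet> \<Theta>)) *\<^sub>R \<Theta> + c *\<^sub>R w)" for y
    using riem_inner_model[OF x, of \<psi> y w]
    unfolding riem_inner_def \<Theta>_def[symmetric] c_def[symmetric]
    by (simp add: inner_add_right algebra_simps)
  then show ?thesis by (metis vector_eq_rdot inner_commute)
qed

text \<open>
An orthogonal map sending the radial unit vector to a coordinate axis conjugates the metric to a
diagonal matrix with one entry 1 and the other \<open>n - 1\<close> entries \<open>(\<psi>(r)/r)\<^sup>2\<close>.
\<close>

lemma det_model_metric:
  fixes x :: "real ^ 'n::finite"
  assumes x: "x \<noteq> 0"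
  shows "det (model_metric \<psi> x) = ((\<psi> (norm x) / norm x) ^ (CARD('n) - 1))\<^sup>2"
proof -
  define \<Theta> where "\<Theta> = (1 / norm x) *\<^sub>R x"
  define c where "c = (\<psi> (norm x) / norm x)\<^sup>2"
  define G where "G = model_metric \<psi> x"
  obtain k :: 'n where True by simp
  have norm_T: "norm \<Theta> = 1" using x by (simp add: \<Theta>_def)
  obtain f :: "real ^ 'n \<Rightarrow> real ^ 'n" where f: "orthogonal_transformation f" "f \<Theta> = axis k 1"
    using orthogonal_transformation_exists_1[OF norm_T norm_axis_1[of k]] by blast
  define A where "A = matrix f"
  have lin: "linear f" using f(1) orthogonal_transformation_def by blast
  have Av: "A *v w = f w" for w unfolding A_def using lin by (simp add: matrix_works)
  have "orthogonal_matrix A" using f(1) orthogonal_transformation_matrix unfolding A_def by blast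
  then have detA: "det A \<noteq> 0" using det_orthogonal_matrix by force
  define D :: "real ^ 'n ^ 'n" where "D = (\<chi> i j. if i = j then (if i = k then 1 else c) else 0)"
  have Dv: "D *v y = c *\<^sub>R y + ((1 - c) * y $ k) *\<^sub>R axis k 1" for y
  proof (rule vec_eq_iff[THEN iffD2], intro allI)
    fix i
    have "(D *v y) $ i = (\<Sum>j\<in>UNIV. if i = j then (if i = k then 1 else c) * y $ j else 0)"
      unfolding D_def matrix_vector_mult_def vec_lambda_beta by (intro sum.cong refl) simp
    also have "\<dots> = (if i = k then 1 else c) * y $ i" by simp
    also have "\<dots> = (c *\<^sub>R y + ((1 - c) * y $ k) *\<^sub>R axis k 1) $ i"
      by (simp add: axis_def left_diff_distrib)
    finally show "(D *v y) $ i = (c *\<^sub>R y + ((1 - c) * y $ k) *\<^sub>R axis k 1) $ i" .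
  qed
  have "A ** G = D ** A"
  proof (rule matrix_eq[THEN iffD2], intro allI)
    fix w
    have "(A *v w) $ k = w \<bullet> \<Theta>"
    proof -
      have "(A *v w) $ k = f w \<bullet> f \<Theta>" by (simp add: Av f(2) inner_axis)
      also have "\<dots> = w \<bullet> \<Theta>" using f(1) by (simp add: orthogonal_transformation_def)
      finally show ?thesis .
    qed
    then have "(D ** A) *v w = c *\<^sub>R f w + ((1 - c) * (w \<bullet> \<Theta>)) *\<^sub>R axis k 1"
      by (simp add: Dv Av flip: matrix_vector_mul_assoc)
    moreover have "(A ** G) *v w = ((1 - c) * (w \<bullet> \<Theta>)) *\<^sub>R f \<Theta> + c *\<^sub>R f w"
      unfolding matrix_vector_mul_assoc[symmetric] G_def model_metric_mult[OF x] \<Theta>_def[symmetric] c_def[symmetric] Av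
      by (simp add: linear_add[OF lin] linear_scale[OF lin])
    ultimately show "(A ** G) *v w = (D ** A) *v w" by (simp add: f(2))
  qed
  then have "det A * det G = det D * det A" by (metis det_mul)
  then have "det G = det D" using detA by (simp add: mult.commute)
  also have "det D = (\<Prod>i\<in>UNIV. D $ i $ i)" by (rule det_diagonal) (simp add: D_def)
  also have "\<dots> = (\<Prod>i\<in>UNIV. if i = k then 1 else c)" by (simp add: D_def)
  also have "\<dots> = (\<Prod>i\<in>UNIV - {k}. c)"
    by (subst prod.remove[of _ k]) (auto intro!: prod.cong)
  also have "\<dots> = c ^ (CARD('n) - 1)" by (simp add: card_Diff_singleton)
  finally show ?thesis unfolding G_def c_def by (simp add: power_mult[symmetric] mult.commute)
qed

lemma matrix_inv_mult_eq:
  fixes G :: "real ^ 'n ^ 'n"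
  assumes "det G \<noteq> 0" "G *v w = y"
  shows "matrix_inv G *v y = w"
proof -
  have "\<exists>H. G ** H = mat 1 \<and> H ** G = mat 1"
    using assms(1) by (simp add: invertible_det_nz[symmetric] invertible_def)
  then have "matrix_inv G ** G = mat 1"
    unfolding matrix_inv_def by (rule someI2_ex) simp
  then have "(matrix_inv G ** G) *v w = w" by simp
  then show ?thesis using assms(2) by (simp flip: matrix_vector_mul_assoc)
qed

section \<open>Calculus of radial functions on Euclidean space\<close>

lemma tendsto_norm_at_right_0:
  assumes "(f \<longlongrightarrow> L) (at_right 0)"
  shows "((\<lambda>x. f (norm x)) \<longlongrightarrow> L) (at (0::'a::real_normed_vector))"
proof (rule filterlim_compose[OF assms])
  show "filterlim norm (at_right 0) (at (0::'a))"
    unfolding filterlim_at by (auto simp: eventually_at intro!: tendsto_norm_zero exI[of _ 1])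
qed

lemma continuous_on_punctured:
  fixes g :: "'a::real_normed_vector \<Rightarrow> 'b::topological_space"
  assumes "continuous_on (- {0}) g" "(g \<longlongrightarrow> g 0) (at 0)"
  shows "continuous_on UNIV g"
proof -
  have "isCont g x" for x
  proof (cases "x = 0")
    case True
    then show ?thesis using assms(2) by (simp add: isCont_def)
  next
    case False
    then show ?thesis using assms(1) by (simp add: continuous_on_eq_continuous_at open_Compl)
  qed
  then show ?thesis by (simp add: continuous_on_eq_continuous_at)
qed

lemma continuous_on_radial:
  fixes f :: "real \<Rightarrow> real"
  assumes "continuous_on {0<..} f" "(f \<longlongrightarrow> f 0) (at_right 0)"
  shows "continuous_on UNIV (\<lambda>x::'a::real_normed_vector. f (norm x))"
proof (rule continuous_on_punctured)
  show "continuous_on (- {0}) (\<lambda>x::'a. f (norm x))"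
    by (rule continuous_on_compose2[OF assms(1)]) (auto intro!: continuous_intros)
qed (use tendsto_norm_at_right_0[OF assms(2)] in simp)

text \<open>
For fields built from the direction \<open>x / |x|\<close>, which has no limit at the origin, but whose size tends
to zero there.
\<close>

lemma continuous_on_radial_term:
  fixes f :: "real \<Rightarrow> real" and b :: "'a::real_normed_vector \<Rightarrow> real"
  assumes f: "continuous_on {0<..} f" and b: "continuous_on UNIV b"
    and b_le: "\<And>x. \<bar>b x\<bar> \<le> norm x ^ k" and lim: "((\<lambda>r. f r * r ^ k) \<longlongrightarrow> 0) (at_right 0)"
  shows "continuous_on UNIV (\<lambda>x. if x = 0 then 0 else f (norm x) * b x)"
proof (rule continuous_on_punctured)
  have "continuous_on (- {0}) (\<lambda>x. f (norm x) * b x)"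
    by (intro continuous_on_mult continuous_on_compose2[OF f] continuous_on_subset[OF b])
      (auto intro!: continuous_intros)
  then show "continuous_on (- {0}) (\<lambda>x. if x = 0 then 0 else f (norm x) * b x)"
    by (rule continuous_on_eq) auto
  have "((\<lambda>x. if x = 0 then 0 else f (norm x) * b x) \<longlongrightarrow> 0) (at 0)"
  proof (rule Lim_null_comparison)
    show "((\<lambda>x::'a. \<bar>f (norm x) * norm x ^ k\<bar>) \<longlongrightarrow> 0) (at 0)"
      using tendsto_norm_at_right_0[OF lim] by (rule tendsto_rabs_zero)
    show "\<forall>\<^sub>F x in at 0. norm (if x = 0 then 0 else f (norm x) * b x) \<le> \<bar>f (norm x) * norm x ^ k\<bar>"
      by (rule always_eventually) (auto simp: abs_mult intro!: mult_left_mono b_le)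
  qed
  then show "((\<lambda>x. if x = 0 then 0 else f (norm x) * b x) \<longlongrightarrow>
      (if (0::'a) = 0 then 0 else f (norm 0) * b 0)) (at 0)" by simp
qed

lemma has_derivative_radial:
  fixes x :: "'a::real_inner"
  assumes "x \<noteq> 0" "(f has_real_derivative f') (at (norm x))"
  shows "((\<lambda>x. f (norm x)) has_derivative (\<lambda>h. f' / norm x * (x \<bullet> h))) (at x)"
proof -
  have "(f has_derivative (\<lambda>t. f' * t)) (at (norm x))"
    using assms(2) by (simp add: has_field_derivative_def)
  from has_derivative_compose[OF has_derivative_norm[OF assms(1)] this]
  show ?thesis by (simp add: sgn_div_norm inner_commute divide_inverse mult_ac)
qed

lemma has_derivative_directional:
  fixes f :: "'a::real_normed_vector \<Rightarrow> real"
  assumes "(f has_derivative f') (at x)"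
  shows "((\<lambda>t. f (x + t *\<^sub>R e)) has_real_derivative f' e) (at 0)"
proof -
  have "((\<lambda>t. x + t *\<^sub>R e) has_derivative (\<lambda>t. t *\<^sub>R e)) (at 0)"
    by (auto intro!: derivative_eq_intros)
  from has_derivative_compose[OF this, of f f'] assms
  have "((\<lambda>t. f (x + t *\<^sub>R e)) has_derivative (\<lambda>t. f' (t *\<^sub>R e))) (at 0)" by simp
  then show ?thesis
    using has_derivative_linear[OF assms]
    by (simp add: has_field_derivative_def linear_scale mult.commute[of _ "f' e"])
qed

text \<open>
The derivative of \<open>x \<mapsto> q(|x|) x\<close> is \<open>q I + (q'/r) x x\<^sup>T\<close>, and the last term has entries of size at
most \<open>r |q'|\<close>. This explains the condition on \<open>r q'\<close> at the origin.
\<close>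

lemma radial_field_C1:
  fixes q :: "real \<Rightarrow> real"
  assumes q: "\<And>r. r > 0 \<Longrightarrow> (q has_real_derivative q' r) (at r)"
    and q': "continuous_on {0<..} q'"
    and q_0: "(q \<longlongrightarrow> q 0) (at_right 0)" and q'_0: "((\<lambda>r. r * q' r) \<longlongrightarrow> 0) (at_right 0)"
  shows "C1_field (\<lambda>x::real ^ 'n::finite. q (norm x) *\<^sub>R x)"
proof -
  define E where "E i j x = (if x = 0 then 0 else q' (norm x) / norm x * (x $ i * x $ j))"
    for i j and x :: "real ^ 'n"
  define D :: "real ^ 'n \<Rightarrow> real ^ 'n ^ 'n" where
    "D x = (\<chi> i j. (if i = j then q (norm x) else 0) + E i j x)" for x
  have q_cont: "continuous_on {0<..} q"
    using q by (intro continuous_at_imp_continuous_on ballI) (auto intro: DERIV_isCont)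
  have E_cont: "continuous_on UNIV (E i j)" for i j
    unfolding E_def
  proof (rule continuous_on_radial_term[where k = 2])
    show "continuous_on {0<..} (\<lambda>r. q' r / r)" using q' by (intro continuous_intros) auto
    show "continuous_on UNIV (\<lambda>x::real ^ 'n. x $ i * x $ j)" by (intro continuous_intros)
    show "\<bar>x $ i * x $ j\<bar> \<le> norm x ^ 2" for x :: "real ^ 'n"
      unfolding abs_mult power2_eq_square by (intro mult_mono component_le_norm_cart) auto
    show "((\<lambda>r. q' r / r * r ^ 2) \<longlongrightarrow> 0) (at_right 0)"
      by (rule Lim_transform_eventually[OF q'_0])
        (auto simp: eventually_at_filter power2_eq_square)
  qed
  have "continuous_on UNIV (\<lambda>x::real ^ 'n. if i = j then q (norm x) else 0)" for i j :: 'n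
    using continuous_on_radial[OF q_cont q_0, where 'a = "real ^ 'n"] by (cases "i = j") auto
  then have D_cont: "continuous_on UNIV D"
    unfolding D_def by (intro continuous_on_vec_lambda continuous_on_add E_cont)
  have Dv: "D x *v h = q (norm x) *\<^sub>R h +
      (if x = 0 then 0 else (q' (norm x) / norm x * (x \<bullet> h)) *\<^sub>R x)" for x h
  proof (rule vec_eq_iff[THEN iffD2], intro allI)
    fix i
    define c where "c = (if x = 0 then 0 else q' (norm x) / norm x)"
    have "(D x *v h) $ i = (\<Sum>j\<in>UNIV. (if i = j then q (norm x) * h $ j else 0) + c * x $ i * (x $ j * h $ j))"
      unfolding D_def matrix_vector_mult_def vec_lambda_beta
      by (intro sum.cong refl) (simp add: E_def c_def distrib_right)
    also have "\<dots> = q (norm x) * h $ i + c * x $ i * (x \<bullet> h)"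
      by (simp add: sum.distrib inner_vec_def flip: sum_distrib_left)
    finally show "(D x *v h) $ i = (q (norm x) *\<^sub>R h +
      (if x = 0 then 0 else (q' (norm x) / norm x * (x \<bullet> h)) *\<^sub>R x)) $ i"
      by (simp add: c_def)
  qed
  have "((\<lambda>x. q (norm x) *\<^sub>R x) has_derivative (\<lambda>h. D x *v h)) (at x)" for x
  proof (cases "x = 0")
    case False
    have "((\<lambda>x. q (norm x) *\<^sub>R x) has_derivative
        (\<lambda>h. q (norm x) *\<^sub>R h + (q' (norm x) / norm x * (x \<bullet> h)) *\<^sub>R x)) (at x)"
      using False by (intro has_derivative_scaleR has_derivative_radial q has_derivative_ident) auto
    then show ?thesis using False by (simp add: Dv)
  next
    case True
    have "((\<lambda>h::real^'n. norm (q (norm (0 + h)) *\<^sub>R (0 + h) - q (norm (0::real^'n)) *\<^sub>R 0 - q 0 *\<^sub>R h) / norm h) \<longlongrightarrow> 0) (at 0)"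
    proof (rule Lim_transform_eventually)
      have "((\<lambda>r. \<bar>q r - q 0\<bar>) \<longlongrightarrow> 0) (at_right 0)"
        using q_0 by (intro tendsto_rabs_zero) (simp add: LIM_zero)
      then show "((\<lambda>h::real^'n. \<bar>q (norm h) - q 0\<bar>) \<longlongrightarrow> 0) (at 0)"
        by (rule tendsto_norm_at_right_0)
      show "\<forall>\<^sub>F h in at 0. \<bar>q (norm h) - q 0\<bar> = norm (q (norm (0 + h)) *\<^sub>R (0 + h) - q (norm (0::real^'n)) *\<^sub>R 0 - q 0 *\<^sub>R h) / norm h"
        by (auto simp: eventually_at_filter simp flip: scaleR_left_diff_distrib)
    qed
    then have "((\<lambda>x::real^'n. q (norm x) *\<^sub>R x) has_derivative (\<lambda>h. q 0 *\<^sub>R h)) (at 0)"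
      by (simp add: has_derivative_at bounded_linear_scaleR_right)
    then show ?thesis using True by (simp add: Dv)
  qed
  then show ?thesis unfolding C1_field_def using D_cont by blast
qed

section \<open>The solution on the model manifold\<close>

locale radial_model =
  fixes \<psi> \<psi>' \<psi>'' :: "real \<Rightarrow> real" and N :: nat
  assumes N: "N \<ge> 2"
    and \<psi>_deriv: "\<And>r. r \<ge> 0 \<Longrightarrow> (\<psi> has_real_derivative \<psi>' r) (at r within {0..})"
    and \<psi>'_deriv: "\<And>r. r \<ge> 0 \<Longrightarrow> (\<psi>' has_real_derivative \<psi>'' r) (at r within {0..})"
    and \<psi>''_cont: "continuous_on {0..} \<psi>''"
    and \<psi>_pos: "\<And>r. r > 0 \<Longrightarrow> \<psi> r > 0"
    and \<psi>_0: "\<psi> 0 = 0" "\<psi>'' 0 = 0" "\<psi>' 0 = 1"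
    and \<psi>'_nonneg: "\<And>r. r > 0 \<Longrightarrow> \<psi>' r \<ge> 0"
begin

lemma within_at: "r > 0 \<Longrightarrow> at r within {0..} = at (r::real)"
  by (rule at_within_interior) simp

lemma \<psi>_der: "r > 0 \<Longrightarrow> (\<psi> has_real_derivative \<psi>' r) (at r)"
  and \<psi>'_der: "r > 0 \<Longrightarrow> (\<psi>' has_real_derivative \<psi>'' r) (at r)"
  using \<psi>_deriv[of r] \<psi>'_deriv[of r] within_at[of r] by auto

lemma \<psi>_cont: "continuous_on {0..} \<psi>" and \<psi>'_cont: "continuous_on {0..} \<psi>'"
  using \<psi>_deriv \<psi>'_deriv by (auto intro!: DERIV_continuous_on)

lemma right_limits:
  "(\<psi> \<longlongrightarrow> 0) (at_right 0)" "(\<psi>' \<longlongrightarrow> 1) (at_right 0)" "(\<psi>'' \<longlongrightarrow> 0) (at_right 0)"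
proof -
  note * = tendsto_right_of_continuous
  show "(\<psi> \<longlongrightarrow> 0) (at_right 0)" "(\<psi>' \<longlongrightarrow> 1) (at_right 0)" "(\<psi>'' \<longlongrightarrow> 0) (at_right 0)"
    using *[OF \<psi>_cont] *[OF \<psi>'_cont] *[OF \<psi>''_cont] \<psi>_0 by simp_all
qed

lemma \<psi>_ratio: "((\<lambda>r. \<psi> r / r) \<longlongrightarrow> 1) (at_right 0)"
proof -
  have "((\<lambda>r. (\<psi> r - \<psi> 0) / (r - 0)) \<longlongrightarrow> \<psi>' 0) (at 0 within {0..})"
    using \<psi>_deriv[of 0] by (simp add: has_field_derivative_iff)
  then have "((\<lambda>r. (\<psi> r - \<psi> 0) / (r - 0)) \<longlongrightarrow> \<psi>' 0) (at_right 0)"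
    by (rule tendsto_within_subset) auto
  then show ?thesis using \<psi>_0 by simp
qed

sublocale volume_density "\<lambda>r. \<psi> r ^ N" "\<lambda>r. real N * \<psi> r ^ (N - 1) * \<psi>' r" N
proof
  fix r :: real assume r: "r > 0"
  show "((\<lambda>r. \<psi> r ^ N) has_real_derivative real N * \<psi> r ^ (N - 1) * \<psi>' r) (at r)"
    using DERIV_power[OF \<psi>_der[OF r], of N] by (simp add: mult_ac)
  show "\<psi> r ^ N > 0" using \<psi>_pos[OF r] by simp
  show "real N * \<psi> r ^ (N - 1) * \<psi>' r \<ge> 0"
    using less_imp_le[OF \<psi>_pos[OF r]] \<psi>'_nonneg[OF r] by simp
next
  show "continuous_on {0..} (\<lambda>r. \<psi> r ^ N)" by (intro continuous_intros \<psi>_cont)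
  show "\<psi> 0 ^ N = 0" using N \<psi>_0 by simp
  have "((\<lambda>r. (\<psi> r / r) ^ N) \<longlongrightarrow> 1 ^ N) (at_right 0)" by (intro tendsto_intros \<psi>_ratio)
  then show "((\<lambda>r. \<psi> r ^ N / r ^ N) \<longlongrightarrow> 1) (at_right 0)" by (simp add: power_divide)
  have "((\<lambda>r. real N * \<psi>' r / (\<psi> r / r)) \<longlongrightarrow> real N * 1 / 1) (at_right 0)"
    by (intro tendsto_intros \<psi>_ratio right_limits) simp
  then have "((\<lambda>r. real N * \<psi>' r / (\<psi> r / r)) \<longlongrightarrow> real N) (at_right 0)" by simp
  then show "((\<lambda>r. r * (real N * \<psi> r ^ (N - 1) * \<psi>' r) / \<psi> r ^ N) \<longlongrightarrow> real N) (at_right 0)"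
  proof (rule Lim_transform_eventually)
    have "real N * \<psi>' r / (\<psi> r / r) = r * (real N * \<psi> r ^ (N - 1) * \<psi>' r) / \<psi> r ^ N" if "r > 0" for r
    proof -
      have "\<psi> r ^ N = \<psi> r * \<psi> r ^ (N - 1)" using N by (simp flip: power_Suc)
      then show ?thesis using \<psi>_pos[OF that] that by simp
    qed
    then show "\<forall>\<^sub>F r in at_right 0. real N * \<psi>' r / (\<psi> r / r) = r * (real N * \<psi> r ^ (N - 1) * \<psi>' r) / \<psi> r ^ N"
      by (auto simp: eventually_at_filter)
  qed
qed

text \<open>
The Riemannian volume density \<open>sqrt (det G)\<close> at distance \<open>r\<close> from the pole, relative to Lebesgue
measure, followed by its derivative.
\<close>

definition m :: "real \<Rightarrow> real" where
  "m r = (if r = 0 then 1 else (\<psi> r / r) ^ N)"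

definition m' :: "real \<Rightarrow> real" where
  "m' r = real N * (\<psi> r / r) ^ (N - 1) * ((r * \<psi>' r - \<psi> r) / r\<^sup>2)"

lemma m_pos: "r \<ge> 0 \<Longrightarrow> m r > 0"
  using \<psi>_pos[of r] by (cases "r = 0") (auto simp: m_def)

lemma m_power: "r \<ge> 0 \<Longrightarrow> m r * r ^ N = \<psi> r ^ N"
  using N \<psi>_0 by (simp add: m_def power_divide)

lemma m_deriv:
  assumes r: "r > 0"
  shows "(m has_real_derivative m' r) (at r)"
proof (rule has_field_derivative_transform_within_open[of _ _ _ "{0<..}"])
  have "((\<lambda>r. \<psi> r / r) has_real_derivative (r * \<psi>' r - \<psi> r) / r\<^sup>2) (at r)"
    using r by (auto intro!: derivative_eq_intros \<psi>_der simp: power2_eq_square mult_ac)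
  from DERIV_power[OF this, of N]
  show "((\<lambda>r. (\<psi> r / r) ^ N) has_real_derivative m' r) (at r)" by (simp add: m'_def mult_ac)
qed (use r in \<open>auto simp: m_def\<close>)

lemma m_lim: "(m \<longlongrightarrow> m 0) (at_right 0)"
proof -
  have "((\<lambda>r. (\<psi> r / r) ^ N) \<longlongrightarrow> 1 ^ N) (at_right 0)" by (intro tendsto_intros \<psi>_ratio)
  then have "((\<lambda>r. (\<psi> r / r) ^ N) \<longlongrightarrow> m 0) (at_right 0)" by (simp add: m_def)
  then show ?thesis
    by (rule Lim_transform_eventually) (auto simp: eventually_at_filter m_def)
qed

text \<open>
This is where \<open>\<psi>''(0) = 0\<close> enters: by l'Hospital's rule \<open>(r \<psi>' - \<psi>)/r\<^sup>2\<close> has the limit \<open>\<psi>''(0)/2\<close>.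
Hence the volume density is of class \<open>C\<^sup>1\<close> across the pole.
\<close>

lemma m'_lim: "(m' \<longlongrightarrow> 0) (at_right 0)"
proof -
  have "((\<lambda>r. (r * \<psi>' r - \<psi> r) / r\<^sup>2) \<longlongrightarrow> 0) (at_right 0)"
  proof (rule lhopital_right_0[where f' = "\<lambda>r. r * \<psi>'' r" and g' = "\<lambda>r. 2 * r"])
    have "((\<lambda>r. r * \<psi>' r - \<psi> r) \<longlongrightarrow> 0 * 1 - 0) (at_right 0)"
      by (intro tendsto_intros right_limits)
    then show "((\<lambda>r. r * \<psi>' r - \<psi> r) \<longlongrightarrow> 0) (at_right 0)" by simp
    have "((\<lambda>r::real. r\<^sup>2) \<longlongrightarrow> 0\<^sup>2) (at_right 0)" by (intro tendsto_intros)
    then show "((\<lambda>r::real. r\<^sup>2) \<longlongrightarrow> 0) (at_right 0)" by simp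
    show "\<forall>\<^sub>F r in at_right 0. r\<^sup>2 \<noteq> (0::real)" "\<forall>\<^sub>F r in at_right 0. 2 * r \<noteq> (0::real)"
      by (auto simp: eventually_at_filter)
    show "\<forall>\<^sub>F r in at_right 0. ((\<lambda>r. r * \<psi>' r - \<psi> r) has_real_derivative r * \<psi>'' r) (at r)"
      by (auto simp: eventually_at_filter intro!: always_eventually derivative_eq_intros \<psi>_der \<psi>'_der)
    show "\<forall>\<^sub>F r in at_right 0. ((\<lambda>r. r\<^sup>2) has_real_derivative 2 * r) (at r)"
      by (auto intro!: always_eventually derivative_eq_intros)
    have "((\<lambda>r. \<psi>'' r / 2) \<longlongrightarrow> 0 / 2) (at_right 0)" by (intro tendsto_intros right_limits) simp
    then have "((\<lambda>r. \<psi>'' r / 2) \<longlongrightarrow> 0) (at_right 0)" by simp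
    then show "((\<lambda>r. r * \<psi>'' r / (2 * r)) \<longlongrightarrow> 0) (at_right 0)"
      by (rule Lim_transform_eventually) (auto simp: eventually_at_filter)
  qed
  then have "(m' \<longlongrightarrow> real N * 1 ^ (N - 1) * 0) (at_right 0)"
    unfolding m'_def by (intro tendsto_intros \<psi>_ratio)
  then show ?thesis by simp
qed

lemma m_deriv_0: "((\<lambda>r. (m r - m 0) / r) \<longlongrightarrow> 0) (at_right 0)"
proof (rule lhopital_right_0[where f' = m' and g' = "\<lambda>_. 1"])
  show "((\<lambda>r. m r - m 0) \<longlongrightarrow> 0) (at_right 0)" using m_lim by (rule LIM_zero)
  show "\<forall>\<^sub>F r in at_right 0. ((\<lambda>r. m r - m 0) has_real_derivative m' r) (at r)"
  proof -
    have "((\<lambda>r. m r - m 0) has_real_derivative m' r) (at r)" if "r > 0" for r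
      using DERIV_diff[OF m_deriv[OF that] DERIV_const, of "m 0"] by simp
    then show ?thesis by (auto simp: eventually_at_filter)
  qed
qed (use m'_lim in \<open>auto simp: eventually_at_filter\<close>)

lemma m'_cont: "continuous_on {0<..} m'"
  unfolding m'_def
  by (intro continuous_intros continuous_on_subset[OF \<psi>_cont] continuous_on_subset[OF \<psi>'_cont]) auto

lemma m_cont: "continuous_on {0..} m"
proof -
  have "(m \<longlongrightarrow> m r) (at r within {0..})" if "r \<ge> 0" for r
  proof (cases "r = 0")
    case True
    have "at 0 within {0..} = (at_right 0 :: real filter)"
      unfolding at_within_def by (rule arg_cong[where f = "\<lambda>S. inf _ (principal S)"]) auto
    then show ?thesis using m_lim True by simp
  next
    case False
    then show ?thesis
      using DERIV_isCont[OF m_deriv[of r]] that by (simp add: isCont_def tendsto_within_subset[of _ _ _ UNIV])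
  qed
  then show ?thesis by (simp add: continuous_on_def)
qed

lemma sqrt_det:
  fixes x :: "real ^ 'n::finite"
  assumes "N = CARD('n) - 1"
  shows "sqrt (det (model_metric \<psi> x)) = m (norm x)"
proof (cases "x = 0")
  case True
  then show ?thesis by (simp add: model_metric_def m_def)
next
  case False
  then have "(\<psi> (norm x) / norm x) ^ N \<ge> 0" using \<psi>_pos[of "norm x"] by simp
  then show ?thesis
    unfolding det_model_metric[OF False] assms[symmetric] using False by (simp add: m_def)
qed

text \<open>
Radial vectors are eigenvectors of the metric with eigenvalue 1.
\<close>

lemma riem_inner_radial:
  fixes x w :: "real ^ 'n::finite"
  shows "riem_inner (model_metric \<psi>) x (c *\<^sub>R x) w = (c *\<^sub>R x) \<bullet> w"
proof (cases "x = 0")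
  case True
  then show ?thesis by (simp add: riem_inner_def)
next
  case False
  then have "((c *\<^sub>R x) \<bullet> ((1 / norm x) *\<^sub>R x)) * (w \<bullet> ((1 / norm x) *\<^sub>R x)) = (c *\<^sub>R x) \<bullet> w"
    by (simp add: dot_square_norm power2_eq_square inner_commute)
  then show ?thesis unfolding riem_inner_model[OF False] by simp
qed

lemma riem_grad_radial:
  fixes x :: "real ^ 'n::finite"
  assumes "N = CARD('n) - 1"
    and U: "(U has_derivative (\<lambda>h. (q (norm x) *\<^sub>R x) \<bullet> h)) (at x)"
  shows "riem_grad (model_metric \<psi>) U x = q (norm x) *\<^sub>R x"
proof -
  have "partial_deriv i U x = q (norm x) * x $ i" for i
    using DERIV_imp_deriv[OF has_derivative_directional[OF U, of "axis i 1"]]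
    by (simp add: partial_deriv_def inner_axis)
  then have grad: "(\<chi> i. partial_deriv i U x) = q (norm x) *\<^sub>R x" by (simp add: vec_eq_iff)
  show ?thesis
    unfolding riem_grad_def grad
  proof (rule matrix_inv_mult_eq)
    show "det (model_metric \<psi> x) \<noteq> 0"
      using sqrt_det[OF assms(1), of x] m_pos[of "norm x"] by auto
    show "model_metric \<psi> x *v (q (norm x) *\<^sub>R x) = q (norm x) *\<^sub>R x"
    proof (cases "x = 0")
      case False
      define \<Theta> where "\<Theta> = (1 / norm x) *\<^sub>R x"
      define c where "c = (\<psi> (norm x) / norm x)\<^sup>2"
      have xT: "x = norm x *\<^sub>R \<Theta>" "x \<bullet> \<Theta> = norm x"
        using False by (simp_all add: \<Theta>_def dot_square_norm power2_eq_square)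
      have "model_metric \<psi> x *v (q (norm x) *\<^sub>R x) = (1 - c) *\<^sub>R (q (norm x) *\<^sub>R (norm x *\<^sub>R \<Theta>)) + c *\<^sub>R (q (norm x) *\<^sub>R x)"
        unfolding model_metric_mult[OF False] \<Theta>_def[symmetric] c_def[symmetric] using xT(2) by simp
      also have "\<dots> = q (norm x) *\<^sub>R x"
        unfolding xT(1)[symmetric] by (simp add: algebra_simps)
      finally show ?thesis .
    qed simp
  qed
qed

text \<open>
In polar coordinates the factor \<open>r\<^sup>N\<close> combines with \<open>m(r)\<close> to \<open>\<psi>(r)\<^sup>N\<close>.
\<close>

lemma radial_square_integrable:
  assumes n: "N = CARD('n::finite) - 1" and g: "continuous_on {0..} g" and R: "R \<ge> 0"
    and bound: "\<And>x. x \<ge> R \<Longrightarrow> integral {R..x} (\<lambda>r. \<psi> r ^ N * (g r)\<^sup>2) \<le> C"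
  shows "integrable (riem_measure (model_metric \<psi>)) (\<lambda>x::real ^ 'n. (g (norm x))\<^sup>2)"
proof (rule integrableI_nonneg)
  define F where "F r = ennreal (m (max 0 r) * (g (max 0 r))\<^sup>2)" for r
  have norm_cont: "continuous_on UNIV (norm :: real ^ 'n \<Rightarrow> real)" by (intro continuous_intros)
  have "continuous_on UNIV (\<lambda>x::real ^ 'n. g (norm x))"
    by (rule continuous_on_compose2[OF g norm_cont]) auto
  then have g_meas: "(\<lambda>x::real ^ 'n. (g (norm x))\<^sup>2) \<in> borel_measurable borel"
    by (intro borel_measurable_continuous_onI continuous_intros)
  then show "(\<lambda>x::real ^ 'n. (g (norm x))\<^sup>2) \<in> borel_measurable (riem_measure (model_metric \<psi>))"
    by (simp add: riem_measure_def)
  have M_meas: "(\<lambda>x::real ^ 'n. ennreal (m (norm x))) \<in> borel_measurable borel"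
    by (intro measurable_compose[OF _ measurable_ennreal] borel_measurable_continuous_onI
        continuous_on_compose2[OF m_cont norm_cont]) auto
  have max_cont: "continuous_on UNIV (\<lambda>r::real. max 0 r)" by (intro continuous_intros)
  have F_meas: "F \<in> borel_measurable borel"
    unfolding F_def
    by (intro measurable_compose[OF _ measurable_ennreal] borel_measurable_continuous_onI continuous_on_mult
        continuous_on_power continuous_on_compose2[OF m_cont max_cont] continuous_on_compose2[OF g max_cont]) auto
  have "(\<integral>\<^sup>+x. ennreal ((g (norm (x::real ^ 'n)))\<^sup>2) \<partial>riem_measure (model_metric \<psi>))
      = (\<integral>\<^sup>+x. ennreal (m (norm (x::real ^ 'n))) * ennreal ((g (norm x))\<^sup>2) \<partial>lborel)"
    unfolding riem_measure_def sqrt_det[OF n]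
    using M_meas g_meas by (subst nn_integral_density) auto
  also have "\<dots> = (\<integral>\<^sup>+x. F (norm (x::real ^ 'n)) \<partial>lborel)"
    by (intro nn_integral_cong) (simp add: F_def ennreal_mult'')
  also have "\<dots> = ennreal (real DIM(real ^ 'n) * unit_ball_vol (real DIM(real ^ 'n))) *
      (\<integral>\<^sup>+r. F r * ennreal (r ^ (DIM(real ^ 'n) - 1)) * indicator {0..} r \<partial>lborel)"
    by (rule nn_integral_radial[OF F_meas])
  also have "(\<integral>\<^sup>+r. F r * ennreal (r ^ (DIM(real ^ 'n) - 1)) * indicator {0..} r \<partial>lborel)
      = (\<integral>\<^sup>+r. ennreal (\<psi> r ^ N * (g r)\<^sup>2) * indicator {0..} r \<partial>lborel)"
  proof (rule nn_integral_cong)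
    fix r :: real
    have dim: "DIM(real ^ 'n) - 1 = N" using n by simp
    have "F r * ennreal (r ^ N) = ennreal (\<psi> r ^ N * (g r)\<^sup>2)" if r: "r \<ge> 0"
    proof -
      have "F r * ennreal (r ^ N) = ennreal (m r * (g r)\<^sup>2 * r ^ N)"
        unfolding F_def using r by (simp add: ennreal_mult'')
      moreover have "m r * (g r)\<^sup>2 * r ^ N = \<psi> r ^ N * (g r)\<^sup>2"
        unfolding m_power[OF r, symmetric] by (simp add: mult_ac)
      ultimately show ?thesis by (simp only:)
    qed
    then show "F r * ennreal (r ^ (DIM(real ^ 'n) - 1)) * indicator {0..} r
        = ennreal (\<psi> r ^ N * (g r)\<^sup>2) * indicator {0..} r"
      unfolding dim by (cases "r \<ge> 0") (simp_all add: indicator_def)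
  qed
  also have "ennreal (real DIM(real ^ 'n) * unit_ball_vol (real DIM(real ^ 'n))) * \<dots> < \<infinity>"
  proof -
    have "(\<integral>\<^sup>+r. ennreal (\<psi> r ^ N * (g r)\<^sup>2) * indicator {0..} r \<partial>lborel) < \<infinity>"
      by (rule nn_integral_half_line_finite[OF _ _ R bound])
        (auto intro!: continuous_intros V_cont g mult_nonneg_nonneg V_nonneg)
    then show ?thesis by (simp add: ennreal_mult_less_top)
  qed
  finally show "(\<integral>\<^sup>+x. ennreal ((g (norm (x::real ^ 'n)))\<^sup>2) \<partial>riem_measure (model_metric \<psi>)) < \<infinity>" .
qed simp

context
  fixes p \<alpha> :: real and u v :: "real \<Rightarrow> real"
  assumes p: "p > 1" and \<alpha>: "\<alpha> > 0" and sol: "emden p \<alpha> u v" and pos: "\<And>r. r \<ge> 0 \<Longrightarrow> u r > 0"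
begin

private lemmas s = p \<alpha> sol

text \<open>
The gradient of \<open>x \<mapsto> u(|x|)\<close> is \<open>q(|x|) x\<close>. The value at 0 is the limit of \<open>v(r)/r\<close>; the function \<open>q'\<close>
below is the derivative of \<open>q\<close> with \<open>v'\<close> eliminated by the equation.
\<close>

definition q :: "real \<Rightarrow> real" where
  "q r = (if r = 0 then - (\<alpha> powr p / (real N + 1)) else v r / r)"

definition q' :: "real \<Rightarrow> real" where
  "q' r = ((- (real N * \<psi> r ^ (N - 1) * \<psi>' r / \<psi> r ^ N * v r) - u r powr p) - v r / r) / r"

lemma q_lim: "(q \<longlongrightarrow> q 0) (at_right 0)"
proof -
  have "((\<lambda>r. v r / r) \<longlongrightarrow> q 0) (at_right 0)"
    using slope_quotient_limit[OF s] by (simp add: q_def)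
  then show ?thesis
    by (rule Lim_transform_eventually) (auto simp: eventually_at_filter q_def)
qed

lemma v_der: "r > 0 \<Longrightarrow>
    (v has_real_derivative - (real N * \<psi> r ^ (N - 1) * \<psi>' r / \<psi> r ^ N * v r) - u r powr p) (at r)"
  using v_deriv[OF s, of r] pos[of r] by simp

lemma q_deriv:
  assumes r: "r > 0"
  shows "(q has_real_derivative q' r) (at r)"
proof (rule has_field_derivative_transform_within_open[of _ _ _ "{0<..}"])
  define w where "w = - (real N * \<psi> r ^ (N - 1) * \<psi>' r / \<psi> r ^ N * v r) - u r powr p"
  have "(v has_real_derivative w) (at r)" unfolding w_def by (rule v_der[OF r])
  then have "((\<lambda>r. v r / r) has_real_derivative (w * r - v r * 1) / (r * r)) (at r)"
    using r by (intro DERIV_divide DERIV_ident) auto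
  moreover have "(w * r - v r * 1) / (r * r) = q' r"
    unfolding q'_def w_def[symmetric] using r by (simp add: field_simps)
  ultimately show "((\<lambda>r. v r / r) has_real_derivative q' r) (at r)" by simp
qed (use r in \<open>auto simp: q_def\<close>)

lemma q'_cont: "continuous_on {0<..} q'"
proof -
  have c: "continuous_on {0<..} \<psi>" "continuous_on {0<..} \<psi>'" "continuous_on {0<..} v"
    by (rule continuous_on_subset[OF \<psi>_cont] continuous_on_subset[OF \<psi>'_cont] v_cont[OF s]; force)+
  have "continuous_on {0<..} (\<lambda>r. u r powr p)"
    using less_imp_neq[OF pos] by (intro continuous_on_powr u_cont[OF s] continuous_on_const) auto
  moreover have "continuous_on {0<..} (\<lambda>r. ((- (real N * \<psi> r ^ (N - 1) * \<psi>' r / \<psi> r ^ N * v r) - U r) - v r / r) / r)"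
    if "continuous_on {0<..} U" for U
    using that less_imp_neq[OF \<psi>_pos] by (intro continuous_intros c) auto
  ultimately show ?thesis unfolding q'_def by blast
qed

text \<open>
Since \<open>r q' = v' - v/r\<close> and \<open>v' = - h v - u\<^sup>p\<close>, the limit is \<open>- (N+1) q(0) - \<alpha>\<^sup>p\<close>, which vanishes by the
value of \<open>q(0)\<close>.
\<close>

lemma q'_lim: "((\<lambda>r. r * q' r) \<longlongrightarrow> 0) (at_right 0)"
proof -
  have u_lim: "(u \<longlongrightarrow> \<alpha>) (at_right 0)"
    using tendsto_right_of_continuous[OF u_cont[OF s order_refl]] u_0[OF s] by simp
  have "((\<lambda>r. - (r * (real N * \<psi> r ^ (N - 1) * \<psi>' r) / \<psi> r ^ N * q r) - u r powr p - q r)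
      \<longlongrightarrow> - (real N * q 0) - \<alpha> powr p - q 0) (at_right 0)"
    using \<alpha> by (intro tendsto_intros V'_asymp q_lim u_lim) auto
  moreover have "- (real N * q 0) - \<alpha> powr p - q 0 = 0"
  proof -
    have "(real N + 1) * q 0 = - (\<alpha> powr p)" by (simp add: q_def)
    then show ?thesis by (simp add: algebra_simps)
  qed
  ultimately have "((\<lambda>r. - (r * (real N * \<psi> r ^ (N - 1) * \<psi>' r) / \<psi> r ^ N * q r) - u r powr p - q r)
      \<longlongrightarrow> 0) (at_right 0)" by simp
  then show ?thesis
  proof (rule Lim_transform_eventually)
    have "- (r * (real N * \<psi> r ^ (N - 1) * \<psi>' r) / \<psi> r ^ N * q r) - u r powr p - q r = r * q' r"
      if r: "r > 0" for r
    proof -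
      define X where "X = real N * \<psi> r ^ (N - 1) * \<psi>' r"
      have "r * X / \<psi> r ^ N * (v r / r) = X / \<psi> r ^ N * v r" using r by simp
      moreover have "r * q' r = - (X / \<psi> r ^ N * v r) - u r powr p - v r / r"
        unfolding q'_def X_def[symmetric] using r by simp
      ultimately show ?thesis using r unfolding X_def[symmetric] by (simp add: q_def)
    qed
    then show "\<forall>\<^sub>F r in at_right 0. - (r * (real N * \<psi> r ^ (N - 1) * \<psi>' r) / \<psi> r ^ N * q r)
        - u r powr p - q r = r * q' r"
      unfolding eventually_at_filter by (intro always_eventually) simp
  qed
qed

lemma gradient_field_C1: "C1_field (\<lambda>x::real ^ 'n::finite. q (norm x) *\<^sub>R x)"
  by (rule radial_field_C1[OF q_deriv q'_cont q_lim q'_lim])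

lemma u_has_derivative:
  "((\<lambda>x::real ^ 'n::finite. u (norm x)) has_derivative (\<lambda>h. (q (norm x) *\<^sub>R x) \<bullet> h)) (at x)"
proof (cases "x = 0")
  case False
  then have "(u has_real_derivative v (norm x)) (at (norm x))" by (intro u_deriv[OF s]) simp
  from has_derivative_radial[OF False this] show ?thesis using False by (simp add: q_def)
next
  case True
  have "((\<lambda>h::real ^ 'n. norm (u (norm (0 + h)) - u (norm (0::real ^ 'n)) - 0) / norm h) \<longlongrightarrow> 0) (at 0)"
  proof (rule Lim_null_comparison)
    show "((\<lambda>h::real ^ 'n. \<alpha> powr p / 2 * norm h) \<longlongrightarrow> 0) (at 0)"
      by (intro tendsto_mult_right_zero tendsto_norm_zero tendsto_ident_at)
    show "\<forall>\<^sub>F h::real ^ 'n in at 0. norm (norm (u (norm (0 + h)) - u (norm (0::real ^ 'n)) - 0) / norm h)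
        \<le> \<alpha> powr p / 2 * norm h"
    proof (rule always_eventually, rule allI)
      fix h :: "real ^ 'n"
      have "\<bar>u (norm h) - \<alpha>\<bar> \<le> (\<alpha> powr p / 2 * norm h) * norm h"
        using u_lower[OF s, of "norm h"] u_le[OF s, of "norm h"] by (simp add: power2_eq_square)
      then show "norm (norm (u (norm (0 + h)) - u (norm (0::real ^ 'n)) - 0) / norm h) \<le> \<alpha> powr p / 2 * norm h"
        using u_0[OF s] by (cases "h = 0") (simp_all add: pos_divide_le_eq)
    qed
  qed
  then have "((\<lambda>x::real ^ 'n. u (norm x)) has_derivative (\<lambda>h. 0)) (at 0)"
    by (simp add: has_derivative_at)
  then show ?thesis using True by simp
qed

lemma u_C2: "C2_function (\<lambda>x::real ^ 'n::finite. u (norm x))"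
  unfolding C2_function_def
  by (intro exI[of _ "\<lambda>x. q (norm x) *\<^sub>R x"] conjI allI u_has_derivative gradient_field_C1)

text \<open>
Away from the pole the divergence of \<open>F(|x|) x\<close> is \<open>r F' + n F = (r\<^sup>n F)' / r\<^sup>n\<^sup>-\<^sup>1\<close>, and here
\<open>r\<^sup>n F = V u'\<close>. At the pole the divergence is \<open>n F(0)\<close> by continuity of \<open>F\<close>, and
\<open>n q(0) = - \<alpha>\<^sup>p\<close>.
\<close>

lemma laplacian:
  fixes x :: "real ^ 'n::finite"
  assumes n: "N = CARD('n) - 1"
  shows "laplace_beltrami (model_metric \<psi>) (\<lambda>x. u (norm x)) x = - (u (norm x) powr p)"
proof -
  define F where "F r = m r * q r" for r
  have card: "real CARD('n) = real N + 1" using n N by simp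
  have grad: "riem_grad (model_metric \<psi>) (\<lambda>x::real ^ 'n. u (norm x)) = (\<lambda>x. q (norm x) *\<^sub>R x)"
    by (rule ext, rule riem_grad_radial[where q = q, OF n]) (rule u_has_derivative)
  have div: "laplace_beltrami (model_metric \<psi>) (\<lambda>x. u (norm x)) x
      = (\<Sum>i\<in>UNIV. partial_deriv i (\<lambda>y. F (norm y) * y $ i) x) / m (norm x)"
    unfolding laplace_beltrami_def riem_div_def grad sqrt_det[OF n] by (simp add: F_def mult.assoc)
  have F_lim: "(F \<longlongrightarrow> F 0) (at_right 0)"
    unfolding F_def by (intro tendsto_intros m_lim q_lim)
  have "(\<Sum>i\<in>UNIV. partial_deriv i (\<lambda>y. F (norm y) * y $ i) x) = - m (norm x) * u (norm x) powr p"
  proof (cases "x = 0")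
    case True
    have "partial_deriv i (\<lambda>y. F (norm y) * y $ i) (0 :: real ^ 'n) = F 0" for i
      unfolding partial_deriv_def
    proof (rule DERIV_imp_deriv)
      have "((\<lambda>t::real. F (norm t)) \<longlongrightarrow> F 0) (at 0)" by (rule tendsto_norm_at_right_0[OF F_lim])
      then have "((\<lambda>t. (F \<bar>t\<bar> * t - 0) / t) \<longlongrightarrow> F 0) (at 0)"
        by (rule Lim_transform_eventually) (auto simp: eventually_at_filter)
      then have "((\<lambda>t. F \<bar>t\<bar> * t) has_real_derivative F 0) (at 0)"
        unfolding DERIV_def by (simp only: add_0_left mult_zero_right)
      then show "((\<lambda>t. F (norm (0 + t *\<^sub>R axis i 1 :: real ^ 'n)) * (0 + t *\<^sub>R axis i 1 :: real ^ 'n) $ i)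
          has_real_derivative F 0) (at 0)" by simp
    qed
    then show ?thesis using True card u_0[OF s] by (simp add: F_def m_def q_def)
  next
    case False
    define r where "r = norm x"
    have r: "r > 0" using False by (simp add: r_def)
    define F' where "F' = (- (\<psi> r ^ N) * u r powr p * r ^ (N + 1) - (\<psi> r ^ N * v r) * (real (N + 1) * r ^ N)) / (r ^ (N + 1) * r ^ (N + 1))"
    have F_eq: "F t = \<psi> t ^ N * v t / t ^ (N + 1)" if "t > 0" for t
      using that by (simp add: F_def m_def q_def power_divide)
    have F_der: "(F has_real_derivative F') (at r)"
    proof (rule has_field_derivative_transform_within_open[of _ _ _ "{0<..}"])
      have "((\<lambda>t. \<psi> t ^ N * v t) has_real_derivative - (\<psi> r ^ N) * u r powr p) (at r)"
        using flux_deriv[OF s r] pos[of r] r by simp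
      moreover have "((\<lambda>t. t ^ (N + 1)) has_real_derivative real (N + 1) * r ^ N) (at r)"
        using DERIV_pow[of "N + 1" r] by simp
      ultimately show "((\<lambda>t. \<psi> t ^ N * v t / t ^ (N + 1)) has_real_derivative F') (at r)"
        unfolding F'_def using r by (intro DERIV_divide) auto
    qed (use r F_eq in auto)
    have alg: "(- A * P * (r * B) - A * w * (k * B)) / ((r * B) * (r * B)) / r * r\<^sup>2 + k * (A * w / (r * B))
        = - (A / B) * P" if "B > 0" for A P B w k
      using that r by (simp add: field_simps power2_eq_square)
    have part: "partial_deriv i (\<lambda>y. F (norm y) * y $ i) x = F' / r * (x $ i)\<^sup>2 + F r" for i
    proof -
      have "((\<lambda>y. F (norm y) * y $ i) has_derivative (\<lambda>h. F (norm x) * h $ i + F' / norm x * (x \<bullet> h) * x $ i)) (at x)"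
        using F_der[unfolded r_def]
        by (intro has_derivative_mult has_derivative_radial False bounded_linear.has_derivative[OF bounded_linear_vec_nth] has_derivative_ident)
      from has_derivative_directional[OF this, of "axis i 1"]
      show ?thesis
        unfolding partial_deriv_def
        by (intro DERIV_imp_deriv) (simp add: r_def inner_axis power2_eq_square algebra_simps)
    qed
    have "(\<Sum>i\<in>UNIV. partial_deriv i (\<lambda>y. F (norm y) * y $ i) x) = F' / r * (\<Sum>i\<in>UNIV. (x $ i)\<^sup>2) + (real N + 1) * F r"
      unfolding part by (simp add: sum.distrib card sum_distrib_left sum_divide_distrib)
    also have "(\<Sum>i\<in>UNIV. (x $ i)\<^sup>2) = r\<^sup>2"
      unfolding r_def power2_norm_eq_inner by (simp add: inner_vec_def power2_eq_square)
    also have "F' / r * r\<^sup>2 + (real N + 1) * F r = - (\<psi> r ^ N / r ^ N) * u r powr p"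
      using alg[of "r ^ N" "\<psi> r ^ N" "u r powr p" "v r" "real N + 1"] r
      unfolding F_eq[OF r] F'_def by (simp add: add.commute)
    also have "\<psi> r ^ N / r ^ N = m r" using r by (simp add: m_def power_divide)
    finally show ?thesis by (simp add: r_def)
  qed
  then show ?thesis using div m_pos[of "norm x"] by simp
qed

text \<open>
Summed over \<open>i\<close>, the partial derivatives of the compactly supported functions \<open>u m \<Phi>\<^sub>i\<close> are
\<open>m (\<nabla>u \<bullet> \<Phi>) + u m div \<Phi>\<close>, and their integrals vanish. They are continuous also at the pole because the
volume density is of class \<open>C\<^sup>1\<close> there.
\<close>

lemma weak_gradient:
  assumes n: "N = CARD('n::finite) - 1"
  shows "weak_riem_grad (model_metric \<psi>) (\<lambda>x::real ^ 'n. u (norm x)) (\<lambda>x. q (norm x) *\<^sub>R x)"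
  unfolding weak_riem_grad_def
proof (intro allI impI)
  fix \<Phi> :: "real ^ 'n \<Rightarrow> real ^ 'n"
  assume "test_field \<Phi>"
  then obtain D where D: "\<And>x. (\<Phi> has_derivative (\<lambda>h. D x *v h)) (at x)" "continuous_on UNIV D"
    and K: "compact (closure {x. \<Phi> x \<noteq> 0})"
    unfolding test_field_def C1_field_def by auto
  define K where "K = closure {x. \<Phi> x \<noteq> 0}"
  have \<Phi>0: "\<Phi> x = 0" if "x \<notin> K" for x
    using that closure_subset[of "{x. \<Phi> x \<noteq> 0}"] unfolding K_def by auto
  have \<Phi>_cont: "continuous_on UNIV \<Phi>"
    using D(1) has_derivative_continuous by (blast intro: continuous_at_imp_continuous_on)
  define U where "U x = u (norm x)" for x :: "real ^ 'n"
  define M where "M x = m (norm x)" for x :: "real ^ 'n"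
  define \<mu> where "\<mu> i x = (if x = 0 then 0 else m' (norm x) / norm x * x $ i)" for i and x :: "real ^ 'n"
  have norm_cont: "continuous_on UNIV (norm :: real ^ 'n \<Rightarrow> real)" by (intro continuous_intros)
  have U_cont: "continuous_on UNIV U"
    unfolding U_def by (rule continuous_on_compose2[OF u_cont[OF s order_refl] norm_cont]) auto
  have M_cont: "continuous_on UNIV M"
    unfolding M_def by (rule continuous_on_compose2[OF m_cont norm_cont]) auto
  have \<mu>_cont: "continuous_on UNIV (\<mu> i)" for i
    unfolding \<mu>_def
  proof (rule continuous_on_radial_term[where k = 1])
    show "continuous_on {0<..} (\<lambda>r. m' r / r)" by (intro continuous_intros m'_cont) auto
    show "((\<lambda>r. m' r / r * r ^ 1) \<longlongrightarrow> 0) (at_right 0)"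
      by (rule Lim_transform_eventually[OF m'_lim]) (auto simp: eventually_at_filter)
  qed (auto intro!: continuous_intros component_le_norm_cart)
  have X_cont: "continuous_on UNIV (\<lambda>x::real ^ 'n. q (norm x) *\<^sub>R x)"
    using gradient_field_C1 unfolding C1_field_def
    by (auto intro!: continuous_at_imp_continuous_on dest: has_derivative_continuous)
  have M_der: "((\<lambda>t. M (x + t *\<^sub>R axis i 1)) has_real_derivative \<mu> i x) (at 0)" for x i
  proof (cases "x = 0")
    case False
    have "(M has_derivative (\<lambda>h. m' (norm x) / norm x * (x \<bullet> h))) (at x)"
      unfolding M_def using False by (intro has_derivative_radial m_deriv) auto
    from has_derivative_directional[OF this, of "axis i 1"] show ?thesis
      using False by (simp add: \<mu>_def inner_axis)
  next
    case True
    have "((\<lambda>t. \<bar>(m (norm t) - m 0) / norm t\<bar>) \<longlongrightarrow> 0) (at (0::real))"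
      by (rule tendsto_rabs_zero[OF tendsto_norm_at_right_0[OF m_deriv_0]])
    then have "((\<lambda>t. (m \<bar>t\<bar> - m 0) / t) \<longlongrightarrow> 0) (at 0)"
      by (rule Lim_null_comparison[rotated]) (auto intro!: always_eventually)
    then show ?thesis using True by (simp add: DERIV_def M_def \<mu>_def)
  qed
  have U_der: "((\<lambda>t. U (x + t *\<^sub>R axis i 1)) has_real_derivative q (norm x) * x $ i) (at 0)" for x i
    using has_derivative_directional[OF u_has_derivative[of x], of "axis i 1"]
    by (simp add: U_def inner_axis)
  have \<Phi>_der: "((\<lambda>t. \<Phi> (x + t *\<^sub>R axis i 1) $ i) has_real_derivative D x $ i $ i) (at 0)" for x i
  proof -
    have "((\<lambda>y. \<Phi> y $ i) has_derivative (\<lambda>h. (D x *v h) $ i)) (at x)"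
      by (rule bounded_linear.has_derivative[OF bounded_linear_vec_nth D(1)])
    from has_derivative_directional[OF this, of "axis i 1"] show ?thesis
      by (simp add: matrix_vector_mult_basis column_def)
  qed
  define d where "d i x = \<mu> i x * \<Phi> x $ i + D x $ i $ i * M x" for i x
  have M\<Phi>_der: "((\<lambda>t. M (x + t *\<^sub>R axis i 1) * \<Phi> (x + t *\<^sub>R axis i 1) $ i) has_real_derivative d i x) (at 0)" for x i
    using DERIV_mult[OF M_der[where x = x and i = i] \<Phi>_der[where x = x and i = i]] by (simp add: d_def)
  have div: "M x * riem_div (model_metric \<psi>) \<Phi> x = (\<Sum>i\<in>UNIV. d i x)" for x
  proof -
    have "partial_deriv i (\<lambda>y. M y * \<Phi> y $ i) x = d i x" for i
      unfolding partial_deriv_def by (rule DERIV_imp_deriv[OF M\<Phi>_der])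
    then show ?thesis
      unfolding riem_div_def sqrt_det[OF n] M_def using m_pos[of "norm x"] by simp
  qed
  define g where "g i x = (q (norm x) * x $ i) * (M x * \<Phi> x $ i) + d i x * U x" for i x
  have D_cont: "continuous_on UNIV (\<lambda>x. D x $ i $ i)" for i
    by (intro continuous_intros D(2))
  have d_cont: "continuous_on UNIV (d i)" for i
    unfolding d_def by (intro continuous_intros \<mu>_cont \<Phi>_cont D_cont M_cont)
  have g: "integrable lborel (g i)" "(LINT x|lborel. g i x) = 0" for i
  proof -
    have "continuous_on UNIV (\<lambda>x::real ^ 'n. (q (norm x) *\<^sub>R x) $ i)"
      by (intro continuous_intros X_cont)
    then have Xi: "continuous_on UNIV (\<lambda>x::real ^ 'n. q (norm x) * x $ i)" by simp
    have "continuous_on UNIV (g i)"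
      unfolding g_def
      by (rule continuous_on_add[OF continuous_on_mult[OF Xi]])
        (intro continuous_intros d_cont U_cont M_cont \<Phi>_cont)+
    moreover have "continuous_on UNIV (\<lambda>x. U x * (M x * \<Phi> x $ i))"
      by (intro continuous_intros U_cont M_cont \<Phi>_cont)
    moreover have "((\<lambda>t. U (x + t *\<^sub>R axis i 1) * (M (x + t *\<^sub>R axis i 1) * \<Phi> (x + t *\<^sub>R axis i 1) $ i)) has_real_derivative g i x) (at 0)" for x
      using DERIV_mult[OF U_der[where x = x and i = i] M\<Phi>_der[where x = x and i = i]] by (simp add: g_def)
    ultimately show "integrable lborel (g i)" "(LINT x|lborel. g i x) = 0"
      using integral_directional_derivative_zero[OF K[folded K_def], of "\<lambda>x. U x * (M x * \<Phi> x $ i)" "g i" "axis i 1"] \<Phi>0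
      by auto
  qed
  have inner: "riem_inner (model_metric \<psi>) x (q (norm x) *\<^sub>R x) (\<Phi> x) = (q (norm x) *\<^sub>R x) \<bullet> \<Phi> x" for x
    by (rule riem_inner_radial)
  define a where "a x = M x * ((q (norm x) *\<^sub>R x) \<bullet> \<Phi> x)" for x
  have a_cont: "continuous_on UNIV a" unfolding a_def by (intro continuous_intros X_cont M_cont \<Phi>_cont)
  have a_int: "integrable lborel a"
    by (rule integrable_compact_support[OF K[folded K_def] a_cont]) (simp add: a_def \<Phi>0)
  have sum_eq: "(\<Sum>i\<in>UNIV. g i x) = a x + U x * (\<Sum>i\<in>UNIV. d i x)" for x
    unfolding g_def a_def by (simp add: sum.distrib inner_vec_def sum_distrib_left mult_ac)
  have M_meas: "M \<in> borel_measurable lborel" using M_cont by (simp add: borel_measurable_continuous_onI)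
  have meas: "riem_measure (model_metric \<psi>) = density lborel (\<lambda>x. ennreal (M x))"
    unfolding riem_measure_def sqrt_det[OF n] M_def ..
  have M_nonneg: "AE x in lborel. 0 \<le> M x" by (rule AE_I2) (simp add: M_def less_imp_le m_pos)
  have div_meas: "riem_div (model_metric \<psi>) \<Phi> \<in> borel_measurable lborel"
  proof -
    have "riem_div (model_metric \<psi>) \<Phi> = (\<lambda>x. (\<Sum>i\<in>UNIV. d i x) / M x)"
    proof
      fix x
      have "M x \<noteq> 0" using m_pos[of "norm x"] by (simp add: M_def)
      then show "riem_div (model_metric \<psi>) \<Phi> x = (\<Sum>i\<in>UNIV. d i x) / M x"
        unfolding div[symmetric] by simp
    qed
    moreover have "continuous_on UNIV (\<lambda>x. (\<Sum>i\<in>UNIV. d i x) / M x)"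
    proof (intro continuous_intros d_cont M_cont)
      show "\<forall>x\<in>UNIV. M x \<noteq> 0" using m_pos[OF norm_ge_zero] by (auto simp: M_def less_le)
    qed
    ultimately show ?thesis by (simp add: borel_measurable_continuous_onI)
  qed
  have "(LINT x|riem_measure (model_metric \<psi>). riem_inner (model_metric \<psi>) x (q (norm x) *\<^sub>R x) (\<Phi> x)) = (LINT x|lborel. a x)"
  proof -
    have "(\<lambda>x. (q (norm x) *\<^sub>R x) \<bullet> \<Phi> x) \<in> borel_measurable lborel"
      using borel_measurable_continuous_onI[OF continuous_on_inner[OF X_cont \<Phi>_cont]] by simp
    from integral_density[OF this M_meas M_nonneg] show ?thesis
      unfolding meas inner a_def real_scaleR_def .
  qed
  moreover have "(LINT x|riem_measure (model_metric \<psi>). u (norm x) * riem_div (model_metric \<psi>) \<Phi> x) = (LINT x|lborel. U x * (\<Sum>i\<in>UNIV. d i x))"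
  proof -
    have "(\<lambda>x. U x * riem_div (model_metric \<psi>) \<Phi> x) \<in> borel_measurable lborel"
      using U_cont div_meas by (intro borel_measurable_times) (auto intro: borel_measurable_continuous_onI)
    then have "(LINT x|riem_measure (model_metric \<psi>). U x * riem_div (model_metric \<psi>) \<Phi> x)
        = (LINT x|lborel. M x *\<^sub>R (U x * riem_div (model_metric \<psi>) \<Phi> x))"
      unfolding meas by (rule integral_density[OF _ M_meas M_nonneg])
    moreover have "M x *\<^sub>R (U x * riem_div (model_metric \<psi>) \<Phi> x) = U x * (\<Sum>i\<in>UNIV. d i x)" for x
      unfolding div[symmetric] by (simp add: mult_ac)
    ultimately show ?thesis unfolding U_def[symmetric] by (simp only:)
  qed
  moreover have "(LINT x|lborel. U x * (\<Sum>i\<in>UNIV. d i x)) = (LINT x|lborel. (\<Sum>i\<in>UNIV. g i x) - a x)"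
    by (simp add: sum_eq)
  moreover have "\<dots> = (\<Sum>i\<in>UNIV. LINT x|lborel. g i x) - (LINT x|lborel. a x)"
    using g(1) a_int by (simp add: Bochner_Integration.integral_diff Bochner_Integration.integral_sum)
  ultimately show "(LINT x|riem_measure (model_metric \<psi>). riem_inner (model_metric \<psi>) x (q (norm x) *\<^sub>R x) (\<Phi> x))
      = - (LINT x|riem_measure (model_metric \<psi>). u (norm x) * riem_div (model_metric \<psi>) \<Phi> x)"
    using g(2) by simp
qed

lemma ground_state_H1:
  assumes n: "N = CARD('n::finite) - 1" and R: "R > 0" and \<kappa>: "\<kappa> > 0"
    and steep: "\<And>r. r \<ge> R \<Longrightarrow> \<kappa> * u r \<le> - v r"
    and small: "\<And>r. r \<ge> R \<Longrightarrow> u r powr (p - 1) \<le> \<kappa>\<^sup>2 / 2"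
  shows "(\<lambda>x::real ^ 'n. u (norm x)) \<in> H1 (model_metric \<psi>)"
proof -
  define C where "C = - 2 * (u R * (\<psi> R ^ N * v R))"
  have energy: "integral {R..x} (\<lambda>r. \<psi> r ^ N * (v r)\<^sup>2) \<le> C" if "x \<ge> R" for x
    unfolding C_def by (rule fast_decay_energy[OF s _ R \<kappa> _ _ that]) (use pos steep small in auto)
  have cont: "continuous_on {R..x} (\<lambda>r. \<psi> r ^ N * (f r)\<^sup>2)" if "continuous_on {0..} f" for f x
    using R by (intro continuous_intros continuous_on_subset[OF that] continuous_on_subset[OF V_cont]) auto
  have u_bound: "integral {R..x} (\<lambda>r. \<psi> r ^ N * (u r)\<^sup>2) \<le> C / \<kappa>\<^sup>2" if x: "x \<ge> R" for x
  proof -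
    have "integral {R..x} (\<lambda>r. \<psi> r ^ N * (u r)\<^sup>2) \<le> integral {R..x} (\<lambda>r. \<psi> r ^ N * (v r)\<^sup>2 / \<kappa>\<^sup>2)"
    proof (rule integral_le)
      show "(\<lambda>r. \<psi> r ^ N * (u r)\<^sup>2) integrable_on {R..x}"
        by (intro integrable_continuous_real cont u_cont[OF s order_refl])
      show "(\<lambda>r. \<psi> r ^ N * (v r)\<^sup>2 / \<kappa>\<^sup>2) integrable_on {R..x}"
        using \<kappa> by (intro integrable_continuous_real continuous_on_divide cont v_cont[OF s order_refl] continuous_on_const) auto
      fix r assume r: "r \<in> {R..x}"
      have "(\<kappa> * u r)\<^sup>2 \<le> (- v r)\<^sup>2"
        using steep[of r] pos[of r] r R \<kappa> by (intro power_mono) auto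
      then have "(u r)\<^sup>2 \<le> (v r)\<^sup>2 / \<kappa>\<^sup>2"
        using \<kappa> by (simp add: pos_le_divide_eq power_mult_distrib mult.commute)
      then show "\<psi> r ^ N * (u r)\<^sup>2 \<le> \<psi> r ^ N * (v r)\<^sup>2 / \<kappa>\<^sup>2"
        using mult_left_mono[OF _ V_nonneg[of r]] r R by fastforce
    qed
    also have "\<dots> \<le> C / \<kappa>\<^sup>2" using energy[OF x] by (simp add: divide_right_mono)
    finally show ?thesis .
  qed
  have "L2_function (model_metric \<psi>) (\<lambda>x::real ^ 'n. u (norm x))"
    unfolding L2_function_def
  proof
    show "(\<lambda>x::real ^ 'n. u (norm x)) \<in> borel_measurable borel"
      by (intro borel_measurable_continuous_onI continuous_on_compose2[OF u_cont[OF s order_refl]] continuous_intros) auto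
    show "integrable (riem_measure (model_metric \<psi>)) (\<lambda>x::real ^ 'n. (u (norm x))\<^sup>2)"
      by (rule radial_square_integrable[OF n u_cont[OF s order_refl] less_imp_le[OF R] u_bound])
  qed
  moreover have "L2_field (model_metric \<psi>) (\<lambda>x::real ^ 'n. q (norm x) *\<^sub>R x)"
    unfolding L2_field_def
  proof
    show "(\<lambda>x::real ^ 'n. q (norm x) *\<^sub>R x) \<in> borel_measurable borel"
      using gradient_field_C1 unfolding C1_field_def
      by (auto intro!: borel_measurable_continuous_onI continuous_at_imp_continuous_on dest: has_derivative_continuous)
    have "riem_inner (model_metric \<psi>) x (q (norm x) *\<^sub>R x) (q (norm x) *\<^sub>R x) = (v (norm x))\<^sup>2" for x :: "real ^ 'n"
    proof -
      have "q (norm x) * norm x = v (norm x)" using v_0[OF s] by (simp add: q_def)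
      moreover have "riem_inner (model_metric \<psi>) x (q (norm x) *\<^sub>R x) (q (norm x) *\<^sub>R x) = (q (norm x) * norm x)\<^sup>2"
        unfolding riem_inner_radial by (simp add: dot_square_norm power_mult_distrib power2_eq_square)
      ultimately show ?thesis by simp
    qed
    then show "integrable (riem_measure (model_metric \<psi>))
        (\<lambda>x::real ^ 'n. riem_inner (model_metric \<psi>) x (q (norm x) *\<^sub>R x) (q (norm x) *\<^sub>R x))"
      using radial_square_integrable[OF n v_cont[OF s order_refl] less_imp_le[OF R] energy] by simp
  qed
  ultimately show ?thesis
    unfolding H1_def using weak_gradient[OF n] by blast
qed

end

end

theorem theorem2p2:
  fixes \<psi> \<psi>' \<psi>'' :: "real \<Rightarrow> real" and p :: real
  assumes n: "CARD('n::finite) \<ge> 3"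
    and p: "1 < p" "p < (real CARD('n) + 2) / (real CARD('n) - 2)"
    and \<psi>_deriv: "\<And>r. r \<ge> 0 \<Longrightarrow> (\<psi> has_real_derivative \<psi>' r) (at r within {0..})"
    and \<psi>'_deriv: "\<And>r. r \<ge> 0 \<Longrightarrow> (\<psi>' has_real_derivative \<psi>'' r) (at r within {0..})"
    and \<psi>''_cont: "continuous_on {0..} \<psi>''"
    and \<psi>_pos: "\<And>r. r > 0 \<Longrightarrow> \<psi> r > 0"
    and \<psi>_0: "\<psi> 0 = 0" "\<psi>'' 0 = 0" "\<psi>' 0 = 1"
    and \<psi>'_nonneg: "\<And>r. r > 0 \<Longrightarrow> \<psi>' r \<ge> 0"
    and liminf_pos: "Liminf at_top (\<lambda>r. ereal (\<psi>' r / \<psi> r)) > 0"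
  shows "\<exists>u :: real ^ 'n \<Rightarrow> real.
           C2_function u \<and> radial u \<and> (\<forall>x. u x > 0) \<and> u \<in> H1 (model_metric \<psi>) \<and>
           (\<forall>x. - laplace_beltrami (model_metric \<psi>) u x = \<bar>u x\<bar> powr (p - 1) * u x)"
proof -
  define N where "N = CARD('n) - 1"
  have dim: "N \<ge> 2" "real N = real CARD('n) - 1" using n by (auto simp: N_def)
  interpret radial_model \<psi> \<psi>' \<psi>'' N
    by unfold_locales (use dim \<psi>_deriv \<psi>'_deriv \<psi>''_cont \<psi>_pos \<psi>_0 \<psi>'_nonneg in auto)
  obtain c where c: "c > 0" "\<forall>\<^sub>F r in at_top. ereal c < ereal (\<psi>' r / \<psi> r)"
  proof -
    obtain y where y: "0 < y" "y < Liminf at_top (\<lambda>r. ereal (\<psi>' r / \<psi> r))"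
      using dense[OF liminf_pos] by blast
    then obtain c where c: "y = ereal c" by (cases y) auto
    show ?thesis using that[of c] y less_LiminfD[OF y(2)] c by simp
  qed
  then obtain R1 where R1: "\<And>r. r \<ge> R1 \<Longrightarrow> c < \<psi>' r / \<psi> r"
    unfolding eventually_at_top_linorder by auto
  define R0 where "R0 = max R1 1"
  have h: "real N * \<psi> r ^ (N - 1) * \<psi>' r / \<psi> r ^ N \<ge> 2 * c" if r: "r \<ge> R0" for r
  proof -
    have pos: "\<psi> r > 0" using r by (intro \<psi>_pos) (simp add: R0_def)
    have "\<psi> r ^ N = \<psi> r * \<psi> r ^ (N - 1)" using dim by (simp flip: power_Suc)
    then have "real N * \<psi> r ^ (N - 1) * \<psi>' r / \<psi> r ^ N = real N * (\<psi>' r / \<psi> r)"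
      using pos by simp
    also have "\<dots> \<ge> 2 * c"
      using R1[of r] r dim(1) c(1) by (intro mult_mono) (auto simp: R0_def)
    finally show ?thesis .
  qed
  have sub: "p < (real N + 3) / (real N - 1)"
  proof -
    have "real N + 3 = real CARD('n) + 2" "real N - 1 = real CARD('n) - 2" using dim(2) by linarith+
    then show ?thesis using p(2) by (simp only:)
  qed
  have R0: "R0 > 0" by (simp add: R0_def)
  show ?thesis
  proof (rule exists_fast_decaying_solution[OF dim(1) p(1) sub R0 c(1)])
    show "real N * \<psi> r ^ (N - 1) * \<psi>' r / \<psi> r ^ N \<ge> 2 * c" if "r \<ge> R0" for r by (rule h[OF that])
  next
    fix \<alpha> u v R assume sol: "\<alpha> > 0" "emden p \<alpha> u v" "\<And>r. r \<ge> 0 \<Longrightarrow> u r > 0"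
      and R: "R > 0" "\<And>r. r \<ge> R \<Longrightarrow> c * u r \<le> - v r" "\<And>r. r \<ge> R \<Longrightarrow> u r powr (p - 1) \<le> c\<^sup>2 / 2"
    define U where "U = (\<lambda>x::real ^ 'n. u (norm x))"
    have "C2_function U" unfolding U_def by (rule u_C2[OF p(1) sol])
    moreover have "radial U" by (simp add: radial_def U_def)
    moreover have "U x > 0" for x using sol(3) by (simp add: U_def)
    moreover have "U \<in> H1 (model_metric \<psi>)"
      unfolding U_def by (rule ground_state_H1[OF p(1) sol N_def R(1) c(1) R(2,3)])
    moreover have "- laplace_beltrami (model_metric \<psi>) U x = \<bar>U x\<bar> powr (p - 1) * U x" for x
    proof -
      have "U x > 0" using sol(3) by (simp add: U_def)
      then have "U x powr p = \<bar>U x\<bar> powr (p - 1) * U x"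
        using powr_mult_base[of "U x" "p - 1"] by (simp add: mult.commute)
      then show ?thesis
        using laplacian[OF p(1) sol N_def, of x] unfolding U_def by simp
    qed
    ultimately show ?thesis by blast
  qed
qed

end
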